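(* Let $0\le\delta<\infty$. If there exists a bound for the mSQG nonlinearity of the form $$\left|\int_{\mathbb{R}^2}\phi(x)\,\epsilon^{\ell a}\nabla_a(-\Delta)^{-1+\delta}\theta\,\nabla_\ell\theta\,dx\right|\lesssim_\delta\|\phi\|_X\,\|\theta\|_{\dot H^{-1+\delta}}^2$$ for all $\phi\in C_c^\infty(\mathbb{R}^2)$ and all $\theta\in\mathcal{S}_0(\mathbb{R}^2)$, for some semi-norm $\|\cdot\|_X$, then we must have $\|\mathring{\nabla}^2\phi\|_{L^\infty}\lesssim_\delta\|\phi\|_X$ (for all $\phi\in C_c^\infty(\mathbb{R}^2)$).
   Context: Notation: $A\lesssim_\delta B$ means $A\le C_\delta B$ with a constant $C_\delta$ that may depend on $\delta$ but not on the functions $\phi,\theta$. Repeated indices are summed; $\epsilon^{\ell a}$ is the Levi-Civita symbol, $\epsilon^{j\ell}=-\epsilon^{\ell j}$, $\epsilon^{12}=1$. The operator $(-\Delta)^{-1+\delta}$ is the Fourier multiplier with symbol $|\xi|^{2(-1+\delta)}$. $\mathring{\nabla}^2_{j\ell}\phi=\nabla_j\nabla_\ell\phi-\tfrac12\Delta\phi\,\delta_{j\ell}$ is the trace-free part of the Hessian of $\phi$ (here $\delta_{j\ell}$ is the Kronecker delta). $\mathcal{S}_0(\mathbb{R}^2)$ is the set of Schwartz functions $f$ for which $\mathrm{supp}\,\hat f$ is a compact subset of $\mathbb{R}^2\setminus\{0\}$. Littlewood–Paley projections: $P_{\le 0}$ has Fourier multiplier $\hat\chi_{\le0}$ (a smooth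 cutoff) equal to $1$ for $|\xi|\le1/2$ and supported in $|\xi|\le1$; $P_{\le q}$ has Fourier multiplier $\hat\chi_{\le0}(2^{-q}\xi)$, and $P_q=P_{\le q+1}-P_{\le q}$, $q\in\mathbb{Z}$. The homogeneous Sobolev norm is $\|\theta\|_{\dot H^s}^2=\sum_{q\in\mathbb{Z}}(2^{sq}\|P_q\theta\|_{L^2})^2$.
   Formalization: The value δ = 1 is excluded, since there the operator is the identity, the integrand vanishes by antisymmetry of ε, and the zero semi-norm satisfies the assumed bound while the conclusion fails. *)

theory Defs
  imports "HOL-Probability.Essential_Supremum"
begin

section \<open>Smooth functions on the plane\<close>

definition nabla :: "2 \<Rightarrow> (real^2 \<Rightarrow> 'b::real_normed_vector) \<Rightarrow> real^2 \<Rightarrow> 'b" where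
  "nabla j f x = frechet_derivative f (at x) (axis j 1)"

text \<open>\<open>foldr nabla js f\<close> is the iterated partial derivative of \<open>f\<close> along the list of
  directions \<open>js\<close>. If all of these exist and are (totally) differentiable, then all of them
  are continuous, so the following is the usual class of infinitely differentiable functions.\<close>

definition smooth :: "(real^2 \<Rightarrow> 'b::real_normed_vector) \<Rightarrow> bool" where
  "smooth f \<longleftrightarrow> (\<forall>js x. foldr nabla js f differentiable (at x))"

definition supp :: "(real^2 \<Rightarrow> 'b::real_normed_vector) \<Rightarrow> (real^2) set" where
  "supp f = closure (support_on UNIV f)"

definition Cc_smooth :: "(real^2 \<Rightarrow> real) set" where
  "Cc_smooth = {\<phi>. smooth \<phi> \<and> compact (supp \<phi>)}"

definition schwartz :: "(real^2 \<Rightarrow> 'b::real_normed_vector) \<Rightarrow> bool" where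
  "schwartz f \<longleftrightarrow> smooth f \<and>
     (\<forall>k::nat. \<forall>js. bounded (range (\<lambda>x. norm x ^ k *\<^sub>R foldr nabla js f x)))"

section \<open>Fourier multipliers\<close>

text \<open>The normalisation without a factor \<open>2 * pi\<close> in the phase is the one for which
  the negative Laplacian has the symbol \<open>norm \<xi> ^ 2\<close>.\<close>

definition fourier :: "(real^2 \<Rightarrow> real) \<Rightarrow> real^2 \<Rightarrow> complex" where
  "fourier f \<xi> = (LINT x|lborel. cis (- (x \<bullet> \<xi>)) * complex_of_real (f x))"

definition fmult :: "(real^2 \<Rightarrow> real) \<Rightarrow> (real^2 \<Rightarrow> real) \<Rightarrow> real^2 \<Rightarrow> complex" where
  "fmult m f x =
     (LINT \<xi>|lborel. cis (x \<bullet> \<xi>) * (complex_of_real (m \<xi>) * fourier f \<xi>)) / (2 * pi)\<^sup>2"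

definition S0 :: "(real^2 \<Rightarrow> real) set" where
  "S0 = {f. schwartz f \<and> compact (supp (fourier f)) \<and> supp (fourier f) \<subseteq> - {0}}"

text \<open>\<open>fracLap s\<close> is the \<open>s\<close>-th power of the negative Laplacian. The value \<open>0 powr a = 0\<close> of
  the symbol at the origin is irrelevant on \<open>S0\<close>.\<close>

definition fracLap :: "real \<Rightarrow> (real^2 \<Rightarrow> real) \<Rightarrow> real^2 \<Rightarrow> complex" where
  "fracLap s f = fmult (\<lambda>\<xi>. norm \<xi> powr (2 * s)) f"

section \<open>Littlewood--Paley projections and homogeneous Sobolev norms\<close>

definition LP_cutoff :: "(real^2 \<Rightarrow> real) \<Rightarrow> bool" where
  "LP_cutoff m \<longleftrightarrow> smooth m \<and> (\<forall>\<xi>. norm \<xi> \<le> 1/2 \<longrightarrow> m \<xi> = 1) \<and> supp m \<subseteq> cball 0 1"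

definition P_le :: "(real^2 \<Rightarrow> real) \<Rightarrow> int \<Rightarrow> (real^2 \<Rightarrow> real) \<Rightarrow> real^2 \<Rightarrow> complex" where
  "P_le m q f = fmult (\<lambda>\<xi>. m ((2 powi (- q)) *\<^sub>R \<xi>)) f"

definition P_at :: "(real^2 \<Rightarrow> real) \<Rightarrow> int \<Rightarrow> (real^2 \<Rightarrow> real) \<Rightarrow> real^2 \<Rightarrow> complex" where
  "P_at m q f x = P_le m (q + 1) f x - P_le m q f x"

definition L2_norm :: "(real^2 \<Rightarrow> complex) \<Rightarrow> real" where
  "L2_norm f = sqrt (LINT x|lborel. (cmod (f x))\<^sup>2)"

text \<open>For \<open>f\<close> in \<open>S0\<close> only finitely many terms of the sum are nonzero, and each
  \<open>P_at m q f\<close> is square integrable, so no default value of a divergent sum or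
  integral is involved.\<close>

definition Hdot_norm :: "(real^2 \<Rightarrow> real) \<Rightarrow> real \<Rightarrow> (real^2 \<Rightarrow> real) \<Rightarrow> real" where
  "Hdot_norm m s f =
     sqrt (\<Sum>\<^sub>\<infinity>q\<in>(UNIV::int set). (2 powr (s * real_of_int q) * L2_norm (P_at m q f))\<^sup>2)"

section \<open>The mSQG nonlinearity\<close>

definition levi_civita :: "2 \<Rightarrow> 2 \<Rightarrow> real" where
  "levi_civita l a = (if l = 1 \<and> a = 2 then 1 else if l = 2 \<and> a = 1 then -1 else 0)"

text \<open>For \<open>\<delta> = 1\<close> the operator \<open>fracLap (-1 + \<delta>)\<close> is the identity on \<open>S0\<close>; then both gradients
  below coincide and the contraction with the antisymmetric symbol vanishes identically. Every
  seminorm, even the zero one, therefore admits the bound on the nonlinearity when \<open>\<delta> = 1\<close>, and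
  nothing can be concluded from it. This is why \<open>\<delta> \<noteq> 1\<close> has to be assumed.\<close>

definition mSQG_form :: "real \<Rightarrow> (real^2 \<Rightarrow> real) \<Rightarrow> (real^2 \<Rightarrow> real) \<Rightarrow> complex" where
  "mSQG_form \<delta> \<phi> \<theta> = (LINT x|lborel. complex_of_real (\<phi> x) *
     (\<Sum>l\<in>UNIV. \<Sum>a\<in>UNIV. complex_of_real (levi_civita l a) *
        nabla a (fracLap (-1 + \<delta>) \<theta>) x * complex_of_real (nabla l \<theta> x)))"

section \<open>Seminorms and the trace-free Hessian\<close>

definition seminorm_on :: "(real^2 \<Rightarrow> real) set \<Rightarrow> ((real^2 \<Rightarrow> real) \<Rightarrow> real) \<Rightarrow> bool" where
  "seminorm_on V X \<longleftrightarrow>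
     (\<forall>f\<in>V. 0 \<le> X f) \<and>
     (\<forall>c. \<forall>f\<in>V. X (\<lambda>x. c * f x) = \<bar>c\<bar> * X f) \<and>
     (\<forall>f\<in>V. \<forall>g\<in>V. X (\<lambda>x. f x + g x) \<le> X f + X g)"

definition laplacian :: "(real^2 \<Rightarrow> real) \<Rightarrow> real^2 \<Rightarrow> real" where
  "laplacian f x = (\<Sum>j\<in>UNIV. nabla j (nabla j f) x)"

definition tracefree_hessian :: "(real^2 \<Rightarrow> real) \<Rightarrow> real^2 \<Rightarrow> real^2^2" where
  "tracefree_hessian f x =
     (\<chi> j l. nabla j (nabla l f) x - 1/2 * laplacian f x * (if j = l then 1 else 0))"

text \<open>The norm on matrices is the Frobenius norm.\<close>

definition Linf_norm :: "(real^2 \<Rightarrow> real^2^2) \<Rightarrow> ereal" where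
  "Linf_norm F = esssup lborel (\<lambda>x. ereal (norm (F x)))"

end

theory Submission
  imports Defs "HOL-Probability.Characteristic_Functions" "HOL-Probability.Sinc_Integral"
begin

text \<open>Put \<open>s = \<delta> - 1\<close>. On the Fourier side the nonlinearity is a quadratic form in the
  transform of \<open>\<theta>\<close>. Exchanging the two frequencies \<open>\<xi>\<close> and \<open>\<eta>\<close> changes the sign of their cross
  product, so only the antisymmetric part of \<open>norm \<xi> powr (2 * s)\<close> survives, and the kernel is
  \<open>1/2 * (\<xi> \<times> \<eta>) * (norm \<xi> powr (2 * s) - norm \<eta> powr (2 * s))\<close> times the transform of \<open>\<phi>\<close> at
  \<open>\<xi> + \<eta>\<close> (\<open>mSQG_form_eq_kernel\<close>).

  Test this with wave packets: for a smooth compactly supported profile \<open>G\<close> and a unit vector \<open>w\<close>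
  let the transform of \<open>\<theta>\<close> consist of \<open>G\<close> moved to the frequency \<open>l *\<^sub>R w\<close> and its reflected
  conjugate at \<open>- l *\<^sub>R w\<close>. If \<open>\<xi>\<close> and \<open>\<eta>\<close> lie near the same point, then \<open>\<xi> + \<eta>\<close> is of size
  \<open>2 * l\<close>, where the transform of \<open>\<phi>\<close> is negligible. If they lie near opposite points, then
  \<open>\<zeta> = \<xi> + \<eta>\<close> stays bounded, the cross product is about \<open>l * (w \<times> \<zeta>)\<close> and the difference of the
  symbols about \<open>2 * s * l powr (2 * s - 1) * (w \<bullet> \<zeta>)\<close>. The factor \<open>(w \<times> \<zeta>) * (w \<bullet> \<zeta>)\<close> is the
  symbol of a second derivative, so \<open>l powr (-2 * s)\<close> times the nonlinearity tends to \<open>-2 * s\<close>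
  times the integral of \<open>\<bar>G\<^sup>\<or>\<bar>\<^sup>2\<close> against the derivative of \<open>\<phi>\<close> in the direction \<open>w\<close> and the one
  orthogonal to it (\<open>mSQG_form_packet_limit\<close>); here \<open>G\<^sup>\<or>\<close> is the inverse transform of \<open>G\<close>.

  When \<open>l\<close> is a power of \<open>2\<close>, the packet meets only three Littlewood--Paley shells, and the
  Plancherel identity bounds its squared homogeneous Sobolev norm by a constant times
  \<open>l powr (2 * s)\<close> times the integral of \<open>\<bar>G\<^sup>\<or>\<bar>\<^sup>2\<close> (\<open>Hdot_norm_packet_le\<close>). In the limit the powers
  of \<open>l\<close> cancel and \<open>s \<noteq> 0\<close> may be divided out. Letting \<open>\<bar>G\<^sup>\<or>\<bar>\<^sup>2\<close> concentrate at a point makes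
  the bound pointwise (\<open>pointwise_from_averages\<close>), and the directions \<open>e\<^sub>1\<close>, \<open>e\<^sub>2\<close> and
  \<open>(e\<^sub>1 + e\<^sub>2) / sqrt 2\<close> give all entries of the trace-free Hessian.\<close>

section \<open>Closure properties of smooth functions\<close>

lemma nabla_eq:
  assumes "(f has_derivative D) (at x)"
  shows "nabla j f x = D (axis j 1)"
  unfolding nabla_def by (simp add: frechet_derivative_at[OF assms, symmetric])

text \<open>A class of differentiable functions that is stable under partial derivatives consists of
  smooth functions.\<close>

lemma smooth_coinduct:
  assumes "P f"
    and step: "\<And>f. P f \<Longrightarrow> (\<forall>x. f differentiable (at x)) \<and> (\<forall>j. P (nabla j f))"
  shows "smooth f"
proof -
  have "P (foldr nabla js f)" for js
    by (induction js) (use assms in auto)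
  with step show ?thesis unfolding smooth_def by blast
qed

lemma smooth_differentiable:
  assumes "smooth f"
  shows "f differentiable (at x)"
  using assms[unfolded smooth_def, rule_format, of "[]" x] by simp

lemma smooth_nabla:
  assumes "smooth f"
  shows "smooth (nabla j f)"
  unfolding smooth_def
proof (intro allI)
  fix js x
  show "foldr nabla js (nabla j f) differentiable (at x)"
    using assms[unfolded smooth_def, rule_format, of "js @ [j]" x] by simp
qed

lemma smooth_continuous: "smooth f \<Longrightarrow> continuous_on S f"
  by (simp add: continuous_at_imp_continuous_on differentiable_imp_continuous_within smooth_differentiable)

lemma smooth_has_derivative:
  "smooth f \<Longrightarrow> (f has_derivative frechet_derivative f (at x)) (at x)"
  using frechet_derivative_works smooth_differentiable by blast

lemma nabla_add:
  assumes "smooth f" "smooth g"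
  shows "nabla j (\<lambda>x. f x + g x) = (\<lambda>x. nabla j f x + nabla j g x)"
proof
  fix x
  show "nabla j (\<lambda>x. f x + g x) x = nabla j f x + nabla j g x"
    by (subst nabla_eq[OF has_derivative_add[OF smooth_has_derivative smooth_has_derivative]])
      (use assms in \<open>auto simp: nabla_def\<close>)
qed

lemma smooth_add:
  assumes "smooth f" "smooth g"
  shows "smooth (\<lambda>x. f x + g x)"
proof (rule smooth_coinduct[of "\<lambda>F. \<exists>f g. smooth f \<and> smooth g \<and> F = (\<lambda>x. f x + g x)"])
  fix F :: "real^2 \<Rightarrow> 'a" assume "\<exists>f g. smooth f \<and> smooth g \<and> F = (\<lambda>x. f x + g x)"
  then obtain f g where F: "smooth f" "smooth g" "F = (\<lambda>x. f x + g x)" by blast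
  then have "F differentiable (at x)" for x
    by (simp add: differentiable_add smooth_differentiable)
  moreover have "nabla j F = (\<lambda>x. nabla j f x + nabla j g x)" for j
    using F nabla_add by blast
  ultimately show "(\<forall>x. F differentiable (at x)) \<and>
      (\<forall>j. \<exists>f g. smooth f \<and> smooth g \<and> nabla j F = (\<lambda>x. f x + g x))"
    using F smooth_nabla by blast
qed (use assms in auto)

lemma nabla_mult:
  fixes f g :: "real^2 \<Rightarrow> 'b::real_normed_algebra"
  assumes "smooth f" "smooth g"
  shows "nabla j (\<lambda>x. f x * g x) = (\<lambda>x. f x * nabla j g x + nabla j f x * g x)"
proof
  fix x
  show "nabla j (\<lambda>x. f x * g x) x = f x * nabla j g x + nabla j f x * g x"
    by (subst nabla_eq[OF has_derivative_mult[OF smooth_has_derivative smooth_has_derivative]])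
      (use assms in \<open>auto simp: nabla_def\<close>)
qed

text \<open>The derivatives of a product of smooth functions are finite sums of such products; this is
  the closure under which the coinduction for products runs.\<close>

inductive sum_of_products :: "(real^2 \<Rightarrow> 'b::real_normed_algebra) \<Rightarrow> bool" where
  mult: "smooth f \<Longrightarrow> smooth g \<Longrightarrow> sum_of_products (\<lambda>x. f x * g x)"
| add: "sum_of_products f \<Longrightarrow> sum_of_products g \<Longrightarrow> sum_of_products (\<lambda>x. f x + g x)"

lemma sum_of_products_nabla:
  "sum_of_products F \<Longrightarrow> (\<forall>x. F differentiable (at x)) \<and> (\<forall>j. sum_of_products (nabla j F))"
proof (induction rule: sum_of_products.induct)
  case (mult f g)
  then have "(\<lambda>x. f x * g x) differentiable (at x)" for x
    by (intro differentiable_mult smooth_differentiable)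
  moreover have "sum_of_products (nabla j (\<lambda>x. f x * g x))" for j
    unfolding nabla_mult[OF mult]
    by (intro sum_of_products.intros smooth_nabla mult)
  ultimately show ?case by blast
next
  case (add f g)
  have "nabla j (\<lambda>x. f x + g x) = (\<lambda>x. nabla j f x + nabla j g x)" for j
  proof
    fix x
    show "nabla j (\<lambda>x. f x + g x) x = nabla j f x + nabla j g x"
      by (subst nabla_eq[OF has_derivative_add])
        (use add.IH in \<open>auto simp: nabla_def frechet_derivative_works[symmetric]\<close>)
  qed
  with add show ?case by (auto intro: sum_of_products.add)
qed

lemma smooth_mult:
  fixes f g :: "real^2 \<Rightarrow> 'b::real_normed_algebra"
  assumes "smooth f" "smooth g"
  shows "smooth (\<lambda>x. f x * g x)"
proof (rule smooth_coinduct[of sum_of_products])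
  show "sum_of_products (\<lambda>x. f x * g x)" using assms by (rule sum_of_products.mult)
qed (rule sum_of_products_nabla)

lemma nabla_bounded_linear:
  assumes "bounded_linear L" "f differentiable (at x)"
  shows "nabla j (\<lambda>x. L (f x)) x = L (nabla j f x)"
  by (subst nabla_eq[OF bounded_linear.has_derivative[OF assms(1)]])
    (use assms frechet_derivative_works in \<open>auto simp: nabla_def\<close>)

lemma smooth_bounded_linear:
  assumes "bounded_linear L" "smooth f"
  shows "smooth (\<lambda>x. L (f x))"
proof (rule smooth_coinduct[of "\<lambda>F. \<exists>f. smooth f \<and> F = (\<lambda>x. L (f x))"])
  fix F assume "\<exists>f. smooth f \<and> F = (\<lambda>x. L (f x))"
  then obtain f where f: "smooth f" "F = (\<lambda>x. L (f x))" by blast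
  have "nabla j F = (\<lambda>x. L (nabla j f x))" for j
    using nabla_bounded_linear[OF assms(1)] smooth_differentiable[OF f(1)] f(2) by blast
  moreover have "F differentiable (at x)" for x
    unfolding f(2) using bounded_linear.has_derivative[OF assms(1) smooth_has_derivative[OF f(1)]]
    by (auto simp: differentiable_def)
  ultimately show "(\<forall>x. F differentiable (at x)) \<and> (\<forall>j. \<exists>f. smooth f \<and> nabla j F = (\<lambda>x. L (f x)))"
    using f smooth_nabla by blast
qed (use assms in auto)

lemma smooth_affine:
  assumes "smooth f"
  shows "smooth (\<lambda>x. f (c *\<^sub>R x + b))"
proof (rule smooth_coinduct[of "\<lambda>F. \<exists>f. smooth f \<and> F = (\<lambda>x. f (c *\<^sub>R x + b))"])
  fix F :: "real^2 \<Rightarrow> 'a" assume "\<exists>f. smooth f \<and> F = (\<lambda>x. f (c *\<^sub>R x + b))"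
  then obtain f where f: "smooth f" "F = (\<lambda>x. f (c *\<^sub>R x + b))" by blast
  have d: "(F has_derivative (\<lambda>h. frechet_derivative f (at (c *\<^sub>R x + b)) (c *\<^sub>R h))) (at x)" for x
    unfolding f(2)
    by (rule has_derivative_compose[OF _ smooth_has_derivative[OF f(1)], of "\<lambda>x. c *\<^sub>R x + b"])
      (auto intro!: derivative_eq_intros)
  have "nabla j F = (\<lambda>x. (\<lambda>x. c *\<^sub>R nabla j f x) (c *\<^sub>R x + b))" for j
  proof
    fix x
    have "linear (frechet_derivative f (at (c *\<^sub>R x + b)))"
      using smooth_has_derivative[OF f(1)] has_derivative_linear by blast
    then show "nabla j F x = (\<lambda>x. c *\<^sub>R nabla j f x) (c *\<^sub>R x + b)"
      unfolding nabla_eq[OF d] by (simp add: nabla_def linear_scale)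
  qed
  moreover have "smooth (\<lambda>x. c *\<^sub>R nabla j f x)" for j
    using smooth_bounded_linear[OF bounded_linear_scaleR_right smooth_nabla[OF f(1)]] .
  ultimately show "(\<forall>x. F differentiable (at x)) \<and> (\<forall>j. \<exists>f. smooth f \<and> nabla j F = (\<lambda>x. f (c *\<^sub>R x + b)))"
    using d unfolding differentiable_def by blast
qed (use assms in auto)

lemma nabla_const: "nabla j (\<lambda>x. c) = (\<lambda>x. 0)"
  by (rule ext) (simp add: nabla_eq[OF has_derivative_const])

lemma smooth_const: "smooth (\<lambda>x. c)"
  by (rule smooth_coinduct[of "\<lambda>F. \<exists>c. F = (\<lambda>x. c)"]) (auto simp: nabla_const)

lemma smooth_component: "smooth (\<lambda>x::real^2. complex_of_real (x $ j))"
proof (rule smooth_coinduct[of "\<lambda>F. smooth F \<or> F = (\<lambda>x. complex_of_real (x $ j))"])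
  fix F assume disj: "smooth F \<or> F = (\<lambda>x. complex_of_real (x $ j))"
  have d: "((\<lambda>x. complex_of_real (x $ j)) has_derivative (\<lambda>h. complex_of_real (h $ j))) (at x)" for x
    by (intro bounded_linear_imp_has_derivative bounded_linear_compose[OF bounded_linear_of_real]
        bounded_linear_vec_nth)
  from disj show "(\<forall>x. F differentiable (at x)) \<and>
      (\<forall>i. smooth (nabla i F) \<or> nabla i F = (\<lambda>x. complex_of_real (x $ j)))"
  proof
    assume F: "F = (\<lambda>x. complex_of_real (x $ j))"
    have "nabla i F = (\<lambda>x. complex_of_real (axis i 1 $ j))" for i
      unfolding F by (rule ext) (simp add: nabla_eq[OF d])
    then show ?thesis using d F by (auto simp: differentiable_def smooth_const)
  qed (auto intro: smooth_differentiable smooth_nabla)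
qed auto

lemma has_derivative_cis_inner:
  "((\<lambda>x. c * cis (b \<bullet> x)) has_derivative (\<lambda>h. (c * \<i> * (b \<bullet> h)) * cis (b \<bullet> x))) (at x)"
proof -
  have *: "((\<lambda>x. \<i> * complex_of_real (b \<bullet> x)) has_derivative (\<lambda>h. \<i> * complex_of_real (b \<bullet> h))) (at x)"
    by (intro bounded_linear_imp_has_derivative bounded_linear_compose[OF bounded_linear_mult_right]
        bounded_linear_compose[OF bounded_linear_of_real] bounded_linear_inner_right)
  have "((\<lambda>x. c * exp (\<i> * of_real (b \<bullet> x))) has_derivative
      (\<lambda>h. c * (exp (\<i> * of_real (b \<bullet> x)) * (\<i> * of_real (b \<bullet> h))))) (at x)"
    by (intro has_derivative_mult_right has_derivative_compose[OF *]
        has_field_derivative_imp_has_derivative[OF DERIV_exp])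
  then show ?thesis by (simp add: cis_conv_exp mult_ac)
qed

lemma nabla_cis_inner:
  "nabla j (\<lambda>x. c * cis (b \<bullet> x)) = (\<lambda>x. (c * \<i> * (b $ j)) * cis (b \<bullet> x))"
  by (rule ext) (simp add: nabla_eq[OF has_derivative_cis_inner] inner_axis)

lemma smooth_cis_inner: "smooth (\<lambda>x. c * cis (b \<bullet> x))"
proof (rule smooth_coinduct[of "\<lambda>F. \<exists>c. F = (\<lambda>x. c * cis (b \<bullet> x))"])
  fix F :: "real^2 \<Rightarrow> complex" assume "\<exists>c. F = (\<lambda>x. c * cis (b \<bullet> x))"
  then show "(\<forall>x. F differentiable (at x)) \<and> (\<forall>j. \<exists>c. nabla j F = (\<lambda>x. c * cis (b \<bullet> x)))"
    using has_derivative_cis_inner by (auto simp: nabla_cis_inner differentiable_def)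
qed auto

text \<open>Smooth functions with bounded support, real-valued like \<open>\<phi>\<close> or complex-valued like the profiles
  of wave packets.\<close>

definition test_fun :: "(real^2 \<Rightarrow> 'b::real_normed_vector) \<Rightarrow> bool" where
  "test_fun G \<longleftrightarrow> smooth G \<and> (\<exists>R. \<forall>x. R < norm x \<longrightarrow> G x = 0)"

lemma test_funI:
  assumes "smooth G" "\<And>x. R < norm x \<Longrightarrow> G x = 0"
  shows "test_fun G"
  unfolding test_fun_def using assms by auto

lemma test_funE:
  assumes "test_fun G"
  obtains R where "0 < R" "\<And>x. R < norm x \<Longrightarrow> G x = 0"
proof -
  obtain R where "\<forall>x. R < norm x \<longrightarrow> G x = 0" using assms unfolding test_fun_def by auto
  then have "0 < max R 1" "\<And>x. max R 1 < norm x \<Longrightarrow> G x = 0" by auto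
  then show ?thesis by (rule that)
qed

lemma test_fun_smooth: "test_fun G \<Longrightarrow> smooth G"
  by (simp add: test_fun_def)

lemma test_fun_nabla:
  fixes G :: "real^2 \<Rightarrow> 'b::real_normed_vector"
  assumes "test_fun G"
  shows "test_fun (nabla j G)"
proof -
  obtain R where "0 < R" and R: "\<And>x. R < norm x \<Longrightarrow> G x = 0"
    using assms by (rule test_funE) (rule that)
  show ?thesis
  proof (rule test_funI[OF smooth_nabla[OF test_fun_smooth[OF assms]]])
    fix x :: "real^2" assume x: "R < norm x"
    have "open {x::real^2. R < norm x}" by (intro open_Collect_less continuous_intros)
    then have "(G has_derivative (\<lambda>_. 0)) (at x)"
    proof (rule has_derivative_transform_within_open[OF has_derivative_const])
      show "x \<in> {x. R < norm x}" using x by simp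
      show "0 = G y" if "y \<in> {x. R < norm x}" for y using R[of y] that by simp
    qed
    then show "nabla j G x = 0" by (rule nabla_eq)
  qed
qed

lemma test_fun_mult:
  fixes f g :: "real^2 \<Rightarrow> 'b::real_normed_algebra"
  assumes "smooth f" "test_fun g"
  shows "test_fun (\<lambda>x. f x * g x)"
proof -
  obtain R where "0 < R" and R: "\<And>x. R < norm x \<Longrightarrow> g x = 0"
    using assms(2) by (rule test_funE) (rule that)
  show ?thesis
    by (rule test_funI[OF smooth_mult[OF assms(1) test_fun_smooth[OF assms(2)]], of R])
      (simp add: R)
qed

lemma test_fun_add:
  assumes "test_fun f" "test_fun g"
  shows "test_fun (\<lambda>x. f x + g x)"
proof -
  obtain R where "0 < R" and R: "\<And>x. R < norm x \<Longrightarrow> f x = 0"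
    using assms(1) by (rule test_funE) (rule that)
  obtain S where "0 < S" and S: "\<And>x. S < norm x \<Longrightarrow> g x = 0"
    using assms(2) by (rule test_funE) (rule that)
  show ?thesis
    by (rule test_funI[OF smooth_add[OF assms[THEN test_fun_smooth]], of "max R S"])
      (simp add: R S)
qed

lemma test_fun_bounded_linear:
  assumes "bounded_linear L" "test_fun f"
  shows "test_fun (\<lambda>x. L (f x))"
proof -
  obtain R where "0 < R" and R: "\<And>x. R < norm x \<Longrightarrow> f x = 0"
    using assms(2) by (rule test_funE) (rule that)
  show ?thesis
    by (rule test_funI[OF smooth_bounded_linear[OF assms(1) test_fun_smooth[OF assms(2)]], of R])
      (simp add: R linear_0[OF bounded_linear.linear[OF assms(1)]])
qed

lemma test_fun_affine:
  assumes "test_fun f" "c \<noteq> 0"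
  shows "test_fun (\<lambda>x. f (c *\<^sub>R x + b))"
proof -
  obtain R where "0 < R" and R: "\<And>x. R < norm x \<Longrightarrow> f x = 0"
    using assms(1) by (rule test_funE) (rule that)
  show ?thesis
  proof (rule test_funI[OF smooth_affine[OF test_fun_smooth[OF assms(1)]]], rule R)
    fix x :: "real^2" assume "(R + norm b) / \<bar>c\<bar> < norm x"
    then have "R + norm b < norm (c *\<^sub>R x)" using assms(2) by (simp add: field_simps)
    also have "\<dots> \<le> norm (c *\<^sub>R x + b) + norm b"
      using norm_triangle_ineq4[of "c *\<^sub>R x + b" b] by simp
    finally show "R < norm (c *\<^sub>R x + b)" by simp
  qed
qed

lemma test_fun_bounded:
  assumes "test_fun G"
  obtains B where "0 < B" "\<And>x. norm (G x) \<le> B"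
proof -
  obtain R where "0 < R" and R: "\<And>x. R < norm x \<Longrightarrow> G x = 0"
    using assms by (rule test_funE) (rule that)
  have "bounded (G ` cball 0 R)"
    using assms smooth_continuous
    by (intro compact_imp_bounded compact_continuous_image) (auto simp: test_fun_def)
  then obtain B where B: "0 < B" "\<forall>x\<in>cball 0 R. norm (G x) \<le> B"
    by (auto simp: bounded_pos)
  have "norm (G x) \<le> B" for x using B R[of x] by (cases "norm x \<le> R") auto
  then show ?thesis using B(1) that by blast
qed

lemma test_fun_integrable:
  fixes G :: "real^2 \<Rightarrow> 'b::{banach, second_countable_topology}"
  assumes "test_fun G"
  shows "integrable lborel G"
proof -
  obtain R where "0 < R" and R: "\<And>x. R < norm x \<Longrightarrow> G x = 0"
    using assms by (rule test_funE) (rule that)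
  have "integrable lborel (\<lambda>x. indicator (cball 0 R) x *\<^sub>R G x)"
    using assms smooth_continuous by (intro borel_integrable_compact) (auto simp: test_fun_def)
  also have "(\<lambda>x. indicator (cball 0 R) x *\<^sub>R G x) = G"
    using R by (fastforce simp: indicator_def)
  finally show ?thesis .
qed

section \<open>Translations, dilations and integrals of derivatives\<close>

lemma lborel_integral_affine:
  fixes f :: "'a::euclidean_space \<Rightarrow> 'b::{banach, second_countable_topology}"
  assumes [measurable]: "f \<in> borel_measurable borel" and c: "c \<noteq> 0"
  shows "(\<integral>x. f (t + c *\<^sub>R x) \<partial>lborel) = (1 / \<bar>c\<bar> ^ DIM('a)) *\<^sub>R (\<integral>x. f x \<partial>lborel)"
proof -
  have "(\<integral>x. f x \<partial>lborel) = (\<integral>x. f x \<partial>density (distr lborel borel (\<lambda>x. t + c *\<^sub>R x)) (\<lambda>_. \<bar>c\<bar> ^ DIM('a)))"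
    using lborel_affine[OF c, of t] by simp
  also have "\<dots> = \<bar>c\<bar> ^ DIM('a) *\<^sub>R (\<integral>x. f (t + c *\<^sub>R x) \<partial>lborel)"
    by (subst integral_density) (auto simp: integral_distr)
  finally show ?thesis using c by simp
qed

lemma lborel_integral_translate:
  fixes f :: "'a::euclidean_space \<Rightarrow> 'b::{banach, second_countable_topology}"
  assumes "f \<in> borel_measurable borel"
  shows "(\<integral>x. f (t + x) \<partial>lborel) = (\<integral>x. f x \<partial>lborel)"
  using lborel_integral_affine[OF assms, of 1 t] by simp

lemma lborel_integrable_translate:
  fixes f :: "'a::euclidean_space \<Rightarrow> 'b::{banach, second_countable_topology}"
  assumes "integrable lborel f"
  shows "integrable lborel (\<lambda>x. f (t + x))"
proof -
  have "integrable (distr lborel borel ((+) t)) f"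
    using assms by (simp add: lborel_distr_plus)
  then show ?thesis using borel_measurable_integrable[OF assms]
    by (subst (asm) integrable_distr_eq) auto
qed

text \<open>The difference quotients have integral \<open>0\<close> by translation invariance, and they converge
  dominatedly to the derivative.\<close>

lemma integral_nabla_eq_0:
  fixes F :: "real^2 \<Rightarrow> complex"
  assumes "test_fun F"
  shows "(\<integral>x. nabla j F x \<partial>lborel) = 0"
proof -
  let ?e = "axis j 1 :: real^2"
  obtain R where "0 < R" and R: "\<And>x. R < norm x \<Longrightarrow> F x = 0"
    using assms by (rule test_funE) (rule that)
  have F: "smooth F" by (rule test_fun_smooth[OF assms])
  obtain B where B: "0 < B" "\<And>x. norm (nabla j F x) \<le> B"
    using test_fun_bounded[OF test_fun_nabla[OF assms]] by blast
  have meas[measurable]: "F \<in> borel_measurable borel" "nabla j F \<in> borel_measurable borel"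
    using F smooth_nabla by (auto intro!: borel_measurable_continuous_onI smooth_continuous)
  have line: "((\<lambda>t. F (x + t *\<^sub>R ?e)) has_vector_derivative nabla j F (x + t *\<^sub>R ?e)) (at t within S)"
    for x t S
  proof -
    have "((\<lambda>t. F (x + t *\<^sub>R ?e)) has_derivative
        (\<lambda>h. frechet_derivative F (at (x + t *\<^sub>R ?e)) (h *\<^sub>R ?e))) (at t within S)"
      by (rule has_derivative_compose[OF _ smooth_has_derivative[OF F], of "\<lambda>t. x + t *\<^sub>R ?e"])
        (auto intro!: derivative_eq_intros)
    moreover have "linear (frechet_derivative F (at (x + t *\<^sub>R ?e)))"
      using smooth_has_derivative[OF F] has_derivative_linear by blast
    ultimately show ?thesis
      by (simp add: has_vector_derivative_def nabla_def linear_scale)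
  qed
  define Q where "Q n x = real (Suc n) *\<^sub>R (F (x + (1 / real (Suc n)) *\<^sub>R ?e) - F x)" for n x
  have Qbound: "norm (Q n x) \<le> B * indicator (cball 0 (\<bar>R\<bar> + 1)) x" for n x
  proof (cases "norm x \<le> \<bar>R\<bar> + 1")
    case True
    let ?t = "1 / real (Suc n)"
    have "norm (F (x + ?t *\<^sub>R ?e) - F (x + 0 *\<^sub>R ?e)) \<le> B * norm (?t - 0)"
    proof (rule differentiable_bound[of "{0..?t}" "\<lambda>t. F (x + t *\<^sub>R ?e)" "\<lambda>t h. h *\<^sub>R nabla j F (x + t *\<^sub>R ?e)"])
      show "((\<lambda>t. F (x + t *\<^sub>R ?e)) has_derivative (\<lambda>h. h *\<^sub>R nabla j F (x + u *\<^sub>R ?e))) (at u within {0..?t})" for u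
        using line by (simp add: has_vector_derivative_def)
      show "onorm (\<lambda>h. h *\<^sub>R nabla j F (x + u *\<^sub>R ?e)) \<le> B" for u
        by (rule onorm_bound) (use B in \<open>auto simp: mult.commute[of B] intro: mult_left_mono\<close>)
    qed auto
    then have "real (Suc n) * norm (F (x + ?t *\<^sub>R ?e) - F x) \<le> B" by (simp add: field_simps)
    then show ?thesis using True by (simp add: Q_def indicator_def del: of_nat_Suc)
  next
    case False
    have le: "1 / real (Suc n) \<le> 1" by simp
    have "norm ((1 / real (Suc n)) *\<^sub>R ?e) = 1 / real (Suc n)" by (simp add: norm_axis_1)
    with le have "norm ((1 / real (Suc n)) *\<^sub>R ?e) \<le> 1" by linarith
    then have "R < norm (x + (1 / real (Suc n)) *\<^sub>R ?e)"
      using False norm_triangle_ineq4[of "x + (1 / real (Suc n)) *\<^sub>R ?e" "(1 / real (Suc n)) *\<^sub>R ?e"]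
      unfolding add_diff_cancel_right' by linarith
    then show ?thesis using False R by (simp add: Q_def)
  qed
  have Qlim: "(\<lambda>n. Q n x) \<longlonglongrightarrow> nabla j F x" for x
  proof -
    have "((\<lambda>t. F (x + t *\<^sub>R ?e)) has_derivative (\<lambda>h. h *\<^sub>R nabla j F x)) (at 0)"
      using line[of x 0 UNIV] by (simp add: has_vector_derivative_def)
    then have "(\<lambda>h. norm (F (x + h *\<^sub>R ?e) - F x - h *\<^sub>R nabla j F x) / norm h) \<midarrow>0\<rightarrow> 0"
      by (simp add: has_derivative_at)
    moreover have "filterlim (\<lambda>n. 1 / real (Suc n)) (at 0) sequentially"
      using LIMSEQ_inverse_real_of_nat by (auto simp: filterlim_at inverse_eq_divide)
    ultimately have "(\<lambda>n. norm (F (x + (1 / real (Suc n)) *\<^sub>R ?e) - F x - (1 / real (Suc n)) *\<^sub>R nabla j F x)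
        / norm (1 / real (Suc n))) \<longlonglongrightarrow> 0"
      by (rule filterlim_compose)
    moreover have "norm (F (x + (1 / real (Suc n)) *\<^sub>R ?e) - F x - (1 / real (Suc n)) *\<^sub>R nabla j F x)
        / norm (1 / real (Suc n)) = norm (Q n x - nabla j F x)" for n
    proof -
      have "Q n x - nabla j F x = real (Suc n) *\<^sub>R
          (F (x + (1 / real (Suc n)) *\<^sub>R ?e) - F x - (1 / real (Suc n)) *\<^sub>R nabla j F x)"
        by (simp add: Q_def scaleR_diff_right del: of_nat_Suc)
      then show ?thesis by (simp del: of_nat_Suc)
    qed
    ultimately show ?thesis
      by (simp add: tendsto_norm_zero_iff LIM_zero_iff)
  qed
  have "(\<lambda>n. \<integral>x. Q n x \<partial>lborel) \<longlonglongrightarrow> (\<integral>x. nabla j F x \<partial>lborel)"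
  proof (rule integral_dominated_convergence)
    show "integrable lborel (\<lambda>x. B * indicator (cball 0 (\<bar>R\<bar> + 1)) x :: real)"
      by (intro integrable_mult_right integrable_real_indicator emeasure_lborel_cball_finite) auto
  qed (use Qbound Qlim in \<open>auto simp: Q_def\<close>)
  moreover have "(\<integral>x. Q n x \<partial>lborel) = 0" for n
  proof -
    have i: "integrable lborel F" by (rule test_fun_integrable[OF assms])
    have "(\<integral>x. F (x + (1 / real (Suc n)) *\<^sub>R ?e) \<partial>lborel) = (\<integral>x. F x \<partial>lborel)"
      using lborel_integral_translate[of F "(1 / real (Suc n)) *\<^sub>R ?e"] by (simp add: add.commute)
    moreover have "integrable lborel (\<lambda>x. F (x + (1 / real (Suc n)) *\<^sub>R ?e))"
      using lborel_integrable_translate[OF i, of "(1 / real (Suc n)) *\<^sub>R ?e"] by (simp add: add.commute)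
    ultimately show ?thesis using i by (simp add: Q_def del: of_nat_Suc)
  qed
  ultimately show ?thesis by (simp add: LIMSEQ_const_iff)
qed

section \<open>The Fourier transform of compactly supported functions\<close>

text \<open>The inverse Fourier transform without its factor \<open>1 / (2 * pi)\<^sup>2\<close>.\<close>

definition ift :: "(real^2 \<Rightarrow> complex) \<Rightarrow> real^2 \<Rightarrow> complex" where
  "ift a x = (LINT \<xi>|lborel. cis (x \<bullet> \<xi>) * a \<xi>)"

text \<open>Integrable functions that vanish outside some ball. Unlike smoothness, this survives the
  multiplication with any bounded measurable symbol, such as \<open>norm \<xi> powr (2 * s)\<close> away from the
  origin, and it is all that is needed to differentiate \<open>ift a\<close> under the integral sign.\<close>

definition cs_int :: "(real^2 \<Rightarrow> complex) \<Rightarrow> bool" where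
  "cs_int a \<longleftrightarrow> integrable lborel a \<and> (\<exists>R>0. \<forall>x. R < norm x \<longrightarrow> a x = 0)"

lemma cs_int_integrable: "cs_int a \<Longrightarrow> integrable lborel a"
  by (simp add: cs_int_def)

lemma test_fun_cs_int: "test_fun G \<Longrightarrow> cs_int G"
  unfolding cs_int_def by (metis test_fun_integrable test_funE)

lemma cs_int_mult:
  assumes a: "cs_int a" and g: "g \<in> borel_measurable borel"
    and B: "\<And>x. a x \<noteq> 0 \<Longrightarrow> norm (g x) \<le> B"
  shows "cs_int (\<lambda>x. g x * a x)"
proof -
  have i: "integrable lborel a" by (rule cs_int_integrable[OF a])
  have "integrable lborel (\<lambda>x. g x * a x)"
  proof (rule Bochner_Integration.integrable_bound[of _ "\<lambda>x. B * norm (a x)"])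
    show "AE x in lborel. norm (g x * a x) \<le> norm (B * norm (a x))"
    proof (intro AE_I2)
      fix x show "norm (g x * a x) \<le> norm (B * norm (a x))"
      proof (cases "a x = 0")
        case False
        have "norm (g x) * norm (a x) \<le> \<bar>B\<bar> * norm (a x)"
          using B[OF False] by (intro mult_right_mono) auto
        then show ?thesis by (simp add: norm_mult abs_mult)
      qed simp
    qed
  qed (use i g in auto)
  then show ?thesis using a unfolding cs_int_def by (metis mult_zero_right)
qed

lemma cs_int_continuous_mult:
  assumes a: "cs_int a" and g: "continuous_on UNIV g"
  shows "cs_int (\<lambda>x. g x * a x)"
proof -
  obtain R where R: "\<And>x. R < norm x \<Longrightarrow> a x = 0" using a unfolding cs_int_def by blast
  have "bounded (g ` cball 0 R)"
    using continuous_on_subset[OF g]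
    by (intro compact_imp_bounded compact_continuous_image) auto
  then obtain B where B: "\<forall>x\<in>cball 0 R. norm (g x) \<le> B" by (auto simp: bounded_pos)
  show ?thesis
  proof (rule cs_int_mult[OF a])
    show "norm (g x) \<le> B" if "a x \<noteq> 0" for x
      using R[of x] B that by (cases "norm x \<le> R") auto
  qed (use g in \<open>rule borel_measurable_continuous_onI\<close>)
qed

lemma ift_integrand_integrable:
  assumes "integrable lborel a"
  shows "integrable lborel (\<lambda>\<xi>. cis (x \<bullet> \<xi>) * a \<xi>)"
proof (rule Bochner_Integration.integrable_bound[OF assms])
  have [measurable]: "a \<in> borel_measurable borel" using borel_measurable_integrable[OF assms] by simp
  have [measurable]: "(\<lambda>\<xi>. cis (x \<bullet> \<xi>)) \<in> borel_measurable borel"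
    by (intro borel_measurable_continuous_onI continuous_intros)
  show "(\<lambda>\<xi>. cis (x \<bullet> \<xi>) * a \<xi>) \<in> borel_measurable lborel" by measurable
qed (simp add: norm_mult)

lemma norm_ift_le:
  "integrable lborel a \<Longrightarrow> cmod (ift a x) \<le> (LINT \<xi>|lborel. cmod (a \<xi>))"
  unfolding ift_def
  by (rule order_trans[OF integral_norm_bound]) (simp add: norm_mult)

lemma ift_add:
  "integrable lborel a \<Longrightarrow> integrable lborel b \<Longrightarrow> ift (\<lambda>\<xi>. a \<xi> + b \<xi>) x = ift a x + ift b x"
  unfolding ift_def by (simp add: ring_distribs ift_integrand_integrable)

lemma ift_cmult: "ift (\<lambda>\<xi>. c * a \<xi>) x = c * ift a x"
proof -
  have "ift (\<lambda>\<xi>. c * a \<xi>) x = (LINT \<xi>|lborel. c * (cis (x \<bullet> \<xi>) * a \<xi>))"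
    unfolding ift_def by (simp add: mult_ac)
  then show ?thesis by (simp add: ift_def)
qed

lemma cis_taylor_bound: "cmod (cis t - 1 - \<i> * of_real t) \<le> t\<^sup>2 / 2"
proof -
  have "fact (Suc 1) = (2::real)" by simp
  then show ?thesis
    using iexp_approx1[of t 1] by (simp add: cis_conv_exp diff_diff_eq numeral_2_eq_2)
qed

lemma ift_has_derivative:
  assumes a: "cs_int a"
  shows "(ift a has_derivative (\<lambda>h. LINT \<xi>|lborel. \<i> * of_real (h \<bullet> \<xi>) * (cis (x \<bullet> \<xi>) * a \<xi>))) (at x)"
    (is "(_ has_derivative ?D) _")
proof -
  have i: "integrable lborel a" by (rule cs_int_integrable[OF a])
  define K where "K = (LINT \<xi>|lborel. norm \<xi> ^ 2 / 2 * norm (a \<xi>))"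
  have cis_cs: "cs_int (\<lambda>\<xi>. cis (x \<bullet> \<xi>) * a \<xi>)" for x
    by (intro cs_int_continuous_mult[OF a] continuous_intros)
  have Dint: "integrable lborel (\<lambda>\<xi>. \<i> * of_real (h \<bullet> \<xi>) * (cis (x \<bullet> \<xi>) * a \<xi>))" for h
    by (intro cs_int_integrable cs_int_continuous_mult[OF cis_cs] continuous_intros)
  have 1: "integrable lborel (\<lambda>\<xi>. norm (of_real (norm \<xi> ^ n) * a \<xi>))" for n
    by (intro integrable_norm cs_int_integrable cs_int_continuous_mult[OF a] continuous_intros)
  have n1: "integrable lborel (\<lambda>\<xi>. norm \<xi> * norm (a \<xi>))"
    using 1[of 1] by (simp add: norm_mult)
  have n2: "integrable lborel (\<lambda>\<xi>. norm \<xi> ^ 2 / 2 * norm (a \<xi>))"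
    using 1[of 2] by (simp add: norm_mult norm_power)
  have lin: "bounded_linear ?D"
  proof (rule bounded_linear_intro[where K="LINT \<xi>|lborel. norm \<xi> * norm (a \<xi>)"])
    show "?D (h + k) = ?D h + ?D k" for h k
      using Dint[of h] Dint[of k]
      by (subst Bochner_Integration.integral_add[symmetric]) (auto simp: inner_add_left algebra_simps)
    show "?D (r *\<^sub>R h) = r *\<^sub>R ?D h" for r h
      by (subst integral_scaleR_right[symmetric]) (auto simp: scaleR_conv_of_real[where 'a=complex] mult_ac)
    show "norm (?D h) \<le> norm h * (LINT \<xi>|lborel. norm \<xi> * norm (a \<xi>))" for h
    proof -
      have "norm (?D h) \<le> (LINT \<xi>|lborel. norm (\<i> * of_real (h \<bullet> \<xi>) * (cis (x \<bullet> \<xi>) * a \<xi>)))"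
        by (rule integral_norm_bound)
      also have "\<dots> \<le> (LINT \<xi>|lborel. norm h * (norm \<xi> * norm (a \<xi>)))"
        using Dint[of h] n1
      proof (intro integral_mono)
        fix \<xi>
        have "\<bar>h \<bullet> \<xi>\<bar> * norm (a \<xi>) \<le> norm h * norm \<xi> * norm (a \<xi>)"
          by (intro mult_right_mono Cauchy_Schwarz_ineq2) auto
        then show "norm (\<i> * of_real (h \<bullet> \<xi>) * (cis (x \<bullet> \<xi>) * a \<xi>)) \<le> norm h * (norm \<xi> * norm (a \<xi>))"
          by (simp add: norm_mult mult_ac)
      qed auto
      finally show ?thesis by simp
    qed
  qed
  show ?thesis
  proof (rule has_derivativeI_sandwich[of 1, OF _ lin])
    show "((\<lambda>y. K * norm (y - x)) \<longlongrightarrow> 0) (at x)"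
      by (rule tendsto_eq_intros refl | simp)+
    fix y assume "y \<noteq> x"
    have eq: "ift a y - ift a x - ?D (y - x) =
        (LINT \<xi>|lborel. cis (y \<bullet> \<xi>) * a \<xi> - cis (x \<bullet> \<xi>) * a \<xi> - \<i> * of_real ((y - x) \<bullet> \<xi>) * (cis (x \<bullet> \<xi>) * a \<xi>))"
      unfolding ift_def using Dint[of "y - x"] ift_integrand_integrable[OF i] by simp
    have "norm (ift a y - ift a x - ?D (y - x)) \<le>
        (LINT \<xi>|lborel. norm (cis (y \<bullet> \<xi>) * a \<xi> - cis (x \<bullet> \<xi>) * a \<xi> - \<i> * of_real ((y - x) \<bullet> \<xi>) * (cis (x \<bullet> \<xi>) * a \<xi>)))"
      unfolding eq by (rule integral_norm_bound)
    also have "\<dots> \<le> (LINT \<xi>|lborel. (norm (y - x))\<^sup>2 * (norm \<xi> ^ 2 / 2 * norm (a \<xi>)))"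
    proof (rule integral_mono)
      show "integrable lborel (\<lambda>\<xi>. norm (cis (y \<bullet> \<xi>) * a \<xi> - cis (x \<bullet> \<xi>) * a \<xi> - \<i> * of_real ((y - x) \<bullet> \<xi>) * (cis (x \<bullet> \<xi>) * a \<xi>)))"
        using Dint[of "y - x"] ift_integrand_integrable[OF i]
        by (intro integrable_norm Bochner_Integration.integrable_diff) auto
      show "integrable lborel (\<lambda>\<xi>. (norm (y - x))\<^sup>2 * (norm \<xi> ^ 2 / 2 * norm (a \<xi>)))"
        using n2 by (intro integrable_mult_right) auto
      fix \<xi>
      have "cis (y \<bullet> \<xi>) = cis ((y - x) \<bullet> \<xi>) * cis (x \<bullet> \<xi>)"
        by (simp add: cis_mult inner_diff_left)
      then have "cis (y \<bullet> \<xi>) * a \<xi> - cis (x \<bullet> \<xi>) * a \<xi> - \<i> * of_real ((y - x) \<bullet> \<xi>) * (cis (x \<bullet> \<xi>) * a \<xi>)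
          = (cis ((y - x) \<bullet> \<xi>) - 1 - \<i> * of_real ((y - x) \<bullet> \<xi>)) * (cis (x \<bullet> \<xi>) * a \<xi>)"
        by (simp add: algebra_simps)
      then have "norm (cis (y \<bullet> \<xi>) * a \<xi> - cis (x \<bullet> \<xi>) * a \<xi> - \<i> * of_real ((y - x) \<bullet> \<xi>) * (cis (x \<bullet> \<xi>) * a \<xi>))
          \<le> (((y - x) \<bullet> \<xi>)\<^sup>2 / 2) * norm (a \<xi>)"
        using mult_right_mono[OF cis_taylor_bound[of "(y - x) \<bullet> \<xi>"], of "norm (a \<xi>)"]
        by (simp add: norm_mult)
      also have "\<dots> \<le> ((norm (y - x) * norm \<xi>)\<^sup>2 / 2) * norm (a \<xi>)"
        by (intro mult_right_mono divide_right_mono) (auto simp: abs_le_square_iff[symmetric] Cauchy_Schwarz_ineq2)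
      finally show "norm (cis (y \<bullet> \<xi>) * a \<xi> - cis (x \<bullet> \<xi>) * a \<xi> - \<i> * of_real ((y - x) \<bullet> \<xi>) * (cis (x \<bullet> \<xi>) * a \<xi>))
          \<le> (norm (y - x))\<^sup>2 * (norm \<xi> ^ 2 / 2 * norm (a \<xi>))"
        by (simp add: power_mult_distrib mult_ac)
    qed
    also have "\<dots> = (norm (y - x))\<^sup>2 * K" unfolding K_def by (rule integral_mult_right_zero)
    finally show "norm (ift a y - ift a x - ?D (y - x)) / norm (y - x) \<le> K * norm (y - x)"
      using \<open>y \<noteq> x\<close> by (simp add: field_simps power2_eq_square)
  qed auto
qed

lemma cs_int_component:
  "cs_int a \<Longrightarrow> cs_int (\<lambda>\<xi>. \<i> * of_real (\<xi> $ j) * a \<xi>)"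
  by (intro cs_int_continuous_mult continuous_intros)

lemma nabla_ift:
  assumes "cs_int a"
  shows "nabla j (ift a) = ift (\<lambda>\<xi>. \<i> * of_real (\<xi> $ j) * a \<xi>)"
proof
  fix x
  show "nabla j (ift a) x = ift (\<lambda>\<xi>. \<i> * of_real (\<xi> $ j) * a \<xi>) x"
    unfolding nabla_eq[OF ift_has_derivative[OF assms]]
    by (simp add: ift_def inner_axis' mult_ac)
qed

lemma smooth_ift: "cs_int a \<Longrightarrow> smooth (ift a)"
proof (rule smooth_coinduct[of "\<lambda>F. \<exists>a. cs_int a \<and> F = ift a"])
  fix F assume "\<exists>a. cs_int a \<and> F = ift a"
  then obtain a where a: "cs_int a" "F = ift a" by blast
  then have "F differentiable (at x)" for x
    using ift_has_derivative unfolding differentiable_def by blast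
  moreover have "\<exists>b. cs_int b \<and> nabla j F = ift b" for j
    using a nabla_ift cs_int_component by blast
  ultimately show "(\<forall>x. F differentiable (at x)) \<and> (\<forall>j. \<exists>a. cs_int a \<and> nabla j F = ift a)"
    by blast
qed auto

lemma ift_nabla:
  assumes "test_fun G"
  shows "ift (nabla j G) x = - (\<i> * of_real (x $ j)) * ift G x"
proof -
  let ?c = "\<lambda>\<xi>. 1 * cis (x \<bullet> \<xi>)"
  have G: "smooth G" by (rule test_fun_smooth[OF assms])
  have t: "test_fun (\<lambda>\<xi>. ?c \<xi> * G \<xi>)"
    by (rule test_fun_mult[OF smooth_cis_inner assms])
  have "nabla j (\<lambda>\<xi>. ?c \<xi> * G \<xi>) = (\<lambda>\<xi>. cis (x \<bullet> \<xi>) * nabla j G \<xi> + (\<i> * of_real (x $ j)) * (cis (x \<bullet> \<xi>) * G \<xi>))"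
    unfolding nabla_mult[OF smooth_cis_inner G] nabla_cis_inner by (simp add: mult_ac)
  then have "0 = (LINT \<xi>|lborel. cis (x \<bullet> \<xi>) * nabla j G \<xi> + (\<i> * of_real (x $ j)) * (cis (x \<bullet> \<xi>) * G \<xi>))"
    using integral_nabla_eq_0[OF t] by metis
  also have "\<dots> = ift (nabla j G) x + (\<i> * of_real (x $ j)) * ift G x"
    unfolding ift_def
    using ift_integrand_integrable[OF test_fun_integrable[OF test_fun_nabla[OF assms]]]
      ift_integrand_integrable[OF test_fun_integrable[OF assms]]
    by (subst Bochner_Integration.integral_add) (auto intro: integrable_mult_right)
  finally show ?thesis by (simp add: eq_neg_iff_add_eq_0)
qed

lemma norm_le_components: "norm (x::real^2) \<le> \<bar>x $ 1\<bar> + \<bar>x $ 2\<bar>"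
  using norm_le_l1_cart[of x] by (simp add: sum_2)

text \<open>The transform of a test function decays faster than every power: each component of \<open>x\<close> can be
  traded for a derivative of \<open>G\<close>.\<close>

lemma ift_decay:
  assumes "test_fun G"
  shows "\<exists>C. \<forall>x. norm x ^ k * cmod (ift G x) \<le> C"
  using assms
proof (induction k arbitrary: G)
  case 0
  then show ?case using norm_ift_le[OF test_fun_integrable] by auto
next
  case (Suc k)
  obtain C1 where C1: "\<And>x. norm x ^ k * cmod (ift (nabla 1 G) x) \<le> C1"
    using Suc.IH[OF test_fun_nabla[OF Suc.prems]] by blast
  obtain C2 where C2: "\<And>x. norm x ^ k * cmod (ift (nabla 2 G) x) \<le> C2"
    using Suc.IH[OF test_fun_nabla[OF Suc.prems]] by blast
  have "norm x ^ Suc k * cmod (ift G x) \<le> C1 + C2" for x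
  proof -
    have "norm x ^ Suc k * cmod (ift G x) \<le> norm x ^ k * ((\<bar>x $ 1\<bar> + \<bar>x $ 2\<bar>) * cmod (ift G x))"
      using mult_left_mono[OF mult_right_mono[OF norm_le_components[of x] norm_ge_zero[of "ift G x"]], of "norm x ^ k"]
      by (simp add: mult_ac)
    also have "\<dots> = norm x ^ k * cmod (ift (nabla 1 G) x) + norm x ^ k * cmod (ift (nabla 2 G) x)"
      unfolding ift_nabla[OF Suc.prems] by (simp add: norm_mult algebra_simps)
    finally show ?thesis using C1[of x] C2[of x] by linarith
  qed
  then show ?case by blast
qed

lemma prod_Basis_vec2: "(\<Prod>b\<in>(Basis::(real^2) set). f b) = f (axis 1 1) * f (axis 2 1)"
proof -
  have B: "(Basis::(real^2) set) = {axis 1 1, axis 2 1}"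
    by (auto simp: Basis_vec_def UNIV_2)
  have "axis 1 (1::real) \<noteq> (axis 2 1 :: real^2)" by (simp add: axis_eq_axis)
  then show ?thesis unfolding B by simp
qed

lemma lborel_vec2_product:
  fixes f g :: "real \<Rightarrow> 'b::{real_normed_field, banach, second_countable_topology}"
  assumes f: "integrable lborel f" and g: "integrable lborel g"
  shows "integrable lborel (\<lambda>x::real^2. f (x $ 1) * g (x $ 2))"
    and "(LINT x|lborel. f ((x::real^2) $ 1) * g (x $ 2)) = (LINT t|lborel. f t) * (LINT t|lborel. g t)"
proof -
  let ?h = "\<lambda>b::real^2. if b = axis 1 1 then f else g"
  let ?T = "\<lambda>u. \<Sum>b\<in>(Basis::(real^2) set). u b *\<^sub>R b"
  interpret product_sigma_finite "\<lambda>_::real^2. lborel :: real measure" ..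
  have [measurable]: "f \<in> borel_measurable borel" "g \<in> borel_measurable borel"
    using f g by auto
  have ne: "axis 2 (1::real) \<noteq> (axis 1 1 :: real^2)" by (simp add: axis_eq_axis)
  have h: "integrable lborel (?h b)" for b using f g by simp
  have sel: "?T u $ j = u (axis j 1)" for u :: "real^2 \<Rightarrow> real" and j
  proof -
    have "?T u \<bullet> axis j 1 = u (axis j 1)" by (rule inner_sum_left_Basis) (auto simp: Basis_vec_def)
    then show ?thesis by (simp add: inner_axis)
  qed
  have T[measurable]: "?T \<in> (\<Pi>\<^sub>M b\<in>Basis. lborel) \<rightarrow>\<^sub>M borel" by measurable
  have eq: "(\<lambda>u. f (?T u $ 1) * g (?T u $ 2)) = (\<lambda>u. \<Prod>b\<in>Basis. ?h b (u b))"
    unfolding sel prod_Basis_vec2 by (simp add: ne)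
  have m: "(\<lambda>x::real^2. f (x $ 1) * g (x $ 2)) \<in> borel_measurable borel" by measurable
  have "integrable (distr (\<Pi>\<^sub>M b\<in>Basis. lborel) borel ?T) (\<lambda>x::real^2. f (x $ 1) * g (x $ 2))"
    unfolding integrable_distr_eq[OF T m] eq
    by (rule product_integrable_prod) (use h in auto)
  then show "integrable lborel (\<lambda>x::real^2. f (x $ 1) * g (x $ 2))"
    by (subst lborel_eq)
  have "(LINT x|distr (\<Pi>\<^sub>M b\<in>Basis. lborel) borel ?T. f ((x::real^2) $ 1) * g (x $ 2)) =
      (\<Prod>b\<in>Basis. integral\<^sup>L lborel (?h b))"
    unfolding integral_distr[OF T m] eq
    by (rule product_integral_prod) (use h in auto)
  then show "(LINT x|lborel. f ((x::real^2) $ 1) * g (x $ 2)) = (LINT t|lborel. f t) * (LINT t|lborel. g t)"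
    by (subst lborel_eq) (simp add: prod_Basis_vec2 ne)
qed

lemma integrable_ift:
  assumes "test_fun G"
  shows "integrable lborel (ift G)"
proof -
  let ?w = "\<lambda>t::real. inverse (1 + t\<^sup>2)"
  obtain C0 where C0: "\<And>x. norm x ^ 0 * cmod (ift G x) \<le> C0" using ift_decay[OF assms] by blast
  obtain C2 where C2: "\<And>x. norm x ^ 2 * cmod (ift G x) \<le> C2" using ift_decay[OF assms] by blast
  obtain C4 where C4: "\<And>x. norm x ^ 4 * cmod (ift G x) \<le> C4" using ift_decay[OF assms] by blast
  have w: "integrable lborel ?w"
    using integrable_inverse_1_plus_square
    by (simp add: set_integrable_def einterval_def)
  have i: "integrable lborel (\<lambda>x::real^2. ?w (x $ 1) * ?w (x $ 2))"
    by (rule lborel_vec2_product(1)[OF w w])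
  show ?thesis
  proof (rule Bochner_Integration.integrable_bound[OF integrable_mult_right[OF i, of "C0 + 2 * C2 + C4"]])
    show "ift G \<in> borel_measurable lborel"
      using smooth_ift[OF test_fun_cs_int[OF assms]]
      by (simp add: borel_measurable_continuous_onI smooth_continuous)
    show "AE x in lborel. norm (ift G x) \<le> norm ((C0 + 2 * C2 + C4) * (?w (x $ 1) * ?w (x $ 2)))"
    proof (intro AE_I2)
      fix x :: "real^2"
      have le: "(x $ j)\<^sup>2 \<le> (norm x)\<^sup>2" for j
        using component_le_norm_cart[of x j] by (simp add: abs_le_square_iff[symmetric])
      have "(1 + (x $ 1)\<^sup>2) * (1 + (x $ 2)\<^sup>2) \<le> (1 + (norm x)\<^sup>2) * (1 + (norm x)\<^sup>2)"
        by (intro mult_mono) (use le in auto)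
      also have "\<dots> = norm x ^ 0 + 2 * norm x ^ 2 + norm x ^ 4"
        by (simp add: algebra_simps power4_eq_xxxx power2_eq_square)
      finally have "(1 + (x $ 1)\<^sup>2) * (1 + (x $ 2)\<^sup>2) * cmod (ift G x) \<le>
          (norm x ^ 0 + 2 * norm x ^ 2 + norm x ^ 4) * cmod (ift G x)"
        by (rule mult_right_mono) simp
      also have "\<dots> \<le> C0 + 2 * C2 + C4"
        using C0[of x] C2[of x] C4[of x] by (simp add: distrib_right)
      finally have b: "(1 + (x $ 1)\<^sup>2) * (1 + (x $ 2)\<^sup>2) * cmod (ift G x) \<le> C0 + 2 * C2 + C4" .
      have p: "0 < (1 + (x $ 1)\<^sup>2) * (1 + (x $ 2)\<^sup>2)"
        by (intro mult_pos_pos add_pos_nonneg) auto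
      have "cmod (ift G x) \<le> (C0 + 2 * C2 + C4) / ((1 + (x $ 1)\<^sup>2) * (1 + (x $ 2)\<^sup>2))"
        using b p by (simp add: pos_le_divide_eq mult_ac)
      also have "\<dots> = (C0 + 2 * C2 + C4) * (?w (x $ 1) * ?w (x $ 2))"
        by (simp add: divide_inverse)
      finally show "norm (ift G x) \<le> norm ((C0 + 2 * C2 + C4) * (?w (x $ 1) * ?w (x $ 2)))"
        by simp
    qed
  qed
qed

section \<open>Fourier inversion and the Plancherel identity\<close>

lemma lborel_integrable_prod:
  fixes f :: "'a::euclidean_space \<Rightarrow> complex" and g :: "'b::euclidean_space \<Rightarrow> complex"
  assumes f: "integrable lborel f" and g: "integrable lborel g"
  shows "integrable lborel (\<lambda>z. f (fst z) * g (snd z))"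
proof -
  have [measurable]: "f \<in> borel_measurable borel" "g \<in> borel_measurable borel"
    using f g by auto
  have "integrable (lborel \<Otimes>\<^sub>M lborel) (\<lambda>z. f (fst z) * g (snd z))"
  proof (rule lborel_pair.Fubini_integrable)
    show "integrable lborel (\<lambda>x. LINT y|lborel. norm (f (fst (x, y)) * g (snd (x, y))))"
      using f by (simp add: norm_mult)
    show "AE x in lborel. integrable lborel (\<lambda>y. f (fst (x, y)) * g (snd (x, y)))"
      using g by simp
  qed measurable
  then show ?thesis by (simp add: lborel_prod)
qed

text \<open>Fubini for a bounded kernel, as a double integral, as an integral over the product space, and
  with the order of integration exchanged.\<close>

lemma fubini_kernel:
  fixes f :: "'a::euclidean_space \<Rightarrow> complex" and g :: "'b::euclidean_space \<Rightarrow> complex"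
    and K :: "'a \<Rightarrow> 'b \<Rightarrow> complex"
  assumes f: "integrable lborel f" and g: "integrable lborel g"
    and K[measurable]: "(\<lambda>z. K (fst z) (snd z)) \<in> borel_measurable borel"
    and B: "\<And>x y. cmod (K x y) \<le> B"
  shows "integrable lborel (\<lambda>z. K (fst z) (snd z) * (f (fst z) * g (snd z)))" (is ?int)
    and "(LINT x|lborel. f x * (LINT y|lborel. K x y * g y)) =
      (LINT z|lborel. K (fst z) (snd z) * (f (fst z) * g (snd z)))" (is ?one)
    and "(LINT x|lborel. f x * (LINT y|lborel. K x y * g y)) =
      (LINT y|lborel. g y * (LINT x|lborel. K x y * f x))" (is ?two)
proof -
  let ?F = "\<lambda>z. K (fst z) (snd z) * (f (fst z) * g (snd z))"
  have p: "integrable lborel (\<lambda>z. f (fst z) * g (snd z))" by (rule lborel_integrable_prod[OF f g])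
  show i: ?int
  proof (rule Bochner_Integration.integrable_bound)
    show "integrable lborel (\<lambda>z. B * cmod (f (fst z) * g (snd z)))"
      using p by (intro integrable_mult_right integrable_norm) auto
    show "?F \<in> borel_measurable lborel"
      using borel_measurable_integrable[OF p] by measurable
    have "0 \<le> B" using B order_trans norm_ge_zero by blast
    then show "AE z in lborel. norm (?F z) \<le> norm (B * cmod (f (fst z) * g (snd z)))"
      by (intro AE_I2) (simp add: norm_mult abs_mult mult_right_mono[OF B])
  qed
  then have i': "integrable (lborel \<Otimes>\<^sub>M lborel) ?F" by (simp add: lborel_prod)
  have fst: "(LINT x|lborel. LINT y|lborel. ?F (x, y)) = (LINT z|lborel. ?F z)"
    using lborel_pair.integral_fst'[OF i'] by (simp add: lborel_prod)
  have snd: "(LINT y|lborel. LINT x|lborel. ?F (x, y)) = (LINT z|lborel. ?F z)"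
    using lborel_pair.integral_snd[of "\<lambda>x y. ?F (x, y)"] i' by (simp add: lborel_prod case_prod_beta')
  have l: "f x * (LINT y|lborel. K x y * g y) = (LINT y|lborel. ?F (x, y))" for x
    by (subst integral_mult_right_zero[symmetric]) (simp add: mult_ac)
  have r: "g y * (LINT x|lborel. K x y * f x) = (LINT x|lborel. ?F (x, y))" for y
    by (subst integral_mult_right_zero[symmetric]) (simp add: mult_ac)
  show ?one unfolding l by (rule fst)
  show ?two unfolding l r using fst snd by simp
qed

lemma cis_inner_measurable:
  "(\<lambda>z. cis ((fst z :: 'a::euclidean_space) \<bullet> snd z)) \<in> borel_measurable borel"
  by (intro borel_measurable_continuous_onI continuous_intros)

lemma gaussian_char_real:
  shows "integrable lborel (\<lambda>x::real. cis (t * x) * of_real (exp (- x\<^sup>2 / 2)))" (is ?i)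
    and "(LINT x|lborel. cis (t * x) * of_real (exp (- (x::real)\<^sup>2 / 2))) =
      of_real (sqrt (2 * pi) * exp (- t\<^sup>2 / 2))" (is ?e)
proof -
  have d: "of_real (exp (- x\<^sup>2 / 2)) = of_real (sqrt (2 * pi)) * (of_real (std_normal_density x) :: complex)" for x
  proof -
    have "exp (- x\<^sup>2 / 2) = sqrt (2 * pi) * std_normal_density x"
      unfolding std_normal_density_def by simp
    then show ?thesis by (metis of_real_mult)
  qed
  have i1: "integrable lborel (\<lambda>x. complex_of_real (std_normal_density x))"
    using integrable_normal_moment[of 1 0 0] by (intro integrable_of_real) simp
  have i2: "integrable lborel (\<lambda>x. cis (t * x) * complex_of_real (std_normal_density x))"
  proof (rule Bochner_Integration.integrable_bound[OF i1])
    have [measurable]: "(\<lambda>x. cis (t * x)) \<in> borel_measurable borel"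
      by (intro borel_measurable_continuous_onI continuous_intros)
    show "(\<lambda>x. cis (t * x) * complex_of_real (std_normal_density x)) \<in> borel_measurable lborel"
      by measurable
  qed (simp add: norm_mult)
  have eq: "cis (t * x) * of_real (exp (- x\<^sup>2 / 2)) =
      of_real (sqrt (2 * pi)) * (cis (t * x) * complex_of_real (std_normal_density x))" for x
    unfolding d by (simp only: mult_ac)
  show ?i unfolding eq using i2 by (rule integrable_mult_right)
  have "(LINT x|lborel. cis (t * x) * complex_of_real (std_normal_density x)) = char std_normal_distribution t"
    unfolding char_def
    by (subst integral_density) (auto simp: cis_conv_exp scaleR_conv_of_real mult_ac)
  also have "\<dots> = of_real (exp (- t\<^sup>2 / 2))"
    unfolding char_std_normal_distribution ..
  finally show ?e unfolding eq by simp
qed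

text \<open>The Gaussian that is, up to the factor \<open>2 * pi\<close>, its own Fourier transform.\<close>

definition gaussian :: "real^2 \<Rightarrow> real" where
  "gaussian x = exp (- (norm x)\<^sup>2 / 2)"

lemma gaussian_split: "gaussian x = exp (- (x $ 1)\<^sup>2 / 2) * exp (- (x $ 2)\<^sup>2 / 2)"
  unfolding gaussian_def
  by (simp add: norm_vec_def L2_set_def sum_2 exp_add[symmetric] add_divide_distrib)

lemma gaussian_char:
  shows "integrable lborel (\<lambda>x. cis (x \<bullet> \<xi>) * of_real (gaussian x))" (is ?i)
    and "(LINT x|lborel. cis (x \<bullet> \<xi>) * of_real (gaussian x)) = of_real (2 * pi * gaussian \<xi>)" (is ?e)
proof -
  have eq: "(\<lambda>x. cis (x \<bullet> \<xi>) * of_real (gaussian x)) =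
      (\<lambda>x. (cis (\<xi> $ 1 * x $ 1) * of_real (exp (- (x $ 1)\<^sup>2 / 2))) *
        (cis (\<xi> $ 2 * x $ 2) * of_real (exp (- (x $ 2)\<^sup>2 / 2))))"
    unfolding gaussian_split by (auto simp: inner_vec_def sum_2 cis_mult[symmetric] mult_ac)
  show ?i unfolding eq
    by (rule lborel_vec2_product(1)[OF gaussian_char_real(1) gaussian_char_real(1)])
  have "(LINT x|lborel. cis (x \<bullet> \<xi>) * of_real (gaussian x)) =
      of_real (sqrt (2 * pi) * exp (- (\<xi> $ 1)\<^sup>2 / 2)) * of_real (sqrt (2 * pi) * exp (- (\<xi> $ 2)\<^sup>2 / 2))"
    unfolding eq lborel_vec2_product(2)[OF gaussian_char_real(1) gaussian_char_real(1)]
      gaussian_char_real(2) ..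
  also have "\<dots> = complex_of_real ((sqrt (2 * pi) * sqrt (2 * pi)) * gaussian \<xi>)"
    unfolding gaussian_split by (simp only: of_real_mult mult_ac)
  finally show ?e by simp
qed

lemma gaussian_integrable: "integrable lborel (\<lambda>x. complex_of_real (gaussian x))"
  using gaussian_char(1)[of 0] by simp

lemma gaussian_continuous: "continuous_on UNIV gaussian"
  unfolding gaussian_def by (intro continuous_intros) auto

lemma gaussian_scaled_integrable:
  assumes "c \<noteq> 0"
  shows "integrable lborel (\<lambda>x. complex_of_real (gaussian (c *\<^sub>R x)))"
proof -
  have "integrable (density (distr lborel borel (\<lambda>x::real^2. 0 + c *\<^sub>R x)) (\<lambda>_. \<bar>c\<bar> ^ DIM(real^2)))
      (\<lambda>x. complex_of_real (gaussian x))"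
    using gaussian_integrable lborel_affine[OF assms, of "0::real^2"] by simp
  moreover have "(\<lambda>x. complex_of_real (gaussian x)) \<in> borel_measurable borel"
    using gaussian_integrable by auto
  ultimately have "integrable lborel (\<lambda>x. \<bar>c\<bar> ^ DIM(real^2) *\<^sub>R complex_of_real (gaussian (c *\<^sub>R x)))"
    using integrable_density[of "\<lambda>x. complex_of_real (gaussian x)" "distr lborel borel (\<lambda>x::real^2. 0 + c *\<^sub>R x)" "\<lambda>_. \<bar>c\<bar> ^ DIM(real^2)"]
    by (simp add: integrable_distr_eq)
  then have "integrable lborel (\<lambda>x. (1 / \<bar>c\<bar> ^ DIM(real^2)) *\<^sub>R \<bar>c\<bar> ^ DIM(real^2) *\<^sub>R complex_of_real (gaussian (c *\<^sub>R x)))"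
    by (rule integrable_scaleR_right)
  then show ?thesis using assms by simp
qed

text \<open>The integral is regularised by the factor \<open>gaussian (c *\<^sub>R x)\<close> with \<open>c\<close> tending to \<open>0\<close>. Fubini
  turns the regularised integral into an average of \<open>G\<close> over a Gaussian of width \<open>c\<close>
  centred at \<open>\<eta>\<close>.\<close>

lemma fourier_inversion:
  assumes "test_fun G"
  shows "(LINT x|lborel. cis (- (x \<bullet> \<eta>)) * ift G x) = of_real ((2 * pi)\<^sup>2) * G \<eta>"
proof -
  define c where "c n = 1 / real (Suc n)" for n
  have c: "c n \<noteq> 0" for n by (simp add: c_def)
  have c0: "c \<longlonglongrightarrow> 0"
    unfolding c_def using LIMSEQ_inverse_real_of_nat by (simp add: inverse_eq_divide)
  have Gi: "integrable lborel G" by (rule test_fun_integrable[OF assms])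
  have Gc: "continuous_on UNIV G" by (rule smooth_continuous[OF test_fun_smooth[OF assms]])
  have [measurable]: "G \<in> borel_measurable borel" "ift G \<in> borel_measurable borel"
    "gaussian \<in> borel_measurable borel"
    using Gi integrable_ift[OF assms] gaussian_continuous
    by (auto intro: borel_measurable_continuous_onI)
  have cism[measurable]: "(\<lambda>x. cis (x \<bullet> \<zeta>)) \<in> borel_measurable borel" for \<zeta> :: "real^2"
    by (intro borel_measurable_continuous_onI continuous_intros)
  obtain B where B: "\<And>x. norm (G x) \<le> B" by (rule test_fun_bounded[OF assms]) (rule that)
  define A where "A n = (LINT x|lborel. (cis (x \<bullet> (-\<eta>)) * of_real (gaussian (c n *\<^sub>R x))) * ift G x)" for n
  have g0: "gaussian 0 = 1" by (simp add: gaussian_def)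
  have gle: "gaussian x \<le> 1" "0 \<le> gaussian x" for x by (auto simp: gaussian_def)
  have lim1: "A \<longlonglongrightarrow> (LINT x|lborel. (cis (x \<bullet> (-\<eta>)) * of_real 1) * ift G x)"
    unfolding A_def
  proof (rule integral_dominated_convergence[where w="\<lambda>x. cmod (ift G x)"])
    show "integrable lborel (\<lambda>x. cmod (ift G x))" using integrable_ift[OF assms] by simp
    show "AE x in lborel. (\<lambda>n. (cis (x \<bullet> (-\<eta>)) * of_real (gaussian (c n *\<^sub>R x))) * ift G x)
        \<longlonglongrightarrow> (cis (x \<bullet> (-\<eta>)) * of_real 1) * ift G x"
    proof (intro AE_I2 tendsto_intros)
      fix x
      have "(\<lambda>n. gaussian (c n *\<^sub>R x)) \<longlonglongrightarrow> gaussian (0 *\<^sub>R x)"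
        by (rule continuous_on_tendsto_compose[OF gaussian_continuous tendsto_scaleR[OF c0 tendsto_const]]) auto
      then show "(\<lambda>n. gaussian (c n *\<^sub>R x)) \<longlonglongrightarrow> 1" by (simp add: g0)
    qed
    show "AE x in lborel. norm ((cis (x \<bullet> (-\<eta>)) * of_real (gaussian (c n *\<^sub>R x))) * ift G x) \<le> cmod (ift G x)" for n
      using gle by (intro AE_I2) (simp add: norm_mult mult_left_le_one_le)
  qed measurable
  have An: "A n = of_real (2 * pi) * (LINT y|lborel. G (\<eta> + c n *\<^sub>R y) * of_real (gaussian y))" for n
  proof -
    have i: "integrable lborel (\<lambda>x. cis (x \<bullet> (-\<eta>)) * of_real (gaussian (c n *\<^sub>R x)))"
      by (rule ift_integrand_integrable[OF gaussian_scaled_integrable[OF c], of "-\<eta>", unfolded inner_commute[of "-\<eta>"]])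
    have "A n = (LINT \<xi>|lborel. G \<xi> * (LINT x|lborel. cis (x \<bullet> \<xi>) * (cis (x \<bullet> (-\<eta>)) * of_real (gaussian (c n *\<^sub>R x)))))"
      unfolding A_def ift_def
      by (rule fubini_kernel(3)[OF i Gi cis_inner_measurable, of 1]) simp
    also have "(\<lambda>\<xi>. LINT x|lborel. cis (x \<bullet> \<xi>) * (cis (x \<bullet> (-\<eta>)) * of_real (gaussian (c n *\<^sub>R x)))) =
        (\<lambda>\<xi>. of_real (2 * pi / (c n)\<^sup>2 * gaussian ((1 / c n) *\<^sub>R (\<xi> - \<eta>))))"
    proof
      fix \<xi>
      have "(LINT x|lborel. cis (x \<bullet> \<xi>) * (cis (x \<bullet> (-\<eta>)) * of_real (gaussian (c n *\<^sub>R x)))) =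
        (LINT x|lborel. cis ((0 + c n *\<^sub>R x) \<bullet> ((1 / c n) *\<^sub>R (\<xi> - \<eta>))) * of_real (gaussian (0 + c n *\<^sub>R x)))"
        using c[of n] by (simp add: mult.assoc[symmetric] cis_mult inner_diff_right diff_divide_distrib)
      also have "\<dots> = (1 / \<bar>c n\<bar> ^ DIM(real^2)) *\<^sub>R (LINT x|lborel. cis (x \<bullet> ((1 / c n) *\<^sub>R (\<xi> - \<eta>))) * of_real (gaussian x))"
        by (rule lborel_integral_affine[OF _ c]) measurable
      also have "\<dots> = of_real (2 * pi / (c n)\<^sup>2 * gaussian ((1 / c n) *\<^sub>R (\<xi> - \<eta>)))"
        unfolding gaussian_char(2) by (simp add: scaleR_conv_of_real)
      finally show "(LINT x|lborel. cis (x \<bullet> \<xi>) * (cis (x \<bullet> (-\<eta>)) * of_real (gaussian (c n *\<^sub>R x)))) = \<dots>" .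
    qed
    also have "(LINT \<xi>|lborel. G \<xi> * of_real (2 * pi / (c n)\<^sup>2 * gaussian ((1 / c n) *\<^sub>R (\<xi> - \<eta>)))) =
        (LINT \<xi>|lborel. of_real (2 * pi / (c n)\<^sup>2) * (G \<xi> * of_real (gaussian ((1 / c n) *\<^sub>R (\<xi> - \<eta>)))))"
      by (simp add: mult_ac)
    also have "\<dots> = of_real (2 * pi / (c n)\<^sup>2) * (LINT \<xi>|lborel. G \<xi> * of_real (gaussian ((1 / c n) *\<^sub>R (\<xi> - \<eta>))))"
      by (rule integral_mult_right_zero)
    also have "(LINT \<xi>|lborel. G \<xi> * of_real (gaussian ((1 / c n) *\<^sub>R (\<xi> - \<eta>)))) =
        of_real ((c n)\<^sup>2) * (LINT y|lborel. G (\<eta> + c n *\<^sub>R y) * of_real (gaussian y))"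
    proof -
      let ?f = "\<lambda>\<xi>. G \<xi> * of_real (gaussian ((1 / c n) *\<^sub>R (\<xi> - \<eta>)))"
      have "?f \<in> borel_measurable borel" by measurable
      then have I: "(LINT y|lborel. ?f (\<eta> + c n *\<^sub>R y)) = (1 / \<bar>c n\<bar> ^ DIM(real^2)) *\<^sub>R (LINT \<xi>|lborel. ?f \<xi>)"
        by (rule lborel_integral_affine[OF _ c])
      have eq: "(\<lambda>y. ?f (\<eta> + c n *\<^sub>R y)) = (\<lambda>y. G (\<eta> + c n *\<^sub>R y) * of_real (gaussian y))"
        using c[of n] by simp
      have "(LINT y|lborel. G (\<eta> + c n *\<^sub>R y) * of_real (gaussian y)) =
          of_real (1 / (c n)\<^sup>2) * (LINT \<xi>|lborel. ?f \<xi>)"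
        using I unfolding eq scaleR_conv_of_real[where 'a=complex] by simp
      then show ?thesis using c[of n] by simp
    qed
    finally show ?thesis using c[of n] by simp
  qed
  have lim2: "(\<lambda>n. LINT y|lborel. G (\<eta> + c n *\<^sub>R y) * of_real (gaussian y)) \<longlonglongrightarrow>
      (LINT y|lborel. G \<eta> * of_real (gaussian y))"
  proof (rule integral_dominated_convergence[where w="\<lambda>y. B * gaussian y"])
    show "integrable lborel (\<lambda>y. B * gaussian y)"
      using gaussian_integrable by (intro integrable_mult_right) (simp only: complex_of_real_integrable_eq)
    show "AE x in lborel. (\<lambda>n. G (\<eta> + c n *\<^sub>R x) * of_real (gaussian x)) \<longlonglongrightarrow> G \<eta> * of_real (gaussian x)"
    proof (intro AE_I2 tendsto_mult tendsto_const)
      fix x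
      have "(\<lambda>n. G (\<eta> + c n *\<^sub>R x)) \<longlonglongrightarrow> G (\<eta> + 0 *\<^sub>R x)"
        by (rule continuous_on_tendsto_compose[OF Gc tendsto_add[OF tendsto_const tendsto_scaleR[OF c0 tendsto_const]]]) auto
      then show "(\<lambda>n. G (\<eta> + c n *\<^sub>R x)) \<longlonglongrightarrow> G \<eta>" by simp
    qed
    show "AE x in lborel. norm (G (\<eta> + c n *\<^sub>R x) * of_real (gaussian x)) \<le> B * gaussian x" for n
      using gle(2) by (intro AE_I2) (simp add: norm_mult mult_right_mono[OF B])
  qed measurable
  have "(LINT y|lborel. of_real (gaussian y)) = complex_of_real (2 * pi)"
    using gaussian_char(2)[of 0] by (simp add: g0)
  then have "(LINT y|lborel. G \<eta> * of_real (gaussian y)) = of_real (2 * pi) * G \<eta>"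
    by (subst integral_mult_right_zero) (simp only: mult.commute)
  then have "(\<lambda>n. of_real (2 * pi) * (LINT y|lborel. G (\<eta> + c n *\<^sub>R y) * of_real (gaussian y)))
      \<longlonglongrightarrow> of_real (2 * pi) * (of_real (2 * pi) * G \<eta>)"
    using tendsto_mult_left[OF lim2, of "of_real (2 * pi)"] by metis
  then have "A \<longlonglongrightarrow> of_real (2 * pi) * (of_real (2 * pi) * G \<eta>)"
    unfolding An[symmetric] .
  then have "(LINT x|lborel. (cis (x \<bullet> (-\<eta>)) * of_real 1) * ift G x) = of_real (2 * pi) * (of_real (2 * pi) * G \<eta>)"
    using lim1 LIMSEQ_unique by blast
  then show ?thesis by (simp add: power2_eq_square mult_ac)
qed

lemma ift_bounded:
  assumes "integrable lborel a"
  obtains B where "\<And>x. cmod (ift a x) \<le> B"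
  using norm_ift_le[OF assms] that by blast

lemma integrable_norm_ift_sq:
  assumes "test_fun G"
  shows "integrable lborel (\<lambda>x. (cmod (ift G x))\<^sup>2)"
proof -
  obtain B where B: "\<And>x. cmod (ift G x) \<le> B"
    using ift_bounded[OF test_fun_integrable[OF assms]] by blast
  have i: "integrable lborel (ift G)" by (rule integrable_ift[OF assms])
  show ?thesis
  proof (rule Bochner_Integration.integrable_bound[of _ "\<lambda>x. B * cmod (ift G x)"])
    show "AE x in lborel. norm ((cmod (ift G x))\<^sup>2) \<le> norm (B * cmod (ift G x))"
      using B by (intro AE_I2) (simp add: power2_eq_square abs_mult mult_right_mono order_trans[OF B abs_ge_self])
  qed (use i in auto)
qed

lemma plancherel:
  assumes "test_fun G"
  shows "(LINT x|lborel. (cmod (ift G x))\<^sup>2) = (2 * pi)\<^sup>2 * (LINT \<xi>|lborel. (cmod (G \<xi>))\<^sup>2)"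
proof -
  have Gi: "integrable lborel G" by (rule test_fun_integrable[OF assms])
  have i: "integrable lborel (\<lambda>x. cnj (ift G x))" using integrable_ift[OF assms] by simp
  have "of_real (LINT x|lborel. (cmod (ift G x))\<^sup>2) = (LINT x|lborel. complex_of_real ((cmod (ift G x))\<^sup>2))"
    by (rule integral_complex_of_real[symmetric])
  also have "\<dots> = (LINT x|lborel. cnj (ift G x) * (LINT \<xi>|lborel. cis (x \<bullet> \<xi>) * G \<xi>))"
    unfolding ift_def[symmetric] complex_norm_square by (simp add: mult.commute)
  also have "\<dots> = (LINT \<xi>|lborel. G \<xi> * (LINT x|lborel. cis (x \<bullet> \<xi>) * cnj (ift G x)))"
    by (rule fubini_kernel(3)[OF i Gi cis_inner_measurable, of 1]) simp
  also have "(\<lambda>\<xi>. LINT x|lborel. cis (x \<bullet> \<xi>) * cnj (ift G x)) = (\<lambda>\<xi>. cnj (of_real ((2 * pi)\<^sup>2) * G \<xi>))"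
    unfolding fourier_inversion[OF assms, symmetric]
    by (rule ext, subst Bochner_Integration.integral_cnj[symmetric]) (simp add: cis_cnj)
  also have "(LINT \<xi>|lborel. G \<xi> * cnj (of_real ((2 * pi)\<^sup>2) * G \<xi>)) =
      (LINT \<xi>|lborel. complex_of_real ((2 * pi)\<^sup>2 * (cmod (G \<xi>))\<^sup>2))"
    by (simp only: of_real_mult complex_norm_square[of "G _"] complex_cnj_mult complex_cnj_complex_of_real mult_ac)
  also have "\<dots> = of_real ((2 * pi)\<^sup>2 * (LINT \<xi>|lborel. (cmod (G \<xi>))\<^sup>2))"
    unfolding integral_complex_of_real by simp
  finally show ?thesis by (simp only: of_real_eq_iff)
qed

section \<open>The commutator kernel on wave packets\<close>

text \<open>The scalar cross product of two vectors in the plane.\<close>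

definition cross2 :: "real^2 \<Rightarrow> real^2 \<Rightarrow> real" where
  "cross2 x y = x $ 1 * y $ 2 - x $ 2 * y $ 1"

lemma abs_cross2_le: "\<bar>cross2 x y\<bar> \<le> 2 * norm x * norm y"
proof -
  have "\<bar>cross2 x y\<bar> \<le> \<bar>x $ 1\<bar> * \<bar>y $ 2\<bar> + \<bar>x $ 2\<bar> * \<bar>y $ 1\<bar>"
    unfolding cross2_def abs_mult[symmetric] by (rule abs_triangle_ineq4)
  also have "\<dots> \<le> norm x * norm y + norm x * norm y"
    by (intro add_mono mult_mono component_le_norm_cart) auto
  finally show ?thesis by simp
qed

lemma cross2_simps:
  "cross2 (x + x') y = cross2 x y + cross2 x' y" "cross2 x (y + y') = cross2 x y + cross2 x y'"
  "cross2 (c *\<^sub>R x) y = c * cross2 x y" "cross2 x (c *\<^sub>R y) = c * cross2 x y"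
  "cross2 x x = 0"
  by (simp_all add: cross2_def algebra_simps)

lemma cross2_commute: "cross2 y x = - cross2 x y"
  by (simp add: cross2_def)

lemma cross2_minus: "cross2 (- x) y = - cross2 x y" "cross2 x (- y) = - cross2 x y"
  by (simp_all add: cross2_def)

text \<open>The kernel of the nonlinearity after symmetrisation in the two frequencies, where \<open>\<Phi>\<close> is the
  transform of \<open>\<phi>\<close>.\<close>

definition comm_kernel :: "real \<Rightarrow> (real^2 \<Rightarrow> complex) \<Rightarrow> real^2 \<Rightarrow> real^2 \<Rightarrow> complex" where
  "comm_kernel s \<Phi> \<xi> \<eta> =
    of_real (1 / 2 * cross2 \<xi> \<eta> * (norm \<xi> powr (2 * s) - norm \<eta> powr (2 * s))) * \<Phi> (\<xi> + \<eta>)"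

lemma powr_Lipschitz:
  "\<exists>L\<ge>0. \<forall>p\<in>{1/2..3/2}. \<forall>q\<in>{1/2..3/2}. \<bar>p powr r - q powr r\<bar> \<le> L * \<bar>p - q :: real\<bar>"
proof -
  let ?S = "{1/2..3/2::real}"
  have "continuous_on ?S (\<lambda>p. r * p powr (r - 1))"
    by (intro continuous_intros) auto
  then have "bounded ((\<lambda>p. r * p powr (r - 1)) ` ?S)"
    by (intro compact_imp_bounded compact_continuous_image) auto
  then obtain L where L: "0 < L" "\<And>p. p \<in> ?S \<Longrightarrow> \<bar>r * p powr (r - 1)\<bar> \<le> L"
    unfolding bounded_pos by auto
  have "\<bar>p powr r - q powr r\<bar> \<le> L * \<bar>p - q\<bar>" if "p \<in> ?S" "q \<in> ?S" for p q
  proof -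
    have "norm (p powr r - q powr r) \<le> L * norm (p - q)"
    proof (rule field_differentiable_bound[of ?S _ "\<lambda>p. r * p powr (r - 1)"])
      show "((\<lambda>p. p powr r) has_field_derivative r * x powr (r - 1)) (at x within ?S)" if "x \<in> ?S" for x
        using that by (intro has_field_derivative_at_within[OF has_real_derivative_powr]) auto
    qed (use L that in auto)
    then show ?thesis by simp
  qed
  then show ?thesis using L(1) by (intro exI[of _ L]) auto
qed

lemma norm_powr_has_derivative:
  fixes w u :: "real^2"
  assumes "norm w = 1"
  shows "((\<lambda>t. norm (w + t *\<^sub>R u) powr r) has_real_derivative r * (w \<bullet> u)) (at 0)"
proof -
  let ?g = "\<lambda>t. 1 + 2 * t * (w \<bullet> u) + t\<^sup>2 * (norm u)\<^sup>2"
  have sq: "(norm (w + t *\<^sub>R u))\<^sup>2 = ?g t" for t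
  proof -
    have "w \<bullet> w = 1" using assms by (simp add: norm_eq_1)
    then show ?thesis unfolding power2_norm_eq_inner
      by (simp add: inner_add_left inner_add_right inner_commute[of u w] algebra_simps power2_eq_square)
  qed
  have "norm (w + t *\<^sub>R u) powr r = ?g t powr (r / 2)" for t
  proof -
    have "(norm (w + t *\<^sub>R u))\<^sup>2 = norm (w + t *\<^sub>R u) powr 2" by simp
    then have "?g t powr (r / 2) = (norm (w + t *\<^sub>R u) powr 2) powr (r / 2)"
      unfolding sq[symmetric] by metis
    also have "\<dots> = norm (w + t *\<^sub>R u) powr r" by (subst powr_powr) simp
    finally show ?thesis ..
  qed
  then have eq: "(\<lambda>t. norm (w + t *\<^sub>R u) powr r) = (\<lambda>t. ?g t powr (r / 2))" by blast
  have g: "(?g has_real_derivative 2 * (w \<bullet> u)) (at 0)"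
    by (auto intro!: derivative_eq_intros)
  show ?thesis unfolding eq
    using DERIV_fun_powr[OF g, of "r / 2"] by simp
qed

text \<open>Rescaled to unit frequency and with \<open>\<sigma>\<close> equal to \<open>1\<close> or \<open>-1\<close>, the cross product and the difference
  of the symbols are both of size \<open>1 / l\<close>. Dividing each by \<open>1 / l\<close> is therefore harmless, and
  together the two quotients absorb the normalisation \<open>l powr (- 2 * s)\<close>.\<close>

lemma rescaled_symbol:
  fixes w u v :: "real^2"
  assumes "0 < l"
  shows "l powr (- 2 * s) * (cross2 (l *\<^sub>R w + u) ((\<sigma> * l) *\<^sub>R w + v) *
      (norm (l *\<^sub>R w + u) powr (2 * s) - norm ((\<sigma> * l) *\<^sub>R w + v) powr (2 * s))) =
    (cross2 w v + \<sigma> * cross2 u w + (1 / l) * cross2 u v) *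
    ((norm (w + (1 / l) *\<^sub>R u) powr (2 * s) - norm (\<sigma> *\<^sub>R w + (1 / l) *\<^sub>R v) powr (2 * s)) / (1 / l))"
proof -
  have 1: "l *\<^sub>R w + u = l *\<^sub>R (w + (1 / l) *\<^sub>R u)"
    "(\<sigma> * l) *\<^sub>R w + v = l *\<^sub>R (\<sigma> *\<^sub>R w + (1 / l) *\<^sub>R v)"
    using assms by (simp_all add: scaleR_add_right mult.commute)
  have 2: "norm (l *\<^sub>R x) powr (2 * s) = l powr (2 * s) * norm x powr (2 * s)" for x :: "real^2"
    using assms by (simp add: powr_mult)
  have 3: "cross2 (l *\<^sub>R w + u) ((\<sigma> * l) *\<^sub>R w + v) = l * (cross2 w v + \<sigma> * cross2 u w + (1 / l) * cross2 u v)"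
    using assms by (simp add: cross2_simps distrib_left)
  have 4: "l powr (- 2 * s) * l powr (2 * s) = 1"
    using assms by (simp add: powr_add[symmetric])
  have "l powr (- 2 * s) * (l * C * (l powr (2 * s) * a - l powr (2 * s) * b)) =
      (l powr (- 2 * s) * l powr (2 * s)) * (C * ((a - b) / (1 / l)))" for C a b
    using assms by (simp add: field_simps)
  then show ?thesis unfolding 3 unfolding 1 unfolding 2 unfolding 4 by simp
qed

lemma rescaled_symbol_bound:
  fixes w u v :: "real^2"
  assumes w: "norm w = 1" and \<sigma>: "\<bar>\<sigma>\<bar> = 1" and R: "0 < R" "norm u \<le> R" "norm v \<le> R" "2 * R \<le> l"
    and L: "0 \<le> L" "\<forall>p\<in>{1/2..3/2}. \<forall>q\<in>{1/2..3/2}. \<bar>p powr (2 * s) - q powr (2 * s)\<bar> \<le> L * \<bar>p - q :: real\<bar>"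
  shows "\<bar>(cross2 w v + \<sigma> * cross2 u w + (1 / l) * cross2 u v) *
    ((norm (w + (1 / l) *\<^sub>R u) powr (2 * s) - norm (\<sigma> *\<^sub>R w + (1 / l) *\<^sub>R v) powr (2 * s)) / (1 / l))\<bar>
    \<le> 10 * R\<^sup>2 * L"
proof -
  have l: "0 < l" using R by linarith
  let ?p = "norm (w + (1 / l) *\<^sub>R u)" and ?q = "norm (\<sigma> *\<^sub>R w + (1 / l) *\<^sub>R v)"
  have b: "norm ((1 / l) *\<^sub>R y) \<le> 1 / 2" if "norm y \<le> R" for y :: "real^2"
    using that R l by (simp add: field_simps)
  have sw: "norm (\<sigma> *\<^sub>R w) = 1" using w \<sigma> by simp
  have p: "?p \<in> {1/2..3/2}"
    using b[OF R(2)] w norm_triangle_ineq[of w "(1 / l) *\<^sub>R u"] norm_diff_ineq[of w "(1 / l) *\<^sub>R u"]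
    unfolding atLeastAtMost_iff by linarith
  have q: "?q \<in> {1/2..3/2}"
    using b[OF R(3)] sw norm_triangle_ineq[of "\<sigma> *\<^sub>R w" "(1 / l) *\<^sub>R v"] norm_diff_ineq[of "\<sigma> *\<^sub>R w" "(1 / l) *\<^sub>R v"]
    unfolding atLeastAtMost_iff by linarith
  have "?q = norm (\<sigma> *\<^sub>R (\<sigma> *\<^sub>R w + (1 / l) *\<^sub>R v))" using \<sigma> by simp
  also have "\<sigma> *\<^sub>R (\<sigma> *\<^sub>R w + (1 / l) *\<^sub>R v) = w + (\<sigma> / l) *\<^sub>R v"
  proof -
    have "\<sigma> * \<sigma> = 1" using \<sigma> by (metis abs_mult_self_eq mult_1)
    then show ?thesis by (simp add: scaleR_add_right)
  qed
  finally have "\<bar>?p - ?q\<bar> \<le> norm ((w + (1 / l) *\<^sub>R u) - (w + (\<sigma> / l) *\<^sub>R v))"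
    by (metis norm_triangle_ineq3)
  also have "\<dots> \<le> norm ((1 / l) *\<^sub>R u) + norm ((\<sigma> / l) *\<^sub>R v)"
    unfolding add_diff_cancel_left by (rule norm_triangle_ineq4)
  also have "\<dots> = (norm u + norm v) / l" using \<sigma> l by (simp add: add_divide_distrib)
  also have "\<dots> \<le> 2 * R / l" using R l by (intro divide_right_mono) auto
  finally have pq: "\<bar>?p - ?q\<bar> \<le> 2 * R / l" .
  have "\<bar>?p powr (2 * s) - ?q powr (2 * s)\<bar> \<le> L * (2 * R / l)"
    using L(2) p q mult_left_mono[OF pq L(1)] by (meson order_trans)
  then have d: "\<bar>(?p powr (2 * s) - ?q powr (2 * s)) / (1 / l)\<bar> \<le> L * (2 * R)"
    using l by (simp only: abs_divide) (simp add: field_simps)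
  have "\<bar>cross2 w v\<bar> \<le> 2 * R" using abs_cross2_le[of w v] w R by simp
  moreover have "\<bar>\<sigma> * cross2 u w\<bar> \<le> 2 * R" using abs_cross2_le[of u w] w R \<sigma> by (simp add: abs_mult)
  moreover have "\<bar>(1 / l) * cross2 u v\<bar> \<le> R"
  proof -
    have "\<bar>cross2 u v\<bar> \<le> 2 * (R * R)"
      using abs_cross2_le[of u v] mult_mono[OF R(2,3)] R by simp
    also have "\<dots> \<le> l * R" using R by (simp add: mult_right_mono)
    finally show ?thesis using l by (simp add: field_simps abs_mult)
  qed
  ultimately have c: "\<bar>cross2 w v + \<sigma> * cross2 u w + (1 / l) * cross2 u v\<bar> \<le> 5 * R" by linarith
  have "\<bar>cross2 w v + \<sigma> * cross2 u w + (1 / l) * cross2 u v\<bar> * \<bar>(?p powr (2 * s) - ?q powr (2 * s)) / (1 / l)\<bar>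
      \<le> (5 * R) * (L * (2 * R))"
    using R by (intro mult_mono c d) auto
  then show ?thesis by (simp add: abs_mult power2_eq_square mult_ac)
qed

text \<open>For \<open>\<sigma> = -1\<close> the limit is \<open>2 * s * cross2 w \<zeta> * (w \<bullet> \<zeta>)\<close> with \<open>\<zeta> = u + v\<close>.\<close>

lemma rescaled_symbol_limit:
  fixes w u v :: "real^2"
  assumes w: "norm w = 1" and \<sigma>: "\<bar>\<sigma>\<bar> = 1" and l: "filterlim l at_top sequentially"
  shows "(\<lambda>n. (cross2 w v + \<sigma> * cross2 u w + (1 / l n) * cross2 u v) *
    ((norm (w + (1 / l n) *\<^sub>R u) powr (2 * s) - norm (\<sigma> *\<^sub>R w + (1 / l n) *\<^sub>R v) powr (2 * s)) / (1 / l n)))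
    \<longlonglongrightarrow> (cross2 w v + \<sigma> * cross2 u w) * (2 * s * (w \<bullet> u) - 2 * s * (\<sigma> * (w \<bullet> v)))"
proof -
  have t0: "(\<lambda>n. 1 / l n) \<longlonglongrightarrow> 0"
    using tendsto_inverse_0_at_top[OF l] by (simp add: inverse_eq_divide)
  have "eventually (\<lambda>n. 0 < l n) sequentially" using l by (simp add: filterlim_at_top_dense)
  then have t: "filterlim (\<lambda>n. 1 / l n) (at 0) sequentially"
    unfolding filterlim_at using t0 by (auto elim: eventually_mono)
  have sw: "norm (\<sigma> *\<^sub>R w) = 1" using w \<sigma> by simp
  have lim: "(\<lambda>n. (norm (y + (1 / l n) *\<^sub>R z) powr (2 * s) - 1) / (1 / l n)) \<longlonglongrightarrow> 2 * s * (y \<bullet> z)"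
    if "norm y = 1" for y z :: "real^2"
    using filterlim_compose[OF DERIV_D[OF norm_powr_has_derivative[OF that, of z "2 * s"]] t] that
    by simp
  have "(\<lambda>n. (norm (w + (1 / l n) *\<^sub>R u) powr (2 * s) - 1) / (1 / l n) -
      (norm (\<sigma> *\<^sub>R w + (1 / l n) *\<^sub>R v) powr (2 * s) - 1) / (1 / l n))
      \<longlonglongrightarrow> 2 * s * (w \<bullet> u) - 2 * s * ((\<sigma> *\<^sub>R w) \<bullet> v)"
    by (intro tendsto_diff lim w sw)
  then have "(\<lambda>n. (norm (w + (1 / l n) *\<^sub>R u) powr (2 * s) - norm (\<sigma> *\<^sub>R w + (1 / l n) *\<^sub>R v) powr (2 * s)) / (1 / l n))
      \<longlonglongrightarrow> 2 * s * (w \<bullet> u) - 2 * s * (\<sigma> * (w \<bullet> v))"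
    by (simp only: diff_divide_distrib[symmetric] inner_scaleR_left diff_diff_eq2) (simp add: algebra_simps)
  moreover have "(\<lambda>n. cross2 w v + \<sigma> * cross2 u w + (1 / l n) * cross2 u v) \<longlonglongrightarrow> cross2 w v + \<sigma> * cross2 u w + 0 * cross2 u v"
    by (intro tendsto_intros t0)
  ultimately show ?thesis
    using tendsto_mult[of "\<lambda>n. cross2 w v + \<sigma> * cross2 u w + (1 / l n) * cross2 u v"] by simp
qed

lemma measurable_fst_snd_borel:
  "(fst :: 'a::euclidean_space \<times> 'b::euclidean_space \<Rightarrow> 'a) \<in> borel \<rightarrow>\<^sub>M borel"
  "(snd :: 'a::euclidean_space \<times> 'b::euclidean_space \<Rightarrow> 'b) \<in> borel \<rightarrow>\<^sub>M borel"
  by (auto intro!: borel_measurable_continuous_onI continuous_intros)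

lemma comm_kernel_measurable:
  assumes "\<Phi> \<in> borel_measurable borel" "f \<in> M \<rightarrow>\<^sub>M borel" "g \<in> M \<rightarrow>\<^sub>M borel"
  shows "(\<lambda>z. comm_kernel s \<Phi> (f z) (g z)) \<in> borel_measurable M"
proof -
  have nth: "(\<lambda>z. h z $ i) \<in> borel_measurable M" if "h \<in> M \<rightarrow>\<^sub>M borel" for h :: "'a \<Rightarrow> real^2" and i
    by (rule measurable_compose[OF that]) (intro borel_measurable_continuous_onI continuous_intros)
  have "(\<lambda>z. \<Phi> (f z + g z)) \<in> borel_measurable M"
    by (rule measurable_compose[OF borel_measurable_add[OF assms(2,3)] assms(1)])
  moreover have "(\<lambda>z. 1 / 2 * cross2 (f z) (g z) * (norm (f z) powr (2 * s) - norm (g z) powr (2 * s))) \<in> borel_measurable M"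
    unfolding cross2_def
    by (intro borel_measurable_times borel_measurable_diff borel_measurable_const nth powr_real_measurable
        measurable_compose[OF assms(2) borel_measurable_norm]
        measurable_compose[OF assms(3) borel_measurable_norm] assms)
  ultimately show ?thesis
    unfolding comm_kernel_def
    using borel_measurable_times[OF measurable_compose[OF _ borel_measurable_of_real]] by blast
qed

text \<open>The profiles \<open>G\<close> and \<open>H\<close> are moved to the frequencies \<open>l *\<^sub>R w\<close> and \<open>(\<sigma> * l) *\<^sub>R w\<close>. For \<open>\<sigma> = -1\<close>
  the frequencies almost cancel and the normalised interaction has a limit; for \<open>\<sigma> = 1\<close> they add up
  and the decay of \<open>\<Phi>\<close> removes the interaction in the limit.\<close>

lemma comm_kernel_packets:
  fixes s :: real and w :: "real^2" and l :: "nat \<Rightarrow> real" and \<Phi> G H :: "real^2 \<Rightarrow> complex"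
  assumes w: "norm w = 1" and \<sigma>: "\<bar>\<sigma>\<bar> = 1"
    and \<Phi>: "continuous_on UNIV \<Phi>" "\<And>x. cmod (\<Phi> x) \<le> M"
    and G: "integrable lborel G" "\<And>x. R < norm x \<Longrightarrow> G x = 0"
    and H: "integrable lborel H" "\<And>x. R < norm x \<Longrightarrow> H x = 0"
    and R: "0 < R" and l: "filterlim l at_top sequentially" "\<And>n. 2 * R \<le> l n"
  defines "I \<equiv> \<lambda>n z. comm_kernel s \<Phi> (l n *\<^sub>R w + fst z) ((\<sigma> * l n) *\<^sub>R w + snd z) * (G (fst z) * H (snd z))"
  shows "integrable lborel (I n)" (is ?int)
    and "\<sigma> = -1 \<Longrightarrow> (\<lambda>n. of_real (l n powr (-2 * s)) * (LINT z|lborel. I n z)) \<longlonglongrightarrow>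
      (LINT z|lborel. of_real (s * (cross2 w (fst z + snd z) * (w \<bullet> (fst z + snd z)))) * \<Phi> (fst z + snd z) *
        (G (fst z) * H (snd z)))"
    and "\<sigma> = 1 \<Longrightarrow> (\<And>x. norm x * cmod (\<Phi> x) \<le> M') \<Longrightarrow>
      (\<lambda>n. of_real (l n powr (-2 * s)) * (LINT z|lborel. I n z)) \<longlonglongrightarrow> 0"
proof -
  obtain L where L: "0 \<le> L" "\<forall>p\<in>{1/2..3/2}. \<forall>q\<in>{1/2..3/2}. \<bar>p powr (2 * s) - q powr (2 * s)\<bar> \<le> L * \<bar>p - q :: real\<bar>"
    using powr_Lipschitz by blast
  have lpos: "0 < l n" for n using R l(2)[of n] by linarith
  have M: "0 \<le> M" using \<Phi>(2)[of 0] norm_ge_zero order_trans by blast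
  define S where "S n z = (cross2 w (snd z) + \<sigma> * cross2 (fst z) w + (1 / l n) * cross2 (fst z) (snd z)) *
    ((norm (w + (1 / l n) *\<^sub>R fst z) powr (2 * s) - norm (\<sigma> *\<^sub>R w + (1 / l n) *\<^sub>R snd z) powr (2 * s)) / (1 / l n))"
    for n and z :: "(real^2) \<times> (real^2)"
  define J where "J n z = of_real (l n powr (-2 * s)) * I n z" for n z
  let ?GH = "\<lambda>z. G (fst z) * H (snd z)"
  have J: "J n z = of_real (1 / 2 * S n z) * \<Phi> ((l n *\<^sub>R w + fst z) + ((\<sigma> * l n) *\<^sub>R w + snd z)) * ?GH z" for n z
    unfolding J_def I_def comm_kernel_def S_def rescaled_symbol[OF lpos, symmetric] by simp
  have Sb: "\<bar>S n z\<bar> \<le> 10 * R\<^sup>2 * L" if "?GH z \<noteq> 0" for n z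
  proof -
    have "norm (fst z) \<le> R" "norm (snd z) \<le> R"
      using that G(2)[of "fst z"] H(2)[of "snd z"] by fastforce+
    then show ?thesis unfolding S_def
      using rescaled_symbol_bound[OF w \<sigma> R _ _ l(2) L] by blast
  qed
  have GH: "integrable lborel ?GH" by (rule lborel_integrable_prod[OF G(1) H(1)])
  have GHm[measurable]: "?GH \<in> borel_measurable borel" using borel_measurable_integrable[OF GH] by simp
  have \<Phi>m[measurable]: "\<Phi> \<in> borel_measurable borel" by (rule borel_measurable_continuous_onI[OF \<Phi>(1)])
  note measurable_fst_snd_borel[measurable]
  have Im[measurable]: "I n \<in> borel_measurable borel" for n
    unfolding I_def by (intro borel_measurable_times GHm comm_kernel_measurable) measurable
  have Jm[measurable]: "J n \<in> borel_measurable borel" for n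
    unfolding J_def by measurable
  define W where "W z = 5 * R\<^sup>2 * L * M * cmod (?GH z)" for z
  have Wi: "integrable lborel W" unfolding W_def by (intro integrable_mult_right integrable_norm GH)
  have JW: "norm (J n z) \<le> W z" for n z
  proof (cases "?GH z = 0")
    case False
    have "norm (J n z) = (1 / 2 * \<bar>S n z\<bar>) * cmod (\<Phi> ((l n *\<^sub>R w + fst z) + ((\<sigma> * l n) *\<^sub>R w + snd z))) * cmod (?GH z)"
      unfolding J by (simp add: norm_mult abs_mult)
    also have "\<dots> \<le> (1 / 2 * (10 * R\<^sup>2 * L)) * M * cmod (?GH z)"
      using R L M by (intro mult_right_mono mult_mono mult_left_mono Sb[OF False] \<Phi>(2)) auto
    finally show ?thesis by (simp add: W_def mult_ac)
  next
    case True
    have "J n z = 0" unfolding J True by simp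
    then show ?thesis unfolding W_def True by simp
  qed
  have Ji: "integrable lborel (J n)" for n
  proof (rule Bochner_Integration.integrable_bound[OF Wi])
    show "AE z in lborel. norm (J n z) \<le> norm (W z)"
      using JW order_trans[OF JW abs_ge_self] by (intro AE_I2) simp
  qed measurable
  have "I n = (\<lambda>z. of_real (l n powr (2 * s)) * J n z)"
    unfolding J_def using lpos[of n]
    by (auto simp: mult.assoc[symmetric] of_real_mult[symmetric] powr_add[symmetric] simp del: of_real_mult)
  then show ?int using Ji by (simp add: integrable_mult_right)
  have JI: "(LINT z|lborel. J n z) = of_real (l n powr (-2 * s)) * (LINT z|lborel. I n z)" for n
    unfolding J_def by (rule integral_mult_right_zero)
  show "(\<lambda>n. of_real (l n powr (-2 * s)) * (LINT z|lborel. I n z)) \<longlonglongrightarrow>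
      (LINT z|lborel. of_real (s * (cross2 w (fst z + snd z) * (w \<bullet> (fst z + snd z)))) * \<Phi> (fst z + snd z) *
        (G (fst z) * H (snd z)))" if \<sigma>: "\<sigma> = -1"
    unfolding JI[symmetric]
  proof (rule integral_dominated_convergence[OF _ _ Wi])
    show "AE z in lborel. (\<lambda>n. J n z) \<longlonglongrightarrow> of_real (s * (cross2 w (fst z + snd z) * (w \<bullet> (fst z + snd z)))) *
        \<Phi> (fst z + snd z) * ?GH z"
    proof (intro AE_I2)
      fix z :: "(real^2) \<times> (real^2)"
      have "(\<lambda>n. S n z) \<longlonglongrightarrow> (cross2 w (snd z) + \<sigma> * cross2 (fst z) w) * (2 * s * (w \<bullet> fst z) - 2 * s * (\<sigma> * (w \<bullet> snd z)))"
        unfolding S_def by (rule rescaled_symbol_limit[OF w _ l(1)]) (simp add: \<sigma>)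
      then have "(\<lambda>n. of_real (1 / 2 * S n z) * \<Phi> (fst z + snd z) * ?GH z) \<longlonglongrightarrow>
        of_real (1 / 2 * ((cross2 w (snd z) + \<sigma> * cross2 (fst z) w) * (2 * s * (w \<bullet> fst z) - 2 * s * (\<sigma> * (w \<bullet> snd z))))) *
          \<Phi> (fst z + snd z) * ?GH z"
        by (intro tendsto_intros)
      moreover have "1 / 2 * ((cross2 w (snd z) + \<sigma> * cross2 (fst z) w) * (2 * s * (w \<bullet> fst z) - 2 * s * (\<sigma> * (w \<bullet> snd z))))
          = s * (cross2 w (fst z + snd z) * (w \<bullet> (fst z + snd z)))"
        unfolding cross2_commute[of "fst z" w] \<sigma> by (simp add: cross2_simps inner_add_right algebra_simps)
      ultimately show "(\<lambda>n. J n z) \<longlonglongrightarrow> of_real (s * (cross2 w (fst z + snd z) * (w \<bullet> (fst z + snd z)))) *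
        \<Phi> (fst z + snd z) * ?GH z"
        unfolding J by (simp only: \<sigma>) simp
    qed
    show "(\<lambda>z. of_real (s * (cross2 w (fst z + snd z) * (w \<bullet> (fst z + snd z)))) * \<Phi> (fst z + snd z) * ?GH z)
        \<in> borel_measurable lborel"
    proof -
      have "continuous_on UNIV (\<lambda>z :: (real^2) \<times> (real^2). complex_of_real (s * (cross2 w (fst z + snd z) * (w \<bullet> (fst z + snd z)))) *
          \<Phi> (fst z + snd z))"
        unfolding cross2_def by (intro continuous_intros continuous_on_compose2[OF \<Phi>(1)]) auto
      then show ?thesis
        using borel_measurable_times[OF borel_measurable_continuous_onI GHm] by simp
    qed
  qed (use JW in auto)
  show "(\<lambda>n. of_real (l n powr (-2 * s)) * (LINT z|lborel. I n z)) \<longlonglongrightarrow> 0"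
    if \<sigma>: "\<sigma> = 1" and M': "\<And>x. norm x * cmod (\<Phi> x) \<le> M'"
  proof -
    have "(\<lambda>n. LINT z|lborel. J n z) \<longlonglongrightarrow> (LINT z|(lborel :: ((real^2) \<times> (real^2)) measure). 0)"
    proof (rule integral_dominated_convergence[OF _ _ Wi])
      show "AE z in lborel. (\<lambda>n. J n z) \<longlonglongrightarrow> 0"
      proof (intro AE_I2)
        fix z :: "(real^2) \<times> (real^2)"
        let ?u = "fst z + snd z"
        define c where "c = 5 * R\<^sup>2 * L * cmod (?GH z)"
        have c: "0 \<le> c" unfolding c_def using L by simp
        have bound: "norm (J n z) \<le> c * (\<bar>M'\<bar> / (2 * l n - norm ?u))" if "norm ?u < l n" for n
        proof (cases "?GH z = 0")
          case False
          let ?x = "(l n *\<^sub>R w + fst z) + ((\<sigma> * l n) *\<^sub>R w + snd z)"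
          have "?x = (2 * l n) *\<^sub>R w + ?u" using \<sigma> by (simp add: scaleR_2[symmetric] algebra_simps)
          moreover have "2 * l n - norm ?u \<le> norm ((2 * l n) *\<^sub>R w + ?u)"
            using norm_diff_ineq[of "(2 * l n) *\<^sub>R w" ?u] w lpos[of n] by simp
          ultimately have x: "2 * l n - norm ?u \<le> norm ?x" by metis
          have pos: "0 < 2 * l n - norm ?u" using that lpos[of n] by linarith
          have "(2 * l n - norm ?u) * cmod (\<Phi> ?x) \<le> norm ?x * cmod (\<Phi> ?x)"
            by (intro mult_right_mono x) simp
          also have "\<dots> \<le> \<bar>M'\<bar>" using M'[of ?x] by linarith
          finally have \<Phi>x: "cmod (\<Phi> ?x) \<le> \<bar>M'\<bar> / (2 * l n - norm ?u)"
            using pos by (simp add: field_simps)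
          have "norm (J n z) = (1 / 2 * \<bar>S n z\<bar>) * cmod (\<Phi> ?x) * cmod (?GH z)"
            unfolding J by (simp add: norm_mult abs_mult)
          also have "\<dots> \<le> (1 / 2 * (10 * R\<^sup>2 * L)) * (\<bar>M'\<bar> / (2 * l n - norm ?u)) * cmod (?GH z)"
            using R L by (intro mult_right_mono mult_mono mult_left_mono Sb[OF False] \<Phi>x) auto
          finally show ?thesis by (simp add: c_def mult_ac)
        next
          case True
          have "J n z = 0" unfolding J True by simp
          then show ?thesis using c lpos[of n] that by simp
        qed
        have "filterlim (\<lambda>n. 2 * l n - norm ?u) at_top sequentially"
          using filterlim_tendsto_add_at_top[OF tendsto_const[of "- norm ?u"]
              filterlim_tendsto_pos_mult_at_top[OF tendsto_const[of "2::real"] _ l(1)]]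
          by simp
        then have "(\<lambda>n. c * (\<bar>M'\<bar> / (2 * l n - norm ?u))) \<longlonglongrightarrow> c * 0"
          by (intro tendsto_mult_left real_tendsto_divide_at_top[OF tendsto_const])
        moreover have "eventually (\<lambda>n. norm ?u < l n) sequentially"
          using l(1) by (simp add: filterlim_at_top_dense)
        then have "eventually (\<lambda>n. norm (J n z) \<le> c * (\<bar>M'\<bar> / (2 * l n - norm ?u))) sequentially"
          by (rule eventually_mono) (rule bound)
        ultimately show "(\<lambda>n. J n z) \<longlonglongrightarrow> 0" by (simp add: Lim_null_comparison)
      qed
    qed (use JW in auto)
    then show ?thesis unfolding JI by simp
  qed
qed

section \<open>The nonlinearity on the Fourier side\<close>

lemma ift_continuous: "cs_int a \<Longrightarrow> continuous_on UNIV (ift a)"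
  by (intro smooth_continuous smooth_ift)

lemma integrable_mult_bounded:
  fixes f g :: "'a::euclidean_space \<Rightarrow> complex"
  assumes f: "integrable lborel f" and g: "continuous_on UNIV g" "\<And>x. cmod (g x) \<le> B"
  shows "integrable lborel (\<lambda>x. f x * g x)"
proof (rule Bochner_Integration.integrable_bound)
  show "integrable lborel (\<lambda>x. B * cmod (f x))" using f by (intro integrable_mult_right integrable_norm)
  show "(\<lambda>x. f x * g x) \<in> borel_measurable lborel"
    using borel_measurable_times[OF _ borel_measurable_continuous_onI[OF g(1)]]
      borel_measurable_integrable[OF f] by simp
  have B: "0 \<le> B" using g(2) norm_ge_zero order_trans by blast
  show "AE x in lborel. norm (f x * g x) \<le> norm (B * cmod (f x))"
    using B by (intro AE_I2) (simp add: norm_mult abs_mult mult.commute[of "cmod (f _)"] mult_right_mono[OF g(2)])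
qed

text \<open>The integral of \<open>\<phi>\<close> against a product of two transforms, as an integral over pairs of
  frequencies.\<close>

lemma trilinear_fubini:
  assumes \<phi>: "cs_int \<phi>" and f: "cs_int f" and g: "cs_int g"
  shows "integrable lborel (\<lambda>x. \<phi> x * (ift f x * ift g x))" (is ?i1)
    and "integrable lborel (\<lambda>z. f (fst z) * g (snd z) * ift \<phi> (fst z + snd z))" (is ?i2)
    and "(LINT x|lborel. \<phi> x * (ift f x * ift g x)) =
      (LINT z|lborel. f (fst z) * g (snd z) * ift \<phi> (fst z + snd z))" (is ?e)
proof -
  have i: "integrable lborel \<phi>" "integrable lborel f" "integrable lborel g"
    using assms by (auto intro: cs_int_integrable)
  have fg: "integrable lborel (\<lambda>z. f (fst z) * g (snd z))" by (rule lborel_integrable_prod[OF i(2,3)])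
  obtain Bf Bg B\<phi> where B: "\<And>x. cmod (ift f x) \<le> Bf" "\<And>x. cmod (ift g x) \<le> Bg" "\<And>x. cmod (ift \<phi> x) \<le> B\<phi>"
    using ift_bounded i by metis
  have Bf: "0 \<le> Bf" using B(1) norm_ge_zero order_trans by blast
  show ?i1
  proof (rule integrable_mult_bounded[OF i(1), of _ "Bf * Bg"])
    show "continuous_on UNIV (\<lambda>x. ift f x * ift g x)" by (intro continuous_intros ift_continuous f g)
    show "cmod (ift f x * ift g x) \<le> Bf * Bg" for x
      unfolding norm_mult using Bf by (intro mult_mono B) auto
  qed
  show ?i2
  proof (rule integrable_mult_bounded[OF fg, of _ B\<phi>])
    show "continuous_on UNIV (\<lambda>z :: (real^2) \<times> (real^2). ift \<phi> (fst z + snd z))"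
      by (intro continuous_on_compose2[OF ift_continuous[OF \<phi>]] continuous_intros) auto
  qed (rule B)
  have prod: "ift f x * ift g x = (LINT z|lborel. cis (x \<bullet> (fst z + snd z)) * (f (fst z) * g (snd z)))" for x
  proof -
    have "(LINT \<xi>|lborel. (cis (x \<bullet> \<xi>) * f \<xi>) * (LINT \<eta>|lborel. 1 * (cis (x \<bullet> \<eta>) * g \<eta>))) =
        (LINT z|lborel. 1 * ((cis (x \<bullet> fst z) * f (fst z)) * (cis (x \<bullet> snd z) * g (snd z))))"
      by (rule fubini_kernel(2)[OF ift_integrand_integrable[OF i(2)] ift_integrand_integrable[OF i(3)], of "\<lambda>_ _. 1" 1])
        auto
    also have "\<dots> = (LINT z|lborel. cis (x \<bullet> (fst z + snd z)) * (f (fst z) * g (snd z)))"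
      by (simp add: inner_add_right cis_mult[symmetric] mult_ac)
    finally show ?thesis by (simp add: ift_def)
  qed
  have "(LINT x|lborel. \<phi> x * (ift f x * ift g x)) =
      (LINT z|lborel. (f (fst z) * g (snd z)) * (LINT x|lborel. cis (x \<bullet> (fst z + snd z)) * \<phi> x))"
    unfolding prod
  proof (rule fubini_kernel(3)[OF i(1) fg, of _ 1])
    show "(\<lambda>z :: (real^2) \<times> ((real^2) \<times> (real^2)). cis (fst z \<bullet> (fst (snd z) + snd (snd z)))) \<in> borel_measurable borel"
      by (intro borel_measurable_continuous_onI continuous_intros)
  qed simp
  then show ?e by (simp add: ift_def inner_commute)
qed

lemma ift_reflect:
  assumes "cs_int G"
  shows "ift (\<lambda>v. cnj (G (- v))) x = cnj (ift G x)"
proof -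
  let ?f = "\<lambda>v. cis (x \<bullet> (- v)) * cnj (G v)"
  have m: "(\<lambda>v. cis ((- x) \<bullet> v) * cnj (G v)) \<in> borel_measurable borel"
    using borel_measurable_integrable[OF ift_integrand_integrable[of "\<lambda>v. cnj (G v)" "- x"]]
      cs_int_integrable[OF assms] by simp
  have "ift (\<lambda>v. cnj (G (- v))) x = (LINT v|lborel. ?f (0 + (-1) *\<^sub>R v))"
    unfolding ift_def by simp
  also have "\<dots> = (LINT v|lborel. ?f v)"
    using lborel_integral_affine[of ?f "-1" 0] m by simp
  also have "\<dots> = cnj (ift G x)"
    unfolding ift_def by (subst Bochner_Integration.integral_cnj[symmetric]) (simp add: cis_cnj)
  finally show ?thesis .
qed

lemma fourier_Re_ift:
  assumes a: "test_fun a" and \<theta>: "\<And>x. complex_of_real (\<theta> x) = ift a x"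
  shows "fourier \<theta> \<xi> = of_real ((2 * pi)\<^sup>2) * a \<xi>"
  unfolding fourier_def \<theta> by (rule fourier_inversion[OF a])

lemma fmult_Re_ift:
  assumes a: "test_fun a" and \<theta>: "\<And>x. complex_of_real (\<theta> x) = ift a x"
  shows "fmult m \<theta> = ift (\<lambda>\<xi>. of_real (m \<xi>) * a \<xi>)"
proof
  fix x
  have "(LINT \<xi>|lborel. cis (x \<bullet> \<xi>) * (of_real (m \<xi>) * fourier \<theta> \<xi>)) =
      (LINT \<xi>|lborel. of_real ((2 * pi)\<^sup>2) * (cis (x \<bullet> \<xi>) * (of_real (m \<xi>) * a \<xi>)))"
    unfolding fourier_Re_ift[OF a \<theta>] by (simp only: mult_ac)
  also have "\<dots> = of_real ((2 * pi)\<^sup>2) * ift (\<lambda>\<xi>. of_real (m \<xi>) * a \<xi>) x"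
    unfolding ift_def by (rule integral_mult_right_zero)
  finally show "fmult m \<theta> x = ift (\<lambda>\<xi>. of_real (m \<xi>) * a \<xi>) x"
    unfolding fmult_def by simp
qed

lemma powr_between_le:
  assumes "0 < r" "r \<le> x" "x \<le> (R::real)"
  shows "x powr p \<le> r powr p + R powr p"
proof (cases "0 \<le> p")
  case True
  then have "x powr p \<le> R powr p" using assms by (intro powr_mono2) auto
  then show ?thesis by (simp add: add_increasing)
next
  case False
  then have "x powr p \<le> r powr p" using assms by (intro powr_mono2') auto
  then show ?thesis by (simp add: add_increasing2)
qed

lemma mSQG_form_eq_kernel:
  assumes a: "test_fun a" and \<theta>: "\<And>x. complex_of_real (\<theta> x) = ift a x"
    and r: "0 < r" "\<And>\<xi>. norm \<xi> < r \<Longrightarrow> a \<xi> = 0"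
    and \<phi>: "test_fun \<phi>" and s: "s = -1 + \<delta>"
  shows "mSQG_form \<delta> \<phi> \<theta> = (LINT z|lborel. comm_kernel s (ift (\<lambda>x. of_real (\<phi> x))) (fst z) (snd z) *
      (a (fst z) * a (snd z)))"
proof -
  let ?\<Phi> = "ift (\<lambda>x. of_real (\<phi> x))"
  define S where "S \<xi> = norm \<xi> powr (2 * s)" for \<xi> :: "real^2"
  have \<phi>c: "cs_int (\<lambda>x. complex_of_real (\<phi> x))"
    by (intro test_fun_cs_int test_fun_bounded_linear[OF bounded_linear_of_real \<phi>])
  have ac: "cs_int a" by (rule test_fun_cs_int[OF a])
  obtain R where R: "\<And>\<xi>. R < norm \<xi> \<Longrightarrow> a \<xi> = 0" by (rule test_funE[OF a]) (rule that)
  have Sa: "cs_int (\<lambda>\<xi>. of_real (S \<xi>) * a \<xi>)"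
  proof (rule cs_int_mult[OF ac, of _ "r powr (2 * s) + R powr (2 * s)"])
    show "(\<lambda>\<xi>. complex_of_real (S \<xi>)) \<in> borel_measurable borel"
      unfolding S_def by measurable
    show "norm (complex_of_real (S \<xi>)) \<le> r powr (2 * s) + R powr (2 * s)" if "a \<xi> \<noteq> 0" for \<xi>
    proof -
      have "r \<le> norm \<xi>" "norm \<xi> \<le> R" using r(2)[of \<xi>] R[of \<xi>] that by force+
      then show ?thesis unfolding S_def using powr_between_le[OF r(1)] by simp
    qed
  qed
  let ?A = "\<lambda>j \<xi>. \<i> * of_real (\<xi> $ j) * (of_real (S \<xi>) * a \<xi>)"
  let ?B = "\<lambda>j \<xi>. \<i> * of_real (\<xi> $ j) * a \<xi>"
  have A: "cs_int (?A j)" for j by (rule cs_int_component[OF Sa])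
  have B: "cs_int (?B j)" for j by (rule cs_int_component[OF ac])
  have T: "nabla j (fracLap (-1 + \<delta>) \<theta>) x = ift (?A j) x" for j x
    unfolding fracLap_def fmult_Re_ift[OF a \<theta>] s[symmetric] S_def[symmetric] nabla_ift[OF Sa] ..
  have "\<theta> = (\<lambda>x. Re (ift a x))" using \<theta> by (metis Re_complex_of_real)
  then have \<theta>s: "smooth \<theta>"
    using smooth_bounded_linear[OF bounded_linear_Re smooth_ift[OF ac]] by simp
  have D: "of_real (nabla j \<theta> x) = ift (?B j) x" for j x
  proof -
    have "of_real (nabla j \<theta> x) = nabla j (\<lambda>x. complex_of_real (\<theta> x)) x"
      by (rule nabla_bounded_linear[OF bounded_linear_of_real smooth_differentiable[OF \<theta>s], symmetric])
    then show ?thesis unfolding \<theta> nabla_ift[OF ac] .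
  qed
  have "mSQG_form \<delta> \<phi> \<theta> = (LINT x|lborel. of_real (\<phi> x) * (ift (?A 2) x * ift (?B 1) x) -
      of_real (\<phi> x) * (ift (?A 1) x * ift (?B 2) x))"
    unfolding mSQG_form_def T D by (simp add: sum_2 levi_civita_def right_diff_distrib)
  also have "\<dots> = (LINT x|lborel. of_real (\<phi> x) * (ift (?A 2) x * ift (?B 1) x)) -
      (LINT x|lborel. of_real (\<phi> x) * (ift (?A 1) x * ift (?B 2) x))"
    by (intro Bochner_Integration.integral_diff trilinear_fubini(1)[OF \<phi>c A B])
  also have "\<dots> = (LINT z|lborel. ?A 2 (fst z) * ?B 1 (snd z) * ?\<Phi> (fst z + snd z)) -
      (LINT z|lborel. ?A 1 (fst z) * ?B 2 (snd z) * ?\<Phi> (fst z + snd z))"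
    unfolding trilinear_fubini(3)[OF \<phi>c A B] ..
  also have "\<dots> = (LINT z|lborel. ?A 2 (fst z) * ?B 1 (snd z) * ?\<Phi> (fst z + snd z) -
      ?A 1 (fst z) * ?B 2 (snd z) * ?\<Phi> (fst z + snd z))"
    by (intro Bochner_Integration.integral_diff[symmetric] trilinear_fubini(2)[OF \<phi>c A B])
  also have "(\<lambda>z. ?A 2 (fst z) * ?B 1 (snd z) * ?\<Phi> (fst z + snd z) -
      ?A 1 (fst z) * ?B 2 (snd z) * ?\<Phi> (fst z + snd z)) =
      (\<lambda>z. of_real (cross2 (fst z) (snd z) * S (fst z)) * ?\<Phi> (fst z + snd z) * (a (fst z) * a (snd z)))"
    (is "_ = ?N")
    by (rule ext) (simp add: cross2_def algebra_simps)
  finally have form: "mSQG_form \<delta> \<phi> \<theta> = (LINT z|lborel. ?N z)" .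
  have Ni: "integrable lborel ?N"
  proof -
    have "integrable lborel (\<lambda>z. ?A 2 (fst z) * ?B 1 (snd z) * ?\<Phi> (fst z + snd z) -
      ?A 1 (fst z) * ?B 2 (snd z) * ?\<Phi> (fst z + snd z))"
      by (intro Bochner_Integration.integrable_diff trilinear_fubini(2)[OF \<phi>c A B])
    also have "(\<lambda>z. ?A 2 (fst z) * ?B 1 (snd z) * ?\<Phi> (fst z + snd z) -
      ?A 1 (fst z) * ?B 2 (snd z) * ?\<Phi> (fst z + snd z)) = ?N"
      by (rule ext) (simp add: cross2_def algebra_simps)
    finally show ?thesis .
  qed
  \<comment> \<open>averaging with the exchanged frequencies antisymmetrises the symbol\<close>
  let ?N' = "\<lambda>z. ?N (snd z, fst z)"
  have Ni': "integrable lborel ?N'" "(LINT z|lborel. ?N' z) = (LINT z|lborel. ?N z)"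
  proof -
    have i: "integrable (lborel \<Otimes>\<^sub>M lborel) ?N" using Ni by (simp add: lborel_prod)
    show "integrable lborel ?N'"
      using lborel_pair.integrable_product_swap[OF i] by (simp add: lborel_prod case_prod_beta')
    show "(LINT z|lborel. ?N' z) = (LINT z|lborel. ?N z)"
      using lborel_pair.integral_product_swap[OF borel_measurable_integrable[OF i]]
      by (simp add: lborel_prod case_prod_beta')
  qed
  have "comm_kernel s ?\<Phi> (fst z) (snd z) * (a (fst z) * a (snd z)) = of_real (1/2) * (?N z + ?N' z)" for z
  proof -
    have "of_real (1 / 2 * c * (p - q)) * P * A = of_real (1 / 2) * (of_real (c * p) * P * A + of_real (- (c * q)) * P * A)"
      for c p q :: real and P A :: complex
    proof -
      have "complex_of_real (1 / 2 * c * (p - q)) = of_real (1 / 2) * (of_real (c * p) + of_real (- (c * q)))"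
      proof -
        have "1 / 2 * c * (p - q) = 1 / 2 * (c * p + - (c * q))" by (simp add: field_simps)
        then show ?thesis by (metis of_real_mult of_real_add)
      qed
      then show ?thesis by (simp only: distrib_left distrib_right mult.assoc)
    qed
    moreover have "?N' z = of_real (- (cross2 (fst z) (snd z) * S (snd z))) * ?\<Phi> (fst z + snd z) * (a (fst z) * a (snd z))"
      by (simp add: cross2_commute[of "snd z" "fst z"] add.commute[of "snd z" "fst z"] mult.commute[of "a (snd z)"])
    ultimately show ?thesis unfolding comm_kernel_def S_def[symmetric] by simp
  qed
  then have "(LINT z|lborel. comm_kernel s ?\<Phi> (fst z) (snd z) * (a (fst z) * a (snd z))) =
      of_real (1/2) * (LINT z|lborel. ?N z + ?N' z)"
    by (simp only: integral_mult_right_zero)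
  also have "(LINT z|lborel. ?N z + ?N' z) = (LINT z|lborel. ?N z) + (LINT z|lborel. ?N' z)"
    by (rule Bochner_Integration.integral_add[OF Ni Ni'(1)])
  finally show ?thesis unfolding form Ni'(2) by simp
qed

text \<open>The derivative of \<open>f\<close> in direction \<open>w\<close> and then in the direction of \<open>w\<close> turned by a right angle.\<close>

definition perp_hess :: "real^2 \<Rightarrow> (real^2 \<Rightarrow> 'b::real_normed_vector) \<Rightarrow> real^2 \<Rightarrow> 'b" where
  "perp_hess w f x =
    (w $ 1 * w $ 1) *\<^sub>R nabla 2 (nabla 1 f) x + (w $ 1 * w $ 2) *\<^sub>R nabla 2 (nabla 2 f) x -
    (w $ 2 * w $ 1) *\<^sub>R nabla 1 (nabla 1 f) x - (w $ 2 * w $ 2) *\<^sub>R nabla 1 (nabla 2 f) x"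

lemma nabla_of_real:
  assumes "smooth f"
  shows "nabla j (\<lambda>x. complex_of_real (f x)) = (\<lambda>x. of_real (nabla j f x))"
  by (rule ext, rule nabla_bounded_linear[OF bounded_linear_of_real smooth_differentiable[OF assms]])

lemma perp_hess_of_real:
  "smooth f \<Longrightarrow> perp_hess w (\<lambda>x. complex_of_real (f x)) x = of_real (perp_hess w f x)"
  unfolding perp_hess_def by (simp add: nabla_of_real smooth_nabla scaleR_conv_of_real)

lemma perp_hess_test_fun:
  assumes "test_fun f"
  shows "test_fun (perp_hess w f)"
proof -
  have t: "test_fun (\<lambda>x. c *\<^sub>R nabla i (nabla j f) x)" for c i j
    by (intro test_fun_bounded_linear[OF bounded_linear_scaleR_right] test_fun_nabla assms)
  have "perp_hess w f = (\<lambda>x. (((w $ 1 * w $ 1) *\<^sub>R nabla 2 (nabla 1 f) x + (w $ 1 * w $ 2) *\<^sub>R nabla 2 (nabla 2 f) x) +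
    (- (w $ 2 * w $ 1)) *\<^sub>R nabla 1 (nabla 1 f) x) + (- (w $ 2 * w $ 2)) *\<^sub>R nabla 1 (nabla 2 f) x)"
    unfolding perp_hess_def by (rule ext) simp
  then show ?thesis by (simp only:) (intro test_fun_add t)
qed

lemma ift_perp_hess:
  assumes f: "test_fun f"
  shows "ift (perp_hess w f) \<zeta> = - (of_real (cross2 w \<zeta> * (w \<bullet> \<zeta>)) * ift f \<zeta>)"
proof -
  have i: "integrable lborel (\<lambda>\<xi>. of_real c * nabla i (nabla j f) \<xi>)" for c i j
    by (intro integrable_mult_right test_fun_integrable test_fun_nabla f)
  have d: "ift (nabla i (nabla j f)) \<zeta> = - (of_real (\<zeta> $ i * \<zeta> $ j) * ift f \<zeta>)" for i j
    unfolding ift_nabla[OF test_fun_nabla[OF f]] ift_nabla[OF f] by (simp add: mult_ac)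
  have "perp_hess w f = (\<lambda>x. ((of_real (w $ 1 * w $ 1) * nabla 2 (nabla 1 f) x + of_real (w $ 1 * w $ 2) * nabla 2 (nabla 2 f) x) +
    of_real (- (w $ 2 * w $ 1)) * nabla 1 (nabla 1 f) x) + of_real (- (w $ 2 * w $ 2)) * nabla 1 (nabla 2 f) x)"
    unfolding perp_hess_def by (rule ext) (simp add: scaleR_conv_of_real)
  then have "ift (perp_hess w f) \<zeta> =
      of_real (w $ 1 * w $ 1) * ift (nabla 2 (nabla 1 f)) \<zeta> + of_real (w $ 1 * w $ 2) * ift (nabla 2 (nabla 2 f)) \<zeta> +
      of_real (- (w $ 2 * w $ 1)) * ift (nabla 1 (nabla 1 f)) \<zeta> + of_real (- (w $ 2 * w $ 2)) * ift (nabla 1 (nabla 2 f)) \<zeta>"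
    by (simp only: ift_add Bochner_Integration.integrable_add i ift_cmult)
  then show ?thesis unfolding d by (simp add: cross2_def inner_vec_def sum_2 algebra_simps)
qed

section \<open>The nonlinearity on wave packets\<close>

text \<open>The transform of a wave packet with profile \<open>G\<close> at frequency \<open>p\<close>. The second summand is the
  reflected conjugate of the first, so that the packet itself is real.\<close>

definition packet :: "(real^2 \<Rightarrow> complex) \<Rightarrow> real^2 \<Rightarrow> real^2 \<Rightarrow> complex" where
  "packet G p \<xi> = G (\<xi> - p) + cnj (G (- \<xi> - p))"

lemma packet_test_fun:
  assumes "test_fun G"
  shows "test_fun (packet G p)"
proof -
  have "test_fun (\<lambda>\<xi>. G (1 *\<^sub>R \<xi> + (- p)))" "test_fun (\<lambda>\<xi>. cnj (G ((-1) *\<^sub>R \<xi> + (- p))))"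
    by (intro test_fun_affine test_fun_bounded_linear[OF bounded_linear_cnj] assms; simp)+
  then have "test_fun (\<lambda>\<xi>. G (1 *\<^sub>R \<xi> + (- p)) + cnj (G ((-1) *\<^sub>R \<xi> + (- p))))"
    by (rule test_fun_add)
  then show ?thesis unfolding packet_def[abs_def] by simp
qed

lemma ift_packet_real:
  assumes "test_fun G"
  shows "complex_of_real (Re (ift (packet G p) x)) = ift (packet G p) x"
proof -
  have "packet G p = (\<lambda>v. cnj (packet G p (- v)))"
    by (rule ext) (simp add: packet_def add.commute)
  then have "ift (packet G p) x = ift (\<lambda>v. cnj (packet G p (- v))) x" by metis
  also have "\<dots> = cnj (ift (packet G p) x)"
    by (rule ift_reflect[OF test_fun_cs_int[OF packet_test_fun[OF assms]]])
  finally show ?thesis by (metis Reals_cnj_iff of_real_Re)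
qed

lemma packet_support:
  assumes R: "\<And>x. R < norm x \<Longrightarrow> G x = 0" and nz: "packet G p \<xi> \<noteq> 0"
  shows "norm p - R \<le> norm \<xi>" "norm \<xi> \<le> norm p + R"
proof -
  have "norm (\<xi> - p) \<le> R \<or> norm (\<xi> + p) \<le> R"
  proof (rule ccontr)
    assume "\<not> ?thesis"
    then have "G (\<xi> - p) = 0" "G (- \<xi> - p) = 0"
      using R[of "\<xi> - p"] R[of "- \<xi> - p"] norm_minus_cancel[of "\<xi> + p"] by auto
    then show False using nz by (simp add: packet_def)
  qed
  then show "norm p - R \<le> norm \<xi>" "norm \<xi> \<le> norm p + R"
    using norm_triangle_ineq2[of \<xi> p] norm_triangle_ineq2[of p \<xi>] norm_triangle_ineq2[of \<xi> "-p"]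
      norm_triangle_ineq2[of "-p" \<xi>] norm_minus_commute[of \<xi> p] norm_minus_commute[of \<xi> "-p"]
    by auto
qed

lemma lborel_translate_pair:
  fixes F :: "(real^2) \<times> (real^2) \<Rightarrow> complex"
  assumes i: "integrable lborel (\<lambda>z. F (p + fst z, q + snd z))"
  shows "integrable lborel F" "(LINT z|lborel. F z) = (LINT z|lborel. F (p + fst z, q + snd z))"
proof -
  have eq: "(\<lambda>z. F (p + fst z, q + snd z)) = (\<lambda>z. F ((p, q) + z))"
    by (auto simp: plus_prod_def)
  have "integrable lborel (\<lambda>z. F ((p, q) + (- (p, q) + z)))"
    using lborel_integrable_translate[OF i[unfolded eq], of "- (p, q)"] .
  then show 1: "integrable lborel F" by (simp only: add_minus_cancel)
  show "(LINT z|lborel. F z) = (LINT z|lborel. F (p + fst z, q + snd z))"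
    unfolding eq using borel_measurable_integrable[OF 1] by (intro lborel_integral_translate[symmetric]) simp
qed

lemma mSQG_form_packet_limit:
  fixes w :: "real^2" and l :: "nat \<Rightarrow> real" and \<phi> :: "real^2 \<Rightarrow> real"
  assumes w: "norm w = 1" and G: "test_fun G" "\<And>x. R < norm x \<Longrightarrow> G x = 0"
    and R: "0 < R" and l: "filterlim l at_top sequentially" "\<And>n. 2 * R \<le> l n"
    and \<phi>: "test_fun \<phi>" and s: "s = -1 + \<delta>"
  shows "(\<lambda>n. of_real (l n powr (-2 * s)) * mSQG_form \<delta> \<phi> (\<lambda>x. Re (ift (packet G (l n *\<^sub>R w)) x)))
    \<longlonglongrightarrow> of_real (-2 * s * (LINT x|lborel. perp_hess w \<phi> x * (cmod (ift G x))\<^sup>2))"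
proof -
  define H where "H v = cnj (G (- v))" for v
  define \<Phi> where "\<Phi> = ift (\<lambda>x. of_real (\<phi> x))"
  have \<phi>t: "test_fun (\<lambda>x. complex_of_real (\<phi> x))"
    by (rule test_fun_bounded_linear[OF bounded_linear_of_real \<phi>])
  have Ht: "test_fun H"
    using test_fun_bounded_linear[OF bounded_linear_cnj test_fun_affine[OF G(1), of "-1" 0]]
    by (simp add: H_def[abs_def])
  have HR: "\<And>x. R < norm x \<Longrightarrow> H x = 0" using G(2) by (simp add: H_def)
  have Gi: "integrable lborel G" and Hi: "integrable lborel H"
    using G(1) Ht by (auto intro: test_fun_integrable)
  have \<Phi>c: "continuous_on UNIV \<Phi>"
    unfolding \<Phi>_def by (rule ift_continuous[OF test_fun_cs_int[OF \<phi>t]])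
  obtain M where M: "\<And>x. cmod (\<Phi> x) \<le> M"
    unfolding \<Phi>_def using ift_bounded[OF test_fun_integrable[OF \<phi>t]] by blast
  obtain M' where M': "\<And>x. norm x ^ 1 * cmod (\<Phi> x) \<le> M'"
    unfolding \<Phi>_def using ift_decay[OF \<phi>t] by blast
  then have M': "\<And>x. norm x * cmod (\<Phi> x) \<le> M'" by simp
  have w': "norm (- w) = 1" using w by simp
  define I where "I \<sigma> w G H n z = comm_kernel s \<Phi> (l n *\<^sub>R w + fst z) ((\<sigma> * l n) *\<^sub>R w + snd z) * (G (fst z) * H (snd z))"
    for \<sigma> and w :: "real^2" and G H :: "real^2 \<Rightarrow> complex" and n z
  note P = comm_kernel_packets[OF _ _ \<Phi>c M _ _ _ _ R l, where s = s, folded I_def]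
  note P1 = P[OF w _ Gi G(2) Gi G(2)] and P2 = P[OF w _ Gi G(2) Hi HR]
    and P3 = P[OF w' _ Hi HR Gi G(2)] and P4 = P[OF w' _ Hi HR Hi HR]
  let ?K = "\<lambda>z. comm_kernel s \<Phi> (fst z) (snd z)"
  \<comment> \<open>the interactions of the two halves of the packet, each moved back to the origin\<close>
  have form: "mSQG_form \<delta> \<phi> (\<lambda>x. Re (ift (packet G (l n *\<^sub>R w)) x)) =
      (LINT z|lborel. I 1 w G G n z) + (LINT z|lborel. I (-1) w G H n z) +
      ((LINT z|lborel. I (-1) (-w) H G n z) + (LINT z|lborel. I 1 (-w) H H n z))" for n
  proof -
    let ?p = "l n *\<^sub>R w"
    let ?a = "packet G ?p"
    have ln: "0 < l n" using R l(2)[of n] by linarith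
    have a0: "?a \<xi> = 0" if "norm \<xi> < R" for \<xi>
      using packet_support(1)[OF G(2), where p = ?p and \<xi> = \<xi>] that w ln l(2)[of n] by fastforce
    have a: "?a \<xi> = G (\<xi> - ?p) + H (\<xi> + ?p)" for \<xi>
      by (simp add: packet_def H_def)
    define F where "F f g p q z = ?K z * (f (fst z - p) * g (snd z - q))"
      for f g :: "real^2 \<Rightarrow> complex" and p q :: "real^2" and z
    have F1: "(\<lambda>z. F G G ?p ?p (?p + fst z, ?p + snd z)) = I 1 w G G n"
      and F2: "(\<lambda>z. F G H ?p (-?p) (?p + fst z, -?p + snd z)) = I (-1) w G H n"
      and F3: "(\<lambda>z. F H G (-?p) ?p (-?p + fst z, ?p + snd z)) = I (-1) (-w) H G n"
      and F4: "(\<lambda>z. F H H (-?p) (-?p) (-?p + fst z, -?p + snd z)) = I 1 (-w) H H n"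
      by (auto simp: F_def I_def)
    note T1 = lborel_translate_pair[of "F G G ?p ?p" ?p ?p, unfolded F1, OF P1(1)]
      and T2 = lborel_translate_pair[of "F G H ?p (-?p)" ?p "-?p", unfolded F2, OF P2(1)]
      and T3 = lborel_translate_pair[of "F H G (-?p) ?p" "-?p" ?p, unfolded F3, OF P3(1)]
      and T4 = lborel_translate_pair[of "F H H (-?p) (-?p)" "-?p" "-?p", unfolded F4, OF P4(1)]
    have "mSQG_form \<delta> \<phi> (\<lambda>x. Re (ift ?a x)) = (LINT z|lborel. ?K z * (?a (fst z) * ?a (snd z)))"
      unfolding \<Phi>_def
      by (rule mSQG_form_eq_kernel[OF packet_test_fun[OF G(1)] ift_packet_real[OF G(1)] R a0 \<phi> s])
    also have "\<dots> = (LINT z|lborel. (F G G ?p ?p z + F G H ?p (-?p) z) + (F H G (-?p) ?p z + F H H (-?p) (-?p) z))"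
      unfolding a F_def by (simp add: ring_distribs add_ac)
    also have "\<dots> = ((LINT z|lborel. F G G ?p ?p z) + (LINT z|lborel. F G H ?p (-?p) z)) +
        ((LINT z|lborel. F H G (-?p) ?p z) + (LINT z|lborel. F H H (-?p) (-?p) z))"
      using T1(1) T2(1) T3(1) T4(1) by (simp add: Bochner_Integration.integrable_add)
    finally show ?thesis using T1(2) T2(2) T3(2) T4(2) by simp
  qed
  let ?\<Psi> = "perp_hess w (\<lambda>x. complex_of_real (\<phi> x))"
  have \<Psi>c: "cs_int ?\<Psi>" by (rule test_fun_cs_int[OF perp_hess_test_fun[OF \<phi>t]])
  have lim: "(LINT z|lborel. of_real (s * (cross2 w (fst z + snd z) * (w \<bullet> (fst z + snd z)))) * \<Phi> (fst z + snd z) *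
        (f (fst z) * g (snd z))) = of_real (- s) * (LINT x|lborel. ?\<Psi> x * (ift f x * ift g x))"
    if "test_fun f" "test_fun g" for f g
  proof -
    have "(LINT z|lborel. of_real (s * (cross2 w (fst z + snd z) * (w \<bullet> (fst z + snd z)))) * \<Phi> (fst z + snd z) *
        (f (fst z) * g (snd z))) = (LINT z|lborel. of_real (- s) * (f (fst z) * g (snd z) * ift ?\<Psi> (fst z + snd z)))"
      unfolding ift_perp_hess[OF \<phi>t] \<Phi>_def by (simp add: mult_ac)
    also have "\<dots> = of_real (- s) * (LINT z|lborel. f (fst z) * g (snd z) * ift ?\<Psi> (fst z + snd z))"
      by (rule integral_mult_right_zero)
    also have "\<dots> = of_real (- s) * (LINT x|lborel. ?\<Psi> x * (ift f x * ift g x))"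
      using trilinear_fubini(3)[OF \<Psi>c that[THEN test_fun_cs_int]] by simp
    finally show ?thesis .
  qed
  have sq: "ift G x * ift H x = of_real ((cmod (ift G x))\<^sup>2)" for x
    unfolding H_def ift_reflect[OF test_fun_cs_int[OF G(1)]] by (rule complex_norm_square[symmetric])
  have "(LINT x|lborel. ?\<Psi> x * (ift G x * ift H x)) = (LINT x|lborel. complex_of_real (perp_hess w \<phi> x * (cmod (ift G x))\<^sup>2))"
    unfolding sq perp_hess_of_real[OF test_fun_smooth[OF \<phi>]] by simp
  also have "\<dots> = of_real (LINT x|lborel. perp_hess w \<phi> x * (cmod (ift G x))\<^sup>2)"
    by (rule integral_complex_of_real)
  finally have val: "(LINT x|lborel. ?\<Psi> x * (ift G x * ift H x)) = of_real (LINT x|lborel. perp_hess w \<phi> x * (cmod (ift G x))\<^sup>2)" .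
  have val': "(LINT x|lborel. ?\<Psi> x * (ift H x * ift G x)) = of_real (LINT x|lborel. perp_hess w \<phi> x * (cmod (ift G x))\<^sup>2)"
    using val by (simp add: mult.commute)
  have ww: "cross2 (- w) y * ((- w) \<bullet> y) = cross2 w y * (w \<bullet> y)" for y
    by (simp add: cross2_minus)
  have L1: "(\<lambda>n. of_real (l n powr (-2 * s)) * (LINT z|lborel. I 1 w G G n z)) \<longlonglongrightarrow> 0"
    by (rule P1(3)) (use M' in auto)
  have L4: "(\<lambda>n. of_real (l n powr (-2 * s)) * (LINT z|lborel. I 1 (-w) H H n z)) \<longlonglongrightarrow> 0"
    by (rule P4(3)) (use M' in auto)
  have L2: "(\<lambda>n. of_real (l n powr (-2 * s)) * (LINT z|lborel. I (-1) w G H n z)) \<longlonglongrightarrow>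
      of_real (- s) * of_real (LINT x|lborel. perp_hess w \<phi> x * (cmod (ift G x))\<^sup>2)"
    using P2(2)[of "-1"] unfolding lim[OF G(1) Ht] val by simp
  have L3: "(\<lambda>n. of_real (l n powr (-2 * s)) * (LINT z|lborel. I (-1) (-w) H G n z)) \<longlonglongrightarrow>
      of_real (- s) * of_real (LINT x|lborel. perp_hess w \<phi> x * (cmod (ift G x))\<^sup>2)"
    using P3(2)[of "-1"] unfolding ww lim[OF Ht G(1)] val' by simp
  have "(\<lambda>n. of_real (l n powr (-2 * s)) * mSQG_form \<delta> \<phi> (\<lambda>x. Re (ift (packet G (l n *\<^sub>R w)) x)))
    \<longlonglongrightarrow> (0 + of_real (- s) * of_real (LINT x|lborel. perp_hess w \<phi> x * (cmod (ift G x))\<^sup>2)) +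
      (of_real (- s) * of_real (LINT x|lborel. perp_hess w \<phi> x * (cmod (ift G x))\<^sup>2) + 0)"
    unfolding form distrib_left by (intro tendsto_add L1 L2 L3 L4)
  then show ?thesis by (simp add: mult.assoc)
qed

section \<open>The homogeneous Sobolev norm of wave packets\<close>

lemma LP_cutoff_test_fun:
  assumes "LP_cutoff m"
  shows "test_fun m" "\<And>\<xi>. 1 < norm \<xi> \<Longrightarrow> m \<xi> = 0" "\<And>\<xi>. norm \<xi> \<le> 1 / 2 \<Longrightarrow> m \<xi> = 1"
proof -
  have sub: "supp m \<subseteq> cball 0 1" and sm: "smooth m" using assms by (auto simp: LP_cutoff_def)
  show z: "m \<xi> = 0" if "1 < norm \<xi>" for \<xi>
  proof (rule ccontr)
    assume "m \<xi> \<noteq> 0"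
    then have "\<xi> \<in> supp m" unfolding supp_def support_on_def using closure_subset by fastforce
    then show False using sub that by auto
  qed
  show "test_fun m" by (rule test_funI[OF sm z])
  show "\<And>\<xi>. norm \<xi> \<le> 1 / 2 \<Longrightarrow> m \<xi> = 1" using assms by (auto simp: LP_cutoff_def)
qed

lemma foldr_nabla_Re_ift:
  assumes "test_fun a"
  shows "\<exists>b. test_fun b \<and> foldr nabla js (\<lambda>x. Re (ift a x)) = (\<lambda>x. Re (ift b x))"
proof (induction js)
  case Nil
  then show ?case using assms by auto
next
  case (Cons j js)
  then obtain b where b: "test_fun b" "foldr nabla js (\<lambda>x. Re (ift a x)) = (\<lambda>x. Re (ift b x))" by blast
  have bc: "cs_int b" by (rule test_fun_cs_int[OF b(1)])
  have "nabla j (\<lambda>x. Re (ift b x)) x = Re (nabla j (ift b) x)" for x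
    by (rule nabla_bounded_linear[OF bounded_linear_Re smooth_differentiable[OF smooth_ift[OF bc]]])
  then have "nabla j (\<lambda>x. Re (ift b x)) = (\<lambda>x. Re (ift (\<lambda>\<xi>. \<i> * of_real (\<xi> $ j) * b \<xi>) x))"
    unfolding nabla_ift[OF bc] by blast
  moreover have "test_fun (\<lambda>\<xi>. \<i> * of_real (\<xi> $ j) * b \<xi>)"
    by (rule test_fun_mult[OF smooth_mult[OF smooth_const smooth_component] b(1)])
  ultimately show ?case using b(2) by auto
qed

lemma schwartz_Re_ift:
  assumes "test_fun a"
  shows "schwartz (\<lambda>x. Re (ift a x))"
  unfolding schwartz_def
proof (intro conjI allI)
  show "smooth (\<lambda>x. Re (ift a x))"
    by (rule smooth_bounded_linear[OF bounded_linear_Re smooth_ift[OF test_fun_cs_int[OF assms]]])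
  fix k js
  obtain b where b: "test_fun b" "foldr nabla js (\<lambda>x. Re (ift a x)) = (\<lambda>x. Re (ift b x))"
    using foldr_nabla_Re_ift[OF assms] by blast
  obtain C where C: "\<And>x. norm x ^ k * cmod (ift b x) \<le> C" using ift_decay[OF b(1)] by blast
  have "norm (norm x ^ k *\<^sub>R Re (ift b x)) \<le> C" for x
    using order_trans[OF mult_left_mono[OF abs_Re_le_cmod[of "ift b x"], of "norm x ^ k"] C] by (simp add: abs_mult)
  then show "bounded (range (\<lambda>x. norm x ^ k *\<^sub>R foldr nabla js (\<lambda>x. Re (ift a x)) x))"
    unfolding b(2) bounded_iff by blast
qed

lemma packet_in_S0:
  assumes G: "test_fun G" "\<And>x. R < norm x \<Longrightarrow> G x = 0" and p: "R < norm p"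
  shows "(\<lambda>x. Re (ift (packet G p) x)) \<in> S0"
proof -
  let ?\<theta> = "\<lambda>x. Re (ift (packet G p) x)"
  have t: "test_fun (packet G p)" by (rule packet_test_fun[OF G(1)])
  have F: "fourier ?\<theta> \<xi> = of_real ((2 * pi)\<^sup>2) * packet G p \<xi>" for \<xi>
    by (rule fourier_Re_ift[OF t ift_packet_real[OF G(1)]])
  let ?A = "{\<xi>::real^2. norm p - R \<le> norm \<xi> \<and> norm \<xi> \<le> norm p + R}"
  have cl: "closed ?A" by (intro closed_Collect_conj closed_Collect_le continuous_intros)
  have "support_on UNIV (fourier ?\<theta>) \<subseteq> ?A"
  proof
    fix \<xi> assume "\<xi> \<in> support_on UNIV (fourier ?\<theta>)"
    then have "packet G p \<xi> \<noteq> 0" by (auto simp: support_on_def F)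
    then show "\<xi> \<in> ?A" using packet_support[where G = G and R = R, OF G(2)] by blast
  qed
  then have sub: "supp (fourier ?\<theta>) \<subseteq> ?A" unfolding supp_def using cl by (rule closure_minimal)
  then have "supp (fourier ?\<theta>) \<subseteq> cball 0 (norm p + R)" by auto
  then have "compact (supp (fourier ?\<theta>))"
    unfolding compact_eq_bounded_closed using bounded_subset[OF bounded_cball]
    by (auto simp: supp_def)
  moreover have "supp (fourier ?\<theta>) \<subseteq> - {0}" using sub p by auto
  ultimately show ?thesis using schwartz_Re_ift[OF t] by (simp add: S0_def)
qed

lemma powi_two_scale:
  fixes x :: real and k :: nat and q :: int
  shows "int k + 2 \<le> q \<Longrightarrow> 0 \<le> x \<Longrightarrow> x < 2 * 2 ^ k \<Longrightarrow> 2 powi (- q) * x \<le> 1 / 2"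
    and "q \<le> int k - 1 \<Longrightarrow> 2 ^ k < 2 * x \<Longrightarrow> 1 < 2 powi (- q) * x"
proof -
  assume a: "int k + 2 \<le> q" "0 \<le> x" "x < 2 * 2 ^ k"
  have "(2::real) powi (- q) \<le> 2 powi (- (int k + 2))"
    by (rule power_int_increasing) (use a(1) in simp_all)
  also have "\<dots> = 1 / (4 * 2 ^ k)"
  proof -
    have e: "int k + 2 = int (k + 2)" by simp
    have "(2::real) powi (int k + 2) = 4 * 2 ^ k" unfolding e power_int_of_nat by (simp add: power_add)
    then show ?thesis unfolding power_int_minus by (simp add: inverse_eq_divide)
  qed
  finally have "2 powi (- q) * x \<le> 1 / (4 * 2 ^ k) * x" using a(2) by (rule mult_right_mono)
  also have "\<dots> \<le> 1 / 2" using a(3) by (simp add: field_simps)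
  finally show "2 powi (- q) * x \<le> 1 / 2" .
next
  assume a: "q \<le> int k - 1" "2 ^ k < 2 * x"
  have x: "0 < x" using a(2) zero_less_power[of "2::real" k] by linarith
  have "1 < 2 / 2 ^ k * x" using a(2) by (simp add: field_simps)
  also have "2 / 2 ^ k = (2::real) powi (- (int k - 1))"
    using power_int_diff[of "2::real" 1 "int k"] by simp
  finally have "1 < 2 powi (- (int k - 1)) * x" .
  also have "\<dots> \<le> 2 powi (- q) * x"
    using a x by (intro mult_right_mono power_int_increasing) auto
  finally show "1 < 2 powi (- q) * x" .
qed

lemma test_fun_norm_sq_integrable:
  fixes F :: "real^2 \<Rightarrow> complex"
  assumes "test_fun F"
  shows "integrable lborel (\<lambda>\<xi>. (cmod (F \<xi>))\<^sup>2)"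
proof -
  have "test_fun (\<lambda>\<xi>. F \<xi> * cnj (F \<xi>))"
    by (intro test_fun_mult test_fun_smooth test_fun_bounded_linear[OF bounded_linear_cnj] assms)
  then have "integrable lborel (\<lambda>\<xi>. complex_of_real ((cmod (F \<xi>))\<^sup>2))"
    unfolding complex_norm_square by (rule test_fun_integrable)
  then show ?thesis by (simp only: complex_of_real_integrable_eq)
qed

lemma integral_packet_sq_le:
  assumes G: "test_fun G"
  shows "(LINT \<xi>|lborel. (cmod (packet G p \<xi>))\<^sup>2) \<le> 4 * (LINT \<xi>|lborel. (cmod (G \<xi>))\<^sup>2)"
proof -
  let ?g = "\<lambda>\<xi>. (cmod (G \<xi>))\<^sup>2"
  have gm: "?g \<in> borel_measurable borel" using test_fun_norm_sq_integrable[OF G] by auto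
  have t1: "test_fun (\<lambda>\<xi>. G (\<xi> - p))" using test_fun_affine[OF G, of 1 "- p"] by simp
  have t2: "test_fun (\<lambda>\<xi>. G (- \<xi> - p))" using test_fun_affine[OF G, of "-1" "- p"] by simp
  have e1: "(LINT \<xi>|lborel. ?g (\<xi> - p)) = (LINT \<xi>|lborel. ?g \<xi>)"
    using lborel_integral_affine[OF gm, of 1 "- p"] by (simp add: add.commute)
  have e2: "(LINT \<xi>|lborel. ?g (- \<xi> - p)) = (LINT \<xi>|lborel. ?g \<xi>)"
    using lborel_integral_affine[OF gm, of "-1" "- p"] by (simp add: add.commute)
  have "(LINT \<xi>|lborel. (cmod (packet G p \<xi>))\<^sup>2) \<le> (LINT \<xi>|lborel. 2 * ?g (\<xi> - p) + 2 * ?g (- \<xi> - p))"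
  proof (rule integral_mono[OF test_fun_norm_sq_integrable[OF packet_test_fun[OF G]]])
    show "integrable lborel (\<lambda>\<xi>. 2 * ?g (\<xi> - p) + 2 * ?g (- \<xi> - p))"
      using test_fun_norm_sq_integrable[OF t1] test_fun_norm_sq_integrable[OF t2] by simp
    fix \<xi>
    have "(cmod (packet G p \<xi>))\<^sup>2 \<le> (cmod (G (\<xi> - p)) + cmod (G (- \<xi> - p)))\<^sup>2"
      unfolding packet_def by (intro power_mono order_trans[OF norm_triangle_ineq]) auto
    also have "\<dots> \<le> 2 * ?g (\<xi> - p) + 2 * ?g (- \<xi> - p)"
      using zero_le_power2[of "cmod (G (\<xi> - p)) - cmod (G (- \<xi> - p))"]
      by (simp add: power2_sum power2_diff)
    finally show "(cmod (packet G p \<xi>))\<^sup>2 \<le> 2 * ?g (\<xi> - p) + 2 * ?g (- \<xi> - p)" .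
  qed
  also have "\<dots> = 4 * (LINT \<xi>|lborel. ?g \<xi>)"
    using test_fun_norm_sq_integrable[OF t1] test_fun_norm_sq_integrable[OF t2] e1 e2 by simp
  finally show ?thesis .
qed

text \<open>Since \<open>norm p = 2 ^ k\<close> and the profile is supported in a ball of less than half that radius,
  only the shells \<open>k - 1\<close>, \<open>k\<close> and \<open>k + 1\<close> contribute.\<close>

lemma Hdot_norm_packet_le:
  assumes m: "LP_cutoff m" and B: "\<And>\<xi>. \<bar>m \<xi>\<bar> \<le> B"
    and G: "test_fun G" "\<And>x. R < norm x \<Longrightarrow> G x = 0"
    and p: "norm p = 2 ^ k" "2 * R < 2 ^ k"
  shows "(Hdot_norm m s (\<lambda>x. Re (ift (packet G p) x)))\<^sup>2 \<le>
    48 * B\<^sup>2 * 2 powr (2 * \<bar>s\<bar>) * (2 ^ k) powr (2 * s) * (LINT x|lborel. (cmod (ift G x))\<^sup>2)"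
proof -
  let ?a = "packet G p"
  let ?\<theta> = "\<lambda>x. Re (ift ?a x)"
  define N where "N = (LINT \<xi>|lborel. (cmod (G \<xi>))\<^sup>2)"
  have N0: "0 \<le> N" unfolding N_def by simp
  have a: "test_fun ?a" by (rule packet_test_fun[OF G(1)])
  define Mq where "Mq q \<xi> = m ((2 powi (- (q + 1))) *\<^sub>R \<xi>) - m ((2 powi (- q)) *\<^sub>R \<xi>)" for q :: int and \<xi>
  have mt: "test_fun (\<lambda>\<xi>. of_real (m ((2 powi q) *\<^sub>R \<xi>)) * ?a \<xi>)" for q :: int
  proof (rule test_fun_mult[OF _ a])
    show "smooth (\<lambda>\<xi>. complex_of_real (m ((2 powi q) *\<^sub>R \<xi>)))"
      using smooth_bounded_linear[OF bounded_linear_of_real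
          smooth_affine[OF test_fun_smooth[OF LP_cutoff_test_fun(1)[OF m]], of "2 powi q" 0]] by simp
  qed
  have M_eq: "(\<lambda>\<xi>. of_real (Mq q \<xi>) * ?a \<xi>) = (\<lambda>\<xi>. of_real (m ((2 powi (- (q + 1))) *\<^sub>R \<xi>)) * ?a \<xi> +
      (-1) * (of_real (m ((2 powi (- q)) *\<^sub>R \<xi>)) * ?a \<xi>))" for q
    by (rule ext) (simp only: Mq_def of_real_diff, simp add: left_diff_distrib)
  have Mt: "test_fun (\<lambda>\<xi>. of_real (Mq q \<xi>) * ?a \<xi>)" for q
    unfolding M_eq by (intro test_fun_add test_fun_mult[OF smooth_const] mt)
  have P: "P_at m q ?\<theta> = ift (\<lambda>\<xi>. of_real (Mq q \<xi>) * ?a \<xi>)" for q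
  proof
    fix x
    have "ift (\<lambda>\<xi>. of_real (Mq q \<xi>) * ?a \<xi>) x = ift (\<lambda>\<xi>. of_real (m ((2 powi (- (q + 1))) *\<^sub>R \<xi>)) * ?a \<xi>) x +
        (-1) * ift (\<lambda>\<xi>. of_real (m ((2 powi (- q)) *\<^sub>R \<xi>)) * ?a \<xi>) x"
      unfolding M_eq ift_add[OF test_fun_integrable[OF mt] integrable_mult_right[OF test_fun_integrable[OF mt]]]
        ift_cmult ..
    then show "P_at m q ?\<theta> x = ift (\<lambda>\<xi>. of_real (Mq q \<xi>) * ?a \<xi>) x"
      unfolding P_at_def P_le_def fmult_Re_ift[OF a ift_packet_real[OF G(1)]] by simp
  qed
  have L2: "(L2_norm (P_at m q ?\<theta>))\<^sup>2 = (2 * pi)\<^sup>2 * (LINT \<xi>|lborel. (cmod (of_real (Mq q \<xi>) * ?a \<xi>))\<^sup>2)" for q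
    unfolding L2_norm_def P plancherel[OF Mt, symmetric] by simp
  let ?T = "{int k - 1, int k, int k + 1}"
  have zero: "of_real (Mq q \<xi>) * ?a \<xi> = 0" if q: "q \<notin> ?T" for q \<xi>
  proof (cases "?a \<xi> = 0")
    case False
    have n: "2 ^ k < 2 * norm \<xi>" "norm \<xi> < 2 * 2 ^ k"
      using packet_support[where G = G and R = R, OF G(2) False] p by auto
    have "q \<le> int k - 2 \<or> int k + 2 \<le> q" using q by auto
    then have "Mq q \<xi> = 0"
    proof
      assume q: "q \<le> int k - 2"
      have "1 < norm ((2 powi (- (q + 1))) *\<^sub>R \<xi>)" "1 < norm ((2 powi (- q)) *\<^sub>R \<xi>)"
        using powi_two_scale(2)[OF _ n(1), of "q + 1"] powi_two_scale(2)[OF _ n(1), of q] q by auto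
      then show ?thesis unfolding Mq_def by (simp only: LP_cutoff_test_fun(2)[OF m])
    next
      assume q: "int k + 2 \<le> q"
      have "norm ((2 powi (- (q + 1))) *\<^sub>R \<xi>) \<le> 1 / 2" "norm ((2 powi (- q)) *\<^sub>R \<xi>) \<le> 1 / 2"
        using powi_two_scale(1)[OF _ _ n(2), of "q + 1"] powi_two_scale(1)[OF _ _ n(2), of q] q by auto
      then show ?thesis unfolding Mq_def by (simp only: LP_cutoff_test_fun(3)[OF m])
    qed
    then show ?thesis by simp
  qed simp
  have L2_le: "(L2_norm (P_at m q ?\<theta>))\<^sup>2 \<le> (2 * pi)\<^sup>2 * (4 * B\<^sup>2 * (4 * N))" for q
  proof -
    have "(LINT \<xi>|lborel. (cmod (of_real (Mq q \<xi>) * ?a \<xi>))\<^sup>2) \<le> (LINT \<xi>|lborel. 4 * B\<^sup>2 * (cmod (?a \<xi>))\<^sup>2)"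
    proof (rule integral_mono[OF test_fun_norm_sq_integrable[OF Mt]])
      show "integrable lborel (\<lambda>\<xi>. 4 * B\<^sup>2 * (cmod (?a \<xi>))\<^sup>2)"
        by (intro integrable_mult_right test_fun_norm_sq_integrable a)
      fix \<xi>
      have "\<bar>Mq q \<xi>\<bar> \<le> 2 * B" unfolding Mq_def
        using B[of "(2 powi (- (q + 1))) *\<^sub>R \<xi>"] B[of "(2 powi (- q)) *\<^sub>R \<xi>"] by linarith
      then have "\<bar>Mq q \<xi>\<bar>\<^sup>2 \<le> (2 * B)\<^sup>2" by (intro power_mono) auto
      then show "(cmod (of_real (Mq q \<xi>) * ?a \<xi>))\<^sup>2 \<le> 4 * B\<^sup>2 * (cmod (?a \<xi>))\<^sup>2"
        by (simp add: norm_mult power_mult_distrib mult_right_mono)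
    qed
    also have "\<dots> = 4 * B\<^sup>2 * (LINT \<xi>|lborel. (cmod (?a \<xi>))\<^sup>2)" by (rule integral_mult_right_zero)
    also have "\<dots> \<le> 4 * B\<^sup>2 * (4 * N)"
      unfolding N_def by (intro mult_left_mono integral_packet_sq_le[OF G(1)]) auto
    finally show ?thesis unfolding L2 by (intro mult_left_mono) auto
  qed
  have powr_le: "(2 powr (s * real_of_int q))\<^sup>2 \<le> 2 powr (2 * \<bar>s\<bar>) * (2 ^ k) powr (2 * s)" if "q \<in> ?T" for q
  proof -
    have qk: "\<bar>real_of_int q - real k\<bar> \<le> 1" using that by auto
    have "s * (real_of_int q - real k) \<le> \<bar>s\<bar> * \<bar>real_of_int q - real k\<bar>"
      by (metis abs_ge_self abs_mult)
    also have "\<dots> \<le> \<bar>s\<bar> * 1" using qk by (intro mult_left_mono) auto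
    finally have le: "2 * (s * real_of_int q) \<le> 2 * \<bar>s\<bar> + real k * (2 * s)" by (simp add: algebra_simps)
    have "(2 powr (s * real_of_int q))\<^sup>2 = 2 powr (2 * (s * real_of_int q))"
      by (simp add: powr_power mult.commute)
    also have "\<dots> \<le> 2 powr (2 * \<bar>s\<bar> + real k * (2 * s))" using le by (intro powr_mono) auto
    also have "\<dots> = 2 powr (2 * \<bar>s\<bar>) * (2 powr real k) powr (2 * s)" by (simp only: powr_add powr_powr)
    finally show ?thesis by (simp add: powr_realpow)
  qed
  let ?f = "\<lambda>q. (2 powr (s * real_of_int q) * L2_norm (P_at m q ?\<theta>))\<^sup>2"
  have f0: "?f q = 0" if "q \<notin> ?T" for q
    using L2[of q] zero[OF that] by (simp add: power_mult_distrib)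
  have fle: "?f q \<le> 2 powr (2 * \<bar>s\<bar>) * (2 ^ k) powr (2 * s) * ((2 * pi)\<^sup>2 * (4 * B\<^sup>2 * (4 * N)))" if "q \<in> ?T" for q
    unfolding power_mult_distrib[of "2 powr (s * real_of_int q)"]
    by (intro mult_mono powr_le[OF that] L2_le) auto
  have "(Hdot_norm m s ?\<theta>)\<^sup>2 = (\<Sum>\<^sub>\<infinity>q\<in>(UNIV::int set). ?f q)"
    unfolding Hdot_norm_def by (intro real_sqrt_pow2 infsum_nonneg) simp
  also have "\<dots> = (\<Sum>\<^sub>\<infinity>q\<in>?T. ?f q)" by (rule infsum_cong_neutral) (use f0 in auto)
  also have "\<dots> = (\<Sum>q\<in>?T. ?f q)" by (rule infsum_finite) simp
  also have "\<dots> \<le> (\<Sum>q\<in>?T. 2 powr (2 * \<bar>s\<bar>) * (2 ^ k) powr (2 * s) * ((2 * pi)\<^sup>2 * (4 * B\<^sup>2 * (4 * N))))"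
    by (rule sum_mono) (rule fle)
  also have "\<dots> = 48 * B\<^sup>2 * 2 powr (2 * \<bar>s\<bar>) * (2 ^ k) powr (2 * s) * ((2 * pi)\<^sup>2 * N)"
    by (simp add: mult_ac)
  finally show ?thesis unfolding plancherel[OF G(1)] N_def .
qed

section \<open>From averaged to pointwise bounds\<close>

lemma perp_hess_weak_bound:
  assumes m: "LP_cutoff m" and B: "\<And>\<xi>. \<bar>m \<xi>\<bar> \<le> B" and s: "s = -1 + \<delta>" "s \<noteq> 0"
    and \<phi>: "test_fun \<phi>" and A: "0 \<le> A"
    and form: "\<And>\<theta>. \<theta> \<in> S0 \<Longrightarrow> cmod (mSQG_form \<delta> \<phi> \<theta>) \<le> A * (Hdot_norm m s \<theta>)\<^sup>2"
    and w: "norm w = 1" and G: "test_fun G"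
  shows "\<bar>LINT x|lborel. perp_hess w \<phi> x * (cmod (ift G x))\<^sup>2\<bar> \<le>
    24 * B\<^sup>2 * 2 powr (2 * \<bar>s\<bar>) / \<bar>s\<bar> * A * (LINT x|lborel. (cmod (ift G x))\<^sup>2)"
proof -
  obtain R where R: "0 < R" "\<And>x. R < norm x \<Longrightarrow> G x = 0" by (rule test_funE[OF G]) (rule that)
  obtain n0 :: nat where n0: "2 * R < 2 ^ n0" using real_arch_pow[of 2 "2 * R"] by auto
  \<comment> \<open>dyadic frequencies, all of them larger than twice the radius of the support\<close>
  define l :: "nat \<Rightarrow> real" where "l n = 2 ^ (n + n0)" for n
  have l2: "2 * R < l n" for n
  proof -
    have "(2::real) ^ n0 \<le> l n" unfolding l_def by (intro power_increasing) auto
    with n0 show ?thesis by linarith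
  qed
  have lpos: "0 < l n" for n by (simp add: l_def)
  have l: "filterlim l at_top sequentially"
  proof -
    have "filterlim (\<lambda>n. (2::real) ^ n) at_top sequentially"
      by (rule filterlim_at_infinity_imp_filterlim_at_top[OF filterlim_realpow_sequentially_gt1]) auto
    then show ?thesis unfolding l_def
      by (rule filterlim_compose) (rule filterlim_add_const_nat_at_top)
  qed
  let ?\<theta> = "\<lambda>n x. Re (ift (packet G (l n *\<^sub>R w)) x)"
  let ?N = "LINT x|lborel. (cmod (ift G x))\<^sup>2"
  define c where "c = 48 * B\<^sup>2 * 2 powr (2 * \<bar>s\<bar>)"
  have bound: "cmod (of_real (l n powr (-2 * s)) * mSQG_form \<delta> \<phi> (?\<theta> n)) \<le> A * (c * ?N)" for n
  proof -
    have p: "norm (l n *\<^sub>R w) = 2 ^ (n + n0)" using w lpos[of n] by (simp add: l_def)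
    have "?\<theta> n \<in> S0"
      by (rule packet_in_S0[OF G R(2)]) (use p R(1) l2[of n] in \<open>auto simp: l_def\<close>)
    then have "cmod (mSQG_form \<delta> \<phi> (?\<theta> n)) \<le> A * (Hdot_norm m s (?\<theta> n))\<^sup>2" by (rule form)
    also have "\<dots> \<le> A * (c * (l n) powr (2 * s) * ?N)"
      unfolding c_def l_def
      using Hdot_norm_packet_le[where G = G and R = R and s = s, OF m B G R(2) p] l2[of n] A
      by (intro mult_left_mono) (auto simp: l_def)
    finally have "l n powr (-2 * s) * cmod (mSQG_form \<delta> \<phi> (?\<theta> n)) \<le>
        l n powr (-2 * s) * (A * (c * (l n) powr (2 * s) * ?N))"
      by (intro mult_left_mono) auto
    also have "\<dots> = (l n powr (-2 * s) * l n powr (2 * s)) * (A * (c * ?N))" by (simp only: mult_ac)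
    also have "l n powr (-2 * s) * l n powr (2 * s) = 1"
      using lpos[of n] by (simp add: powr_add[symmetric])
    finally show ?thesis by (simp add: norm_mult)
  qed
  have "cmod (of_real (-2 * s * (LINT x|lborel. perp_hess w \<phi> x * (cmod (ift G x))\<^sup>2))) \<le> A * (c * ?N)"
    by (rule LIMSEQ_le_const2[OF tendsto_norm[OF mSQG_form_packet_limit[OF w G R(2) R(1) l _ \<phi> s(1)]]])
      (use bound l2 less_imp_le in auto)
  then have "2 * \<bar>s\<bar> * \<bar>LINT x|lborel. perp_hess w \<phi> x * (cmod (ift G x))\<^sup>2\<bar> \<le> A * (c * ?N)"
    unfolding norm_of_real abs_mult by simp
  then have "\<bar>LINT x|lborel. perp_hess w \<phi> x * (cmod (ift G x))\<^sup>2\<bar> \<le> A * (c * ?N) / (2 * \<bar>s\<bar>)"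
    using s(2) by (simp add: field_simps)
  then show ?thesis by (simp add: c_def mult_ac)
qed

text \<open>Testing against translated and concentrated copies of one profile turns the averaged bound into
  a pointwise one.\<close>

lemma pointwise_from_averages:
  fixes \<Psi> :: "real^2 \<Rightarrow> real"
  assumes \<Psi>: "continuous_on UNIV \<Psi>" "\<And>x. \<bar>\<Psi> x\<bar> \<le> M"
    and G0: "test_fun G0" "0 < (LINT x|lborel. (cmod (ift G0 x))\<^sup>2)"
    and avg: "\<And>G. test_fun G \<Longrightarrow>
      \<bar>LINT x|lborel. \<Psi> x * (cmod (ift G x))\<^sup>2\<bar> \<le> \<kappa> * (LINT x|lborel. (cmod (ift G x))\<^sup>2)"
  shows "\<bar>\<Psi> x0\<bar> \<le> \<kappa>"
proof -
  define c where "c n = 1 / real (Suc n)" for n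
  have c: "0 < c n" for n by (simp add: c_def)
  have c0: "c \<longlonglongrightarrow> 0"
    unfolding c_def using LIMSEQ_inverse_real_of_nat by (simp add: inverse_eq_divide)
  \<comment> \<open>the inverse transform of \<open>G n\<close> is that of \<open>G0\<close>, moved to \<open>x0\<close>,
    shrunk by \<open>c n\<close> and multiplied by a constant\<close>
  define G where "G n u = (1 * cis ((- x0) \<bullet> u)) * G0 (c n *\<^sub>R u + 0)" for n u
  have Gt: "test_fun (G n)" for n
    unfolding G_def using c[of n]
    by (intro test_fun_mult[OF smooth_cis_inner] test_fun_affine G0(1)) auto
  have G0m[measurable]: "G0 \<in> borel_measurable borel"
    using test_fun_integrable[OF G0(1)] by auto
  have Ec: "continuous_on UNIV (ift G0)" by (rule ift_continuous[OF test_fun_cs_int[OF G0(1)]])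
  have ift_G: "ift (G n) x = of_real (1 / (c n)\<^sup>2) * ift G0 ((1 / c n) *\<^sub>R (x - x0))" for n x
  proof -
    let ?f = "\<lambda>u. cis (((1 / c n) *\<^sub>R (x - x0)) \<bullet> u) * G0 u"
    have "?f \<in> borel_measurable borel"
      by (intro borel_measurable_continuous_onI continuous_intros smooth_continuous test_fun_smooth G0(1))
    then have "(LINT u|lborel. ?f (0 + c n *\<^sub>R u)) = (1 / \<bar>c n\<bar> ^ DIM(real^2)) *\<^sub>R (LINT u|lborel. ?f u)"
      using c[of n] by (intro lborel_integral_affine) auto
    moreover have "(\<lambda>u. ?f (0 + c n *\<^sub>R u)) = (\<lambda>u. cis (x \<bullet> u) * G n u)"
    proof
      fix u
      have "cis (((1 / c n) *\<^sub>R (x - x0)) \<bullet> (0 + c n *\<^sub>R u)) = cis (x \<bullet> u) * cis ((- x0) \<bullet> u)"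
        using c[of n] by (simp add: cis_mult inner_diff_left)
      then show "?f (0 + c n *\<^sub>R u) = cis (x \<bullet> u) * G n u" by (simp add: G_def)
    qed
    ultimately show ?thesis unfolding ift_def scaleR_conv_of_real[where 'a=complex] by simp
  qed
  have scale: "(LINT x|lborel. F x * (cmod (ift (G n) x))\<^sup>2) =
      1 / (c n)\<^sup>2 * (LINT y|lborel. F (x0 + c n *\<^sub>R y) * (cmod (ift G0 y))\<^sup>2)"
    if F: "continuous_on UNIV F" for F :: "real^2 \<Rightarrow> real" and n
  proof -
    let ?g = "\<lambda>x. F x * (cmod (ift G0 ((1 / c n) *\<^sub>R (x - x0))))\<^sup>2"
    have "continuous_on UNIV ?g"
      by (intro continuous_intros F continuous_on_compose2[OF Ec]) auto
    then have g: "?g \<in> borel_measurable borel" by (rule borel_measurable_continuous_onI)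
    have I: "(LINT y|lborel. ?g (x0 + c n *\<^sub>R y)) = (1 / \<bar>c n\<bar> ^ DIM(real^2)) *\<^sub>R (LINT x|lborel. ?g x)"
      using c[of n] by (intro lborel_integral_affine[OF g]) auto
    have eq: "(\<lambda>y. ?g (x0 + c n *\<^sub>R y)) = (\<lambda>y. F (x0 + c n *\<^sub>R y) * (cmod (ift G0 y))\<^sup>2)"
      using less_imp_neq[OF c[of n]] by simp
    have "(LINT x|lborel. F x * (cmod (ift (G n) x))\<^sup>2) = (LINT x|lborel. (1 / (c n)\<^sup>2)\<^sup>2 * ?g x)"
      unfolding ift_G norm_mult norm_of_real power_mult_distrib by (simp add: mult_ac)
    also have "\<dots> = (1 / (c n)\<^sup>2)\<^sup>2 * (LINT x|lborel. ?g x)" by (rule integral_mult_right_zero)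
    also have "(LINT x|lborel. ?g x) = (c n)\<^sup>2 * (LINT y|lborel. F (x0 + c n *\<^sub>R y) * (cmod (ift G0 y))\<^sup>2)"
      using I[unfolded eq] c[of n] by (simp add: field_simps power2_eq_square)
    finally show ?thesis using c[of n] by (simp add: power2_eq_square)
  qed
  let ?N = "LINT x|lborel. (cmod (ift G0 x))\<^sup>2"
  have le: "\<bar>LINT y|lborel. \<Psi> (x0 + c n *\<^sub>R y) * (cmod (ift G0 y))\<^sup>2\<bar> \<le> \<kappa> * ?N" for n
  proof -
    have "\<bar>1 / (c n)\<^sup>2 * (LINT y|lborel. \<Psi> (x0 + c n *\<^sub>R y) * (cmod (ift G0 y))\<^sup>2)\<bar> \<le>
        \<kappa> * (1 / (c n)\<^sup>2 * ?N)"
      using avg[OF Gt[of n]] scale[OF \<Psi>(1), of n] scale[of "\<lambda>_. 1" n] by simp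
    then have "1 / (c n)\<^sup>2 * \<bar>LINT y|lborel. \<Psi> (x0 + c n *\<^sub>R y) * (cmod (ift G0 y))\<^sup>2\<bar> \<le>
        1 / (c n)\<^sup>2 * (\<kappa> * ?N)"
      by (simp add: abs_mult mult_ac)
    then show ?thesis using c[of n] by (simp add: divide_le_cancel)
  qed
  have "(\<lambda>n. LINT y|lborel. \<Psi> (x0 + c n *\<^sub>R y) * (cmod (ift G0 y))\<^sup>2) \<longlonglongrightarrow>
      (LINT y|lborel. \<Psi> x0 * (cmod (ift G0 y))\<^sup>2)"
  proof (rule integral_dominated_convergence[where w="\<lambda>y. M * (cmod (ift G0 y))\<^sup>2"])
    show "integrable lborel (\<lambda>y. M * (cmod (ift G0 y))\<^sup>2)"
      by (intro integrable_mult_right integrable_norm_ift_sq G0(1))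
    show "AE y in lborel. (\<lambda>n. \<Psi> (x0 + c n *\<^sub>R y) * (cmod (ift G0 y))\<^sup>2) \<longlonglongrightarrow> \<Psi> x0 * (cmod (ift G0 y))\<^sup>2"
    proof (intro AE_I2 tendsto_mult tendsto_const)
      fix y
      have "(\<lambda>n. \<Psi> (x0 + c n *\<^sub>R y)) \<longlonglongrightarrow> \<Psi> (x0 + 0 *\<^sub>R y)"
        by (rule continuous_on_tendsto_compose[OF \<Psi>(1) tendsto_add[OF tendsto_const tendsto_scaleR[OF c0 tendsto_const]]]) auto
      then show "(\<lambda>n. \<Psi> (x0 + c n *\<^sub>R y)) \<longlonglongrightarrow> \<Psi> x0" by simp
    qed
    show "AE y in lborel. norm (\<Psi> (x0 + c n *\<^sub>R y) * (cmod (ift G0 y))\<^sup>2) \<le> M * (cmod (ift G0 y))\<^sup>2" for n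
      by (intro AE_I2) (simp add: abs_mult mult_right_mono[OF \<Psi>(2)])
    have "continuous_on UNIV (\<lambda>y. \<Psi> (x0 + r *\<^sub>R y) * (cmod (ift G0 y))\<^sup>2)" for r
      by (intro continuous_intros Ec continuous_on_compose2[OF \<Psi>(1)]) auto
    note m = borel_measurable_continuous_onI[OF this]
    show "(\<lambda>y. \<Psi> (x0 + c n *\<^sub>R y) * (cmod (ift G0 y))\<^sup>2) \<in> borel_measurable lborel" for n
      using m[of "c n"] by simp
    show "(\<lambda>y. \<Psi> x0 * (cmod (ift G0 y))\<^sup>2) \<in> borel_measurable lborel" using m[of 0] by simp
  qed
  then have "(\<lambda>n. \<bar>LINT y|lborel. \<Psi> (x0 + c n *\<^sub>R y) * (cmod (ift G0 y))\<^sup>2\<bar>) \<longlonglongrightarrow> \<bar>\<Psi> x0 * ?N\<bar>"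
    using tendsto_rabs by fastforce
  then have "\<bar>\<Psi> x0 * ?N\<bar> \<le> \<kappa> * ?N" by (rule LIMSEQ_le_const2) (use le in auto)
  then show ?thesis using G0(2) by (simp add: abs_mult)
qed

lemma integral_ift_cutoff_pos:
  assumes m: "LP_cutoff m"
  shows "0 < (LINT x|lborel. (cmod (ift (\<lambda>\<xi>. of_real (m \<xi>)) x))\<^sup>2)"
proof -
  let ?c = "cball (0::real^2) (1 / 2)"
  have t: "test_fun (\<lambda>\<xi>. complex_of_real (m \<xi>))"
    by (rule test_fun_bounded_linear[OF bounded_linear_of_real LP_cutoff_test_fun(1)[OF m]])
  have sq: "test_fun (\<lambda>\<xi>. m \<xi> * m \<xi>)"
    by (intro test_fun_mult test_fun_smooth LP_cutoff_test_fun(1)[OF m])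
  have fin: "emeasure lborel ?c < \<infinity>" by (rule emeasure_lborel_cball_finite)
  have "0 < measure lborel ?c" by (simp add: content_cball_pos)
  also have "\<dots> = (LINT \<xi>|lborel. indicator ?c \<xi>)" by simp
  also have "\<dots> \<le> (LINT \<xi>|lborel. m \<xi> * m \<xi>)"
  proof (rule integral_mono)
    show "integrable lborel (\<lambda>\<xi>. indicator ?c \<xi> :: real)" using fin by (intro integrable_real_indicator) auto
    show "integrable lborel (\<lambda>\<xi>. m \<xi> * m \<xi>)" by (rule test_fun_integrable[OF sq])
    show "indicator ?c \<xi> \<le> m \<xi> * m \<xi>" for \<xi>
      using LP_cutoff_test_fun(3)[OF m, of \<xi>] by (cases "\<xi> \<in> ?c") auto
  qed
  finally show ?thesis unfolding plancherel[OF t] by (simp add: power2_eq_square)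
qed

lemma norm_matrix2_le:
  fixes A :: "real^2^2"
  shows "norm A \<le> \<bar>A $ 1 $ 1\<bar> + \<bar>A $ 1 $ 2\<bar> + (\<bar>A $ 2 $ 1\<bar> + \<bar>A $ 2 $ 2\<bar>)"
proof -
  have "norm A \<le> norm (A $ 1) + norm (A $ 2)"
    using L2_set_le_sum[of UNIV "\<lambda>i. norm (A $ i)"] by (simp add: norm_vec_def sum_2)
  then show ?thesis using norm_le_components[of "A $ 1"] norm_le_components[of "A $ 2"] by linarith
qed

text \<open>The coordinate directions control the mixed derivatives, and the diagonal direction then controls
  the difference of the pure ones. No symmetry of the mixed derivatives is used.\<close>

lemma tracefree_hessian_le:
  assumes "\<And>w. norm w = 1 \<Longrightarrow> \<bar>perp_hess w \<phi> x\<bar> \<le> \<kappa>"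
  shows "norm (tracefree_hessian \<phi> x) \<le> 6 * \<kappa>"
proof -
  let ?d = "\<lambda>i j. nabla i (nabla j \<phi>) x"
  let ?w = "(1 / sqrt 2) *\<^sub>R (axis 1 1 + axis 2 1) :: real^2"
  have c: "axis i (1::real) $ j = (if i = j then 1 else 0)" for i j :: 2 by (simp add: axis_def)
  have 1: "\<bar>?d 2 1\<bar> \<le> \<kappa>" using assms[of "axis 1 1"] by (simp add: perp_hess_def c norm_axis_1)
  have 2: "\<bar>?d 1 2\<bar> \<le> \<kappa>" using assms[of "axis 2 1"] by (simp add: perp_hess_def c norm_axis_1)
  have lin: "\<bar>1 / 2 * (b - a)\<bar> \<le> 2 * \<kappa>"
    if "\<bar>p\<bar> \<le> \<kappa>" "p = 1 / 2 * (c + b - a - d)" "\<bar>c\<bar> \<le> \<kappa>" "\<bar>d\<bar> \<le> \<kappa>" for a b c d p :: real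
    using that by (simp add: abs_le_iff)
  have "norm ?w = 1" by (simp add: norm_vec_def L2_set_def sum_2 c power_divide real_sqrt_divide)
  then have "\<bar>perp_hess ?w \<phi> x\<bar> \<le> \<kappa>" by (rule assms)
  moreover have "perp_hess ?w \<phi> x = 1 / 2 * (?d 2 1 + ?d 2 2 - ?d 1 1 - ?d 1 2)"
    by (simp add: perp_hess_def c algebra_simps)
  ultimately have 3: "\<bar>1 / 2 * (?d 2 2 - ?d 1 1)\<bar> \<le> 2 * \<kappa>" using 1 2 lin by blast
  have T: "tracefree_hessian \<phi> x $ i $ j = ?d i j - 1 / 2 * (?d 1 1 + ?d 2 2) * (if i = j then 1 else 0)" for i j
    by (simp add: tracefree_hessian_def laplacian_def sum_2)
  have diag: "\<bar>a - 1 / 2 * (a + b)\<bar> \<le> 2 * \<kappa>" "\<bar>b - 1 / 2 * (a + b)\<bar> \<le> 2 * \<kappa>"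
    if "\<bar>1 / 2 * (b - a)\<bar> \<le> 2 * \<kappa>" for a b :: real
    using that by (simp_all add: abs_le_iff field_simps)
  show ?thesis
    using norm_matrix2_le[of "tracefree_hessian \<phi> x"] 1 2 diag[OF 3] unfolding T by simp
qed

lemma tracefree_hessian_measurable:
  assumes "smooth \<phi>"
  shows "(\<lambda>x. ereal (norm (tracefree_hessian \<phi> x))) \<in> borel_measurable lborel"
proof -
  have d: "continuous_on UNIV (nabla i (nabla j \<phi>))" for i j
    by (intro smooth_continuous smooth_nabla assms)
  have "continuous_on UNIV (tracefree_hessian \<phi>)"
    unfolding tracefree_hessian_def[abs_def] laplacian_def
    by (intro continuous_on_vec_lambda continuous_intros d)
  then have "(\<lambda>x. norm (tracefree_hessian \<phi> x)) \<in> borel_measurable borel"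
    by (intro borel_measurable_continuous_onI continuous_intros)
  then show ?thesis by simp
qed

lemma Cc_smooth_test_fun:
  assumes "\<phi> \<in> Cc_smooth"
  shows "test_fun \<phi>"
proof -
  have "smooth \<phi>" "bounded (supp \<phi>)" using assms by (auto simp: Cc_smooth_def compact_imp_bounded)
  then obtain R where R: "\<And>x. x \<in> supp \<phi> \<Longrightarrow> norm x \<le> R" by (auto simp: bounded_iff)
  show ?thesis
  proof (rule test_funI[OF \<open>smooth \<phi>\<close>])
    fix x :: "real^2" assume x: "R < norm x"
    show "\<phi> x = 0"
    proof (rule ccontr)
      assume "\<phi> x \<noteq> 0"
      then have "x \<in> supp \<phi>" unfolding supp_def support_on_def using closure_subset by fastforce
      with R x show False by fastforce
    qed
  qed
qed

theorem theorem5: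
  fixes m :: "real^2 \<Rightarrow> real" and \<delta> C :: real
  assumes "LP_cutoff m" and "0 \<le> \<delta>" and "\<delta> \<noteq> 1"
  shows "\<exists>C'. \<forall>X. seminorm_on Cc_smooth X \<longrightarrow>
    (\<forall>\<phi>\<in>Cc_smooth. \<forall>\<theta>\<in>S0.
       cmod (mSQG_form \<delta> \<phi> \<theta>) \<le> C * X \<phi> * (Hdot_norm m (-1 + \<delta>) \<theta>)\<^sup>2) \<longrightarrow>
    (\<forall>\<phi>\<in>Cc_smooth. Linf_norm (tracefree_hessian \<phi>) \<le> ereal (C' * X \<phi>))"
proof -
  define s where "s = -1 + \<delta>"
  have s: "s = -1 + \<delta>" "s \<noteq> 0" using assms(3) by (auto simp: s_def)
  note m = assms(1)
  obtain B where B: "\<And>\<xi>. \<bar>m \<xi>\<bar> \<le> B"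
    using test_fun_bounded[OF LP_cutoff_test_fun(1)[OF m]] by (metis real_norm_def)
  define K where "K = 24 * B\<^sup>2 * 2 powr (2 * \<bar>s\<bar>) / \<bar>s\<bar>"
  show ?thesis
    \<comment> \<open>the absolute value of \<open>C\<close> covers a negative constant, for which the hypothesis is only stronger\<close>
  proof (intro exI[of _ "6 * (K * \<bar>C\<bar>)"] allI impI ballI)
    fix X \<phi>
    assume X: "seminorm_on Cc_smooth X"
      and form: "\<forall>\<phi>\<in>Cc_smooth. \<forall>\<theta>\<in>S0.
       cmod (mSQG_form \<delta> \<phi> \<theta>) \<le> C * X \<phi> * (Hdot_norm m (-1 + \<delta>) \<theta>)\<^sup>2"
      and \<phi>: "\<phi> \<in> Cc_smooth"
    have t: "test_fun \<phi>" by (rule Cc_smooth_test_fun[OF \<phi>])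
    have X0: "0 \<le> X \<phi>" using X \<phi> by (auto simp: seminorm_on_def)
    have form': "cmod (mSQG_form \<delta> \<phi> \<theta>) \<le> \<bar>C\<bar> * X \<phi> * (Hdot_norm m s \<theta>)\<^sup>2" if "\<theta> \<in> S0" for \<theta>
    proof -
      have "cmod (mSQG_form \<delta> \<phi> \<theta>) \<le> C * X \<phi> * (Hdot_norm m s \<theta>)\<^sup>2"
        using form \<phi> that by (simp add: s_def)
      also have "\<dots> \<le> \<bar>C\<bar> * X \<phi> * (Hdot_norm m s \<theta>)\<^sup>2"
        using X0 by (intro mult_right_mono) auto
      finally show ?thesis .
    qed
    have "\<bar>perp_hess w \<phi> x\<bar> \<le> K * (\<bar>C\<bar> * X \<phi>)" if w: "norm w = 1" for w x
    proof -
      have p: "test_fun (perp_hess w \<phi>)" by (rule perp_hess_test_fun[OF t])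
      obtain M where M: "\<And>x. norm (perp_hess w \<phi> x) \<le> M" by (rule test_fun_bounded[OF p]) (rule that)
      show ?thesis
      proof (rule pointwise_from_averages[OF smooth_continuous[OF test_fun_smooth[OF p]] _ _ integral_ift_cutoff_pos[OF m]])
        show "\<bar>perp_hess w \<phi> x\<bar> \<le> M" for x using M[of x] by simp
        show "test_fun (\<lambda>\<xi>. complex_of_real (m \<xi>))"
          by (rule test_fun_bounded_linear[OF bounded_linear_of_real LP_cutoff_test_fun(1)[OF m]])
        show "\<bar>LINT x|lborel. perp_hess w \<phi> x * (cmod (ift G x))\<^sup>2\<bar> \<le>
            K * (\<bar>C\<bar> * X \<phi>) * (LINT x|lborel. (cmod (ift G x))\<^sup>2)" if "test_fun G" for G
          unfolding K_def by (rule perp_hess_weak_bound[OF m B s t _ form' w that]) (use X0 in auto)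
      qed
    qed
    then have "norm (tracefree_hessian \<phi> x) \<le> 6 * (K * (\<bar>C\<bar> * X \<phi>))" for x
      by (rule tracefree_hessian_le)
    then show "Linf_norm (tracefree_hessian \<phi>) \<le> ereal (6 * (K * \<bar>C\<bar>) * X \<phi>)"
      unfolding Linf_norm_def
      by (intro esssup_I tracefree_hessian_measurable test_fun_smooth[OF t] AE_I2) (simp add: mult_ac)
  qed
qed

end
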